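(* Let $G$ be an essentially simple, essentially $3$-connected geodesic drawing on the square flat torus $\mathbb{T}_\square$, homotopic to an embedding, with a (not necessarily positive) equilibrium stress $\omega$. Write the displacement vector of edge $e$ (for its reference dart) as $(\Delta x_e,\Delta y_e)^T$, and let $\alpha=\sum_e \omega_e \Delta x_e^2$, $\beta=\sum_e\omega_e\Delta y_e^2$, $\gamma=\sum_e\omega_e\Delta x_e\Delta y_e$. If $\alpha\beta-\gamma^2=1$, then for every non-singular real $2\times 2$ matrix $M$, $\omega$ is an orthogonal reciprocal stress for the image of $G$ on $\mathbb{T}_M$ if and only if $M=\sigma R\begin{pmatrix}\beta & -\gamma\\ 0 & 1\end{pmatrix}$ for some rotation matrix $R$ and some real number $\sigma>0$. On the other hand, if $\alpha\beta-\gamma^2\neq 1$, then $\omega$ is not an orthogonal reciprocal stress for the image of $G$ on any flat torus.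
   Context: Flat tori. For a non-singular real $2\times2$ matrix $M$, $\mathbb{T}_M=\mathbb{R}^2/M\mathbb{Z}^2$; $\mathbb{T}_\square=\mathbb{T}_I=\mathbb{R}^2/\mathbb{Z}^2$ is the square (reference) flat torus. The linear map $M$ induces a homeomorphism $\mathbb{T}_\square\to\mathbb{T}_M$; the image of a drawing under this map (or its inverse) is called its image on $\mathbb{T}_M$ (or on $\mathbb{T}_\square$). "Any flat torus" means $\mathbb{T}_M$ for any non-singular $M$. Drawings. A drawing of a finite graph (loops and parallel edges allowed) on a torus is a continuous map from the graph, as a topological space, to the torus; an embedding is an injective drawing, and embeddings are assumed cellular (all faces are open disks). A drawing is geodesic if every edge is mapped to a geodesic (straight) path. All drawings of $G$ are homotopic to an embedding of $G$; duality is defined through that embedding. $G$ is essentially simple (essentially $3$-connected) if the lift of the embedding to the universal cover $\mathbb{R}^2$ is a simple ($3$-connected) infinite graph. Darts and displacements. Each edge consists of two opposite darts (orientations), and one of them is fixed as the reference dart of $e$. The displacement vector $\Delta_d\in\mathbb{R}^2$ of a dart $d$ in a geodesic drawing on $\mathbb{T}_M$ is the head minus the tail of any lift of $d$ to $\mathbb{R}^2$; opposite darts have opposite displacements. Stress. An equilibrium stress assigns a non-zero real weight $\omega_e$ to each edge such that for every vertex $p$, $\sum_{d:\,\mathrm{tail}(d)=p}\omega_d\Delta_d=0$, where $\omega_d=\omega_e$ for both darts $d$ of $e$. (This condition is preserved under taking images on other flat tori.) Dual. The natural embedding of the dual graph $G^*$ of an embedded graph $G$ on $\mathbb{T}_\square$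 has one vertex $f^*$ inside each face $f$ of $G$, and each dual edge $e^*$ crosses only $e$; the dual dart $d^*$ is directed from the face to the right of $d$ to the face to the left of $d$. A drawing of $G^*$ on $\mathbb{T}_M$ is dual to $G$ if its image on $\mathbb{T}_\square$ is homotopic to the natural embedding of $G^*$. Orthogonal reciprocal stress. An equilibrium stress $\omega$ is an orthogonal reciprocal stress for a geodesic drawing $G$ on $\mathbb{T}_M$ if there is a geodesic drawing of $G^*$ (not necessarily an embedding) on the same flat torus $\mathbb{T}_M$, dual to $G$, in which each dual edge $e^*$ is orthogonal to $e$ and $\omega_e=|e^*|/|e|$, where lengths are signed: precisely, $\Delta_{d^*}=\omega_e\,J\,\Delta_d$ for each dart $d$ of each edge $e$, with $J=\begin{pmatrix}0&-1\\1&0\end{pmatrix}$. *)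

theory Defs
  imports
    "Graph_Theory.Digraph_Component"
    "HOL-Complex_Analysis.Complex_Analysis"
begin

section \<open>Flat tori\<close>

definition quotient_topology :: "'a topology \<Rightarrow> ('a \<Rightarrow> 'b) \<Rightarrow> 'b topology" where
  "quotient_topology X q =
     topology (\<lambda>U. U \<subseteq> q ` topspace X \<and> openin X {x \<in> topspace X. q x \<in> U})"

lemma openin_quotient_topology:
  "openin (quotient_topology X q) U \<longleftrightarrow>
     U \<subseteq> q ` topspace X \<and> openin X {x \<in> topspace X. q x \<in> U}"
proof -
  have "istopology (\<lambda>U. U \<subseteq> q ` topspace X \<and> openin X {x \<in> topspace X. q x \<in> U})"
    unfolding istopology_def
  proof (intro conjI allI impI; (elim conjE)?)
    fix S T
    assume "openin X {x \<in> topspace X. q x \<in> S}" "openin X {x \<in> topspace X. q x \<in> T}"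
    moreover have "{x \<in> topspace X. q x \<in> S \<inter> T} =
        {x \<in> topspace X. q x \<in> S} \<inter> {x \<in> topspace X. q x \<in> T}"
      by blast
    ultimately show "openin X {x \<in> topspace X. q x \<in> S \<inter> T}"
      by (simp only: openin_Int)
  next
    fix K
    assume K: "\<forall>S\<in>K. S \<subseteq> q ` topspace X \<and> openin X {x \<in> topspace X. q x \<in> S}"
    have "{x \<in> topspace X. q x \<in> \<Union>K} = \<Union>((\<lambda>S. {x \<in> topspace X. q x \<in> S}) ` K)"
      by blast
    also have "openin X \<dots>"
      using K by (intro openin_Union) auto
    finally show "openin X {x \<in> topspace X. q x \<in> \<Union>K}" .
  qed auto
  then show ?thesis
    by (simp add: quotient_topology_def)
qed

definition torus_lattice :: "real^2^2 \<Rightarrow> (real^2) set" where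
  "torus_lattice M = (*v) M ` {z. \<forall>i. z $ i \<in> \<int>}"

definition torus_proj :: "real^2^2 \<Rightarrow> real^2 \<Rightarrow> (real^2) set" where
  "torus_proj M x = (+) x ` torus_lattice M"

definition torus :: "real^2^2 \<Rightarrow> (real^2) set topology" where
  "torus M = quotient_topology euclidean (torus_proj M)"

lemma topspace_torus: "topspace (torus M) = range (torus_proj M)"
proof -
  have "openin (torus M) (range (torus_proj M))"
    by (simp add: torus_def openin_quotient_topology)
  moreover have "topspace (torus M) \<subseteq> range (torus_proj M)"
    using openin_topspace[of "torus M"] unfolding torus_def openin_quotient_topology by simp
  ultimately show ?thesis
    using openin_subset by blast
qed

abbreviation square :: "real^2^2" where
  "square \<equiv> mat 1"

text \<open>The map induced by \<open>M\<close> on cosets. It sends \<open>x + \<int>\<^sup>2\<close> to \<open>M x + M \<int>\<^sup>2\<close>, and for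
  \<open>matrix_inv M\<close> in place of \<open>M\<close> it goes back from \<open>torus M\<close> to \<open>torus square\<close>.\<close>

definition torus_map :: "real^2^2 \<Rightarrow> (real^2) set \<Rightarrow> (real^2) set" where
  "torus_map M c = (*v) M ` c"

lemma torus_map_proj: "torus_map M (torus_proj square x) = torus_proj M (M *v x)"
  by (simp add: torus_map_def torus_proj_def torus_lattice_def image_image
      matrix_vector_right_distrib)


section \<open>Graphs as topological spaces, and their drawings\<close>

text \<open>A graph with loops and parallel edges is given by a digraph, whose arcs are the edges and
  whose arc orientations are the reference darts.\<close>

datatype ('v, 'e) graph_point = Vertex 'v | Interior 'e real

definition graph_points :: "('v, 'e) pre_digraph \<Rightarrow> ('v, 'e) graph_point set" where
  "graph_points G = Vertex ` verts G \<union> {Interior e t | e t. e \<in> arcs G \<and> 0 < t \<and> t < 1}"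

definition edge_param :: "('v, 'e) pre_digraph \<Rightarrow> 'e \<Rightarrow> real \<Rightarrow> ('v, 'e) graph_point" where
  "edge_param G e t =
     (if t = 0 then Vertex (tail G e) else if t = 1 then Vertex (head G e) else Interior e t)"

text \<open>The quotient topology on the disjoint union of the vertices and one copy of \<open>[0,1]\<close>
  per edge, with the ends of the copies glued to the vertices.\<close>

definition graph_space :: "('v, 'e) pre_digraph \<Rightarrow> ('v, 'e) graph_point topology" where
  "graph_space G = topology (\<lambda>U. U \<subseteq> graph_points G \<and>
     (\<forall>e\<in>arcs G. openin (top_of_set {0..1}) {t \<in> {0..1}. edge_param G e t \<in> U}))"

lemma openin_graph_space:
  "openin (graph_space G) U \<longleftrightarrow> U \<subseteq> graph_points G \<and>
     (\<forall>e\<in>arcs G. openin (top_of_set {0..1}) {t \<in> {0..1}. edge_param G e t \<in> U})"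
proof -
  have "istopology (\<lambda>U. U \<subseteq> graph_points G \<and>
     (\<forall>e\<in>arcs G. openin (top_of_set {0..1}) {t \<in> {0..1}. edge_param G e t \<in> U}))"
    unfolding istopology_def
  proof (intro conjI allI impI ballI; (elim conjE)?)
    fix S T e
    assume "\<forall>e\<in>arcs G. openin (top_of_set {0..1}) {t \<in> {0..1}. edge_param G e t \<in> S}"
      "\<forall>e\<in>arcs G. openin (top_of_set {0..1}) {t \<in> {0..1}. edge_param G e t \<in> T}" "e \<in> arcs G"
    moreover have "{t \<in> {0..1}. edge_param G e t \<in> S \<inter> T} =
        {t \<in> {0..1}. edge_param G e t \<in> S} \<inter> {t \<in> {0..1}. edge_param G e t \<in> T}"
      by blast
    ultimately show "openin (top_of_set {0..1}) {t \<in> {0..1}. edge_param G e t \<in> S \<inter> T}"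
      by (simp only: openin_Int)
  next
    fix K e
    assume K: "\<forall>S\<in>K. S \<subseteq> graph_points G \<and>
        (\<forall>e\<in>arcs G. openin (top_of_set {0..1}) {t \<in> {0..1}. edge_param G e t \<in> S})"
      and e: "e \<in> arcs G"
    have "{t \<in> {0..1}. edge_param G e t \<in> \<Union>K} =
        \<Union>((\<lambda>S. {t \<in> {0..1}. edge_param G e t \<in> S}) ` K)"
      by blast
    also have "openin (top_of_set {0..1}) \<dots>"
      using K e by (intro openin_Union) auto
    finally show "openin (top_of_set {0..1}) {t \<in> {0..1}. edge_param G e t \<in> \<Union>K}" .
  qed auto
  then show ?thesis
    by (simp add: graph_space_def)
qed

lemma topspace_graph_space:
  assumes "wf_digraph G"
  shows "topspace (graph_space G) = graph_points G"
proof -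
  have "{t \<in> {0..1}. edge_param G e t \<in> graph_points G} = {0..1}" if "e \<in> arcs G" for e
    using that assms by (auto simp: edge_param_def graph_points_def wf_digraph_def)
  then have "openin (graph_space G) (graph_points G)"
    by (simp add: openin_graph_space)
  moreover have "topspace (graph_space G) \<subseteq> graph_points G"
    using openin_topspace[of "graph_space G"] unfolding openin_graph_space by simp
  ultimately show ?thesis
    using openin_subset by blast
qed

type_synonym ('v, 'e) torus_drawing = "('v, 'e) graph_point \<Rightarrow> (real^2) set"

definition drawing :: "real^2^2 \<Rightarrow> ('v, 'e) pre_digraph \<Rightarrow> ('v, 'e) torus_drawing \<Rightarrow> bool" where
  "drawing M G f \<longleftrightarrow> fin_digraph G \<and> continuous_map (graph_space G) (torus M) f"

definition edge_path ::
    "('v, 'e) pre_digraph \<Rightarrow> ('v, 'e) torus_drawing \<Rightarrow> 'e \<Rightarrow> real \<Rightarrow> (real^2) set" where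
  "edge_path G f e t = f (edge_param G e t)"

definition faces ::
    "real^2^2 \<Rightarrow> ('v, 'e) pre_digraph \<Rightarrow> ('v, 'e) torus_drawing \<Rightarrow> (real^2) set set set" where
  "faces M G f = connected_components_of
     (subtopology (torus M) (topspace (torus M) - f ` topspace (graph_space G)))"

text \<open>Embeddings are cellular by convention.\<close>

definition embedding :: "real^2^2 \<Rightarrow> ('v, 'e) pre_digraph \<Rightarrow> ('v, 'e) torus_drawing \<Rightarrow> bool" where
  "embedding M G f \<longleftrightarrow> drawing M G f \<and> inj_on f (topspace (graph_space G)) \<and>
     (\<forall>F\<in>faces M G f. subtopology (torus M) F homeomorphic_space
                        top_of_set (ball (0 :: real^2) 1))"

definition homotopic_drawings ::
    "real^2^2 \<Rightarrow> ('v, 'e) pre_digraph \<Rightarrow> ('v, 'e) torus_drawing \<Rightarrow> ('v, 'e) torus_drawing \<Rightarrow> bool"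
  where
  "homotopic_drawings M G f g \<longleftrightarrow> homotopic_with (\<lambda>_. True) (graph_space G) (torus M) f g"

definition geodesic_path :: "real^2^2 \<Rightarrow> (real \<Rightarrow> (real^2) set) \<Rightarrow> bool" where
  "geodesic_path M p \<longleftrightarrow> (\<exists>x v. \<forall>t\<in>{0..1}. p t = torus_proj M (x + t *\<^sub>R v))"

definition geodesic_drawing ::
    "real^2^2 \<Rightarrow> ('v, 'e) pre_digraph \<Rightarrow> ('v, 'e) torus_drawing \<Rightarrow> bool" where
  "geodesic_drawing M G f \<longleftrightarrow> drawing M G f \<and> (\<forall>e\<in>arcs G. geodesic_path M (edge_path G f e))"


section \<open>Lifts, displacements and the universal cover\<close>

definition is_lift :: "real^2^2 \<Rightarrow> (real \<Rightarrow> (real^2) set) \<Rightarrow> (real \<Rightarrow> real^2) \<Rightarrow> bool" where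
  "is_lift M p q \<longleftrightarrow> path q \<and> (\<forall>t\<in>{0..1}. torus_proj M (q t) = p t)"

definition displacement :: "real^2^2 \<Rightarrow> (real \<Rightarrow> (real^2) set) \<Rightarrow> real^2" where
  "displacement M p = (THE v. \<exists>q. is_lift M p q \<and> v = pathfinish q - pathstart q)"

text \<open>The dart \<open>(e, True)\<close> is the reference dart of \<open>e\<close>, and \<open>(e, False)\<close> its reversal.\<close>

type_synonym 'e dart = "'e \<times> bool"

definition darts :: "('v, 'e) pre_digraph \<Rightarrow> 'e dart set" where
  "darts G = arcs G \<times> UNIV"

definition dart_tail :: "('v, 'e) pre_digraph \<Rightarrow> 'e dart \<Rightarrow> 'v" where
  "dart_tail G d = (if snd d then tail G (fst d) else head G (fst d))"

definition dart_path ::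
    "('v, 'e) pre_digraph \<Rightarrow> ('v, 'e) torus_drawing \<Rightarrow> 'e dart \<Rightarrow> real \<Rightarrow> (real^2) set" where
  "dart_path G f d =
     (if snd d then edge_path G f (fst d) else (\<lambda>t. edge_path G f (fst d) (1 - t)))"

definition dart_displacement ::
    "real^2^2 \<Rightarrow> ('v, 'e) pre_digraph \<Rightarrow> ('v, 'e) torus_drawing \<Rightarrow> 'e dart \<Rightarrow> real^2" where
  "dart_displacement M G f d = displacement M (dart_path G f d)"

text \<open>The lift to \<open>\<real>\<^sup>2\<close> of an embedding: the lifted vertices are the points over the vertices,
  and the edge \<open>(e, x)\<close> is the lift of \<open>e\<close> that starts in \<open>x\<close>.\<close>

definition lift_graph ::
    "real^2^2 \<Rightarrow> ('v, 'e) pre_digraph \<Rightarrow> ('v, 'e) torus_drawing \<Rightarrow>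
     (real^2, 'e \<times> (real^2)) pre_digraph" where
  "lift_graph M G f =
     \<lparr> verts = {x. \<exists>v\<in>verts G. torus_proj M x = f (Vertex v)},
       arcs = {(e, x). e \<in> arcs G \<and> torus_proj M x = f (Vertex (tail G e))},
       tail = snd,
       head = (\<lambda>(e, x). x + displacement M (edge_path G f e)) \<rparr>"

definition simple_undirected :: "('v, 'e) pre_digraph \<Rightarrow> bool" where
  "simple_undirected \<Gamma> \<longleftrightarrow>
     (\<forall>a\<in>arcs \<Gamma>. tail \<Gamma> a \<noteq> head \<Gamma> a) \<and>
     (\<forall>a\<in>arcs \<Gamma>. \<forall>b\<in>arcs \<Gamma>. {tail \<Gamma> a, head \<Gamma> a} = {tail \<Gamma> b, head \<Gamma> b} \<longrightarrow> a = b)"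

text \<open>\<open>Digraph_Component.connected\<close> ignores the orientation of the arcs.\<close>

definition three_connected :: "('v, 'e) pre_digraph \<Rightarrow> bool" where
  "three_connected \<Gamma> \<longleftrightarrow> (infinite (verts \<Gamma>) \<or> card (verts \<Gamma>) > 3) \<and>
     (\<forall>S\<subseteq>verts \<Gamma>. finite S \<and> card S < 3 \<longrightarrow>
        Digraph_Component.connected (induce_subgraph \<Gamma> (verts \<Gamma> - S)))"

definition essentially_simple ::
    "real^2^2 \<Rightarrow> ('v, 'e) pre_digraph \<Rightarrow> ('v, 'e) torus_drawing \<Rightarrow> bool" where
  "essentially_simple M G f \<longleftrightarrow> simple_undirected (lift_graph M G f)"

definition essentially_three_connected ::
    "real^2^2 \<Rightarrow> ('v, 'e) pre_digraph \<Rightarrow> ('v, 'e) torus_drawing \<Rightarrow> bool" where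
  "essentially_three_connected M G f \<longleftrightarrow> three_connected (lift_graph M G f)"


section \<open>Dual graphs\<close>

text \<open>Let \<open>q\<close> and \<open>r\<close> be plane paths with exactly one common point, interior to both. The map
  \<open>(x, y) \<mapsto> r x - q y\<close> on the unit square then has exactly one zero, and its winding number
  along the counterclockwise boundary of the square is the local intersection number: it is \<open>1\<close> if
  \<open>r\<close> crosses \<open>q\<close> from the right to the left, \<open>- 1\<close> if \<open>r\<close> crosses \<open>q\<close> from the left to the
  right, and \<open>0\<close> if \<open>r\<close> touches \<open>q\<close> without crossing it. For example it is \<open>1\<close> if \<open>q\<close>
  runs along the first axis and \<open>r\<close> along the second one, both in the positive direction.\<close>

definition crossing_index :: "(real \<Rightarrow> real^2) \<Rightarrow> (real \<Rightarrow> real^2) \<Rightarrow> complex" where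
  "crossing_index q r =
     winding_number
       (\<lambda>u. let z = rectpath 0 (Complex 1 1) u; w = r (Re z) - q (Im z) in Complex (w $ 1) (w $ 2))
       0"

text \<open>For paths on a torus with exactly one common point, interior to both, the lifts \<open>q\<close> and
  \<open>r\<close> below meet exactly once as well.\<close>

definition crosses_right_to_left ::
    "real^2^2 \<Rightarrow> (real \<Rightarrow> (real^2) set) \<Rightarrow> (real \<Rightarrow> (real^2) set) \<Rightarrow> bool" where
  "crosses_right_to_left M p p' \<longleftrightarrow>
     (\<exists>q r. is_lift M p q \<and> is_lift M p' r \<and> path_image q \<inter> path_image r \<noteq> {} \<and>
        crossing_index q r = 1)"

text \<open>\<open>natural_dual_embedding G h H k\<close>: the graph \<open>H\<close> with embedding \<open>k\<close> is the dual
  \<open>G\<^sup>*\<close>, with its natural embedding, of \<open>G\<close> embedded by \<open>h\<close>. The vertices of \<open>H\<close> are the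
  faces of \<open>h\<close>; the dual of an edge \<open>e\<close> has the same name \<open>e\<close>, and the dual of a dart \<open>d\<close> is
  the dart \<open>d\<close> of \<open>H\<close>. The dual edge meets the drawing of \<open>G\<close> only in its crossing with \<open>e\<close>,
  so the crossing from right to left says that the dual reference dart leads from the face to the
  right of \<open>e\<close> to the face to its left.\<close>

definition natural_dual_embedding ::
    "('v, 'e) pre_digraph \<Rightarrow> ('v, 'e) torus_drawing \<Rightarrow>
     ((real^2) set set, 'e) pre_digraph \<Rightarrow> ((real^2) set set, 'e) torus_drawing \<Rightarrow> bool" where
  "natural_dual_embedding G h H k \<longleftrightarrow>
     embedding square H k \<and>
     verts H = faces square G h \<and>
     arcs H = arcs G \<and>
     (\<forall>F\<in>verts H. k (Vertex F) \<in> F) \<and>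
     (\<forall>e\<in>arcs G. \<exists>s\<in>{0<..<1}. \<exists>t\<in>{0<..<1}.
        edge_path G h e s = edge_path H k e t \<and>
        edge_path H k e ` {0..1} \<inter> h ` topspace (graph_space G) = {edge_path G h e s} \<and>
        crosses_right_to_left square (edge_path G h e) (edge_path H k e))"

definition dual_drawing ::
    "real^2^2 \<Rightarrow> ('f, 'e) pre_digraph \<Rightarrow> ('f, 'e) torus_drawing \<Rightarrow> ('f, 'e) torus_drawing \<Rightarrow> bool"
  where
  "dual_drawing M H k k' \<longleftrightarrow> drawing M H k' \<and>
     homotopic_drawings square H (torus_map (matrix_inv M) \<circ> k') k"


section \<open>Stresses\<close>

definition equilibrium_stress ::
    "real^2^2 \<Rightarrow> ('v, 'e) pre_digraph \<Rightarrow> ('v, 'e) torus_drawing \<Rightarrow> ('e \<Rightarrow> real) \<Rightarrow> bool" where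
  "equilibrium_stress M G f \<omega> \<longleftrightarrow>
     (\<forall>e\<in>arcs G. \<omega> e \<noteq> 0) \<and>
     (\<forall>p\<in>verts G.
        (\<Sum>d\<in>{d \<in> darts G. dart_tail G d = p}. \<omega> (fst d) *\<^sub>R dart_displacement M G f d) = 0)"

definition J :: "real^2^2" where
  "J = vector [vector [0, -1], vector [1, 0]]"

text \<open>Here \<open>f\<close> is the drawing of \<open>G\<close> on \<open>torus M\<close>, and \<open>H\<close>, \<open>k\<close> are the dual graph and its
  natural embedding on \<open>torus square\<close>.\<close>

definition orthogonal_reciprocal_stress ::
    "real^2^2 \<Rightarrow> ('v, 'e) pre_digraph \<Rightarrow> ('v, 'e) torus_drawing \<Rightarrow>
     ('f, 'e) pre_digraph \<Rightarrow> ('f, 'e) torus_drawing \<Rightarrow> ('e \<Rightarrow> real) \<Rightarrow> bool" where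
  "orthogonal_reciprocal_stress M G f H k \<omega> \<longleftrightarrow>
     geodesic_drawing M G f \<and> equilibrium_stress M G f \<omega> \<and>
     (\<exists>k'. geodesic_drawing M H k' \<and> dual_drawing M H k k' \<and>
        (\<forall>d\<in>darts G. dart_displacement M H k' d =
                       \<omega> (fst d) *\<^sub>R (J *v dart_displacement M G f d)))"

end

theory Submission
  imports Defs
begin

text \<open>
  Intersection numbers on the torus turn the theorem into linear algebra. If \<open>\<phi>\<close> is a circulation
  on \<open>G\<close> of homology class \<open>\<Phi>\<close> and \<open>c\<close> a circulation on \<open>G\<^sup>*\<close> of class \<open>C\<close>, then
  \<open>\<Sum>\<^sub>e \<phi>\<^sub>e c\<^sub>e = C\<^sub>2 \<Phi>\<^sub>1 - C\<^sub>1 \<Phi>\<^sub>2\<close>. Applied to the two coordinates of \<open>\<omega> \<Delta>\<close>, which are circulations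
  by equilibrium, this says that the total of \<open>\<omega> \<Delta>\<close> over a dual cycle of class \<open>C\<close> is \<open>T C\<close> with
  \<open>T = (-\<gamma>, \<alpha>; -\<beta>, \<gamma>)\<close>. A dual drawing with displacements \<open>M\<^sup>-\<^sup>1 J M \<omega> \<Delta>\<close> on the square torus
  exists exactly if their total over each dual cycle is the class of that cycle; as the classes of
  dual cycles span the plane, this means \<open>J M T = M\<close>, an equation that is solved entry by entry.

  The intersection formula comes from the change of argument of \<open>s (r x - q y)\<close> around the unit
  square, for lifts \<open>q\<close> of an edge and \<open>r\<close> of a dual edge, where \<open>s\<close> vanishes exactly on the integer
  lattice and is quasi-periodic. The classes span since otherwise some integer linear form would have
  an integer potential on \<open>G\<^sup>*\<close>; the lifted drawing would then split into a left and a right part, and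
  a face would contain an essential closed curve running between them.
\<close>

text \<open>The embedded edges are merely continuous, so crossings cannot be counted by
  transversality: a crossing is known only as the index of a map on the parameter square, and on the
  torus all lattice translates of a lift have to be counted together. Composing with one function
  that vanishes on the whole lattice does this. Such a function cannot be doubly periodic, as the
  zero in a period cell would then have index 0; it must pick up a multiplier under translation.
  Exactly this multiplier leaves the term
  \<open>C\<^sub>2 \<Phi>\<^sub>1 - C\<^sub>1 \<Phi>\<^sub>2\<close>. All other boundary
  contributions are coboundaries, which circulations annihilate. The same cancellation makes the
  choice of lifts harmless and allows the geodesic drawing to be exchanged for the embedding
  homotopic to it.

  The spanning of the dual classes is where cellularity enters, and it gives the necessity of the
  matrix equation. The potential has to be integer-valued there: the gap between the levels 0 and 1
  is what splits the whole lifted drawing into two disjoint closed sets.\<close>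

no_notation fps_nth (infixl \<open>$\<close> 75)

section \<open>Winding along the boundary of a square\<close>

lemma winding_number_exp_path:
  assumes "path q" "\<And>t. t \<in> {0..1} \<Longrightarrow> p t = exp (q t)"
  shows "winding_number p 0 = (pathfinish q - pathstart q) / (2 * of_real pi * \<i>)"
proof -
  have "winding_number p 0 = winding_number (exp \<circ> q) 0"
    by (rule winding_number_cong) (simp add: assms)
  then show ?thesis
    using winding_number_compose_exp[OF assms(1)] by simp
qed

text \<open>Winding numbers about 0 are end point differences of continuous logarithms, and the
  logarithms of the factors add. The paths may be open, as the sides of the unit square are.\<close>

lemma winding_number_mult:
  assumes "path p" "\<And>t. t \<in> {0..1} \<Longrightarrow> p t \<noteq> 0" "path p'" "\<And>t. t \<in> {0..1} \<Longrightarrow> p' t \<noteq> 0"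
  shows "winding_number (\<lambda>t. p t * p' t) 0 = winding_number p 0 + winding_number p' 0"
proof -
  have "0 \<notin> path_image p" "0 \<notin> path_image p'"
    using assms by (force simp: path_image_def)+
  then obtain q q' where q: "path q" "\<And>t. t \<in> {0..1} \<Longrightarrow> p t = 0 + exp (q t)"
    and q': "path q'" "\<And>t. t \<in> {0..1} \<Longrightarrow> p' t = 0 + exp (q' t)"
    using winding_number_as_continuous_log assms by metis
  have "path (\<lambda>t. q t + q' t)"
    using q q' by (simp add: path_def continuous_intros)
  then have "winding_number (\<lambda>t. p t * p' t) 0 =
      (pathfinish (\<lambda>t. q t + q' t) - pathstart (\<lambda>t. q t + q' t)) / (2 * of_real pi * \<i>)"
    by (rule winding_number_exp_path) (simp add: q q' exp_add)
  moreover have "winding_number p 0 = (pathfinish q - pathstart q) / (2 * of_real pi * \<i>)"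
    "winding_number p' 0 = (pathfinish q' - pathstart q') / (2 * of_real pi * \<i>)"
    using q q' by (auto intro!: winding_number_exp_path)
  ultimately show ?thesis
    by (simp add: pathfinish_def pathstart_def diff_divide_distrib add_divide_distrib)
qed

abbreviation unit_square :: "(real \<times> real) set" where
  "unit_square \<equiv> {0..1} \<times> {0..1}"

text \<open>With the four sides kept as separate open paths, each can be computed from one curve and
  one end point of the other. The real part of such a term is the change of argument in full turns;
  the imaginary part records the change of modulus.\<close>

definition boundary_winding :: "(real \<Rightarrow> real \<Rightarrow> complex) \<Rightarrow> complex" where
  "boundary_winding F = winding_number (\<lambda>x. F x 0) 0 + winding_number (F 1) 0
     - winding_number (\<lambda>x. F x 1) 0 - winding_number (F 0) 0"

definition nonzero_on_boundary :: "(real \<Rightarrow> real \<Rightarrow> complex) \<Rightarrow> bool" where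
  "nonzero_on_boundary F \<longleftrightarrow> (\<forall>t\<in>{0..1}. F t 0 \<noteq> 0 \<and> F t 1 \<noteq> 0 \<and> F 0 t \<noteq> 0 \<and> F 1 t \<noteq> 0)"

lemma paths_of_square:
  assumes "continuous_on unit_square (\<lambda>(x, y). F x y)" "s \<in> {0..1}"
  shows "path (\<lambda>x. F x s)" "path (F s)"
proof -
  have "continuous_on {0..1} ((\<lambda>(x, y). F x y) \<circ> (\<lambda>x. (x, s)))"
    "continuous_on {0..1} ((\<lambda>(x, y). F x y) \<circ> (\<lambda>y. (s, y)))"
    using assms(2) by (intro continuous_on_compose continuous_on_subset[OF assms(1)]
        continuous_intros; force)+
  then show "path (\<lambda>x. F x s)" "path (F s)"
    by (simp_all add: path_def o_def)
qed

text \<open>The link to \<open>crossing_index\<close>: \<open>rectpath\<close> runs along the top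
  and the left side backwards, whence their signs in \<open>boundary_winding\<close>.\<close>

lemma boundary_winding_eq_winding_number:
  assumes cont: "continuous_on unit_square (\<lambda>(x, y). F x y)" and nz: "nonzero_on_boundary F"
  shows "winding_number (\<lambda>u. let z = rectpath 0 (Complex 1 1) u in F (Re z) (Im z)) 0 =
    boundary_winding F"
proof -
  define g where "g z = F (Re z) (Im z)" for z
  define l1 l2 l3 l4 where "l1 = linepath 0 (Complex 1 0)"
    and "l2 = linepath (Complex 1 0) (Complex 1 1)"
    and "l3 = linepath (Complex 1 1) (Complex 0 1)"
    and "l4 = linepath (Complex 0 1) 0"
  have rp: "rectpath 0 (Complex 1 1) = l1 +++ l2 +++ l3 +++ l4"
    by (simp add: rectpath_def l1_def l2_def l3_def l4_def Let_def zero_complex.code)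
  have e: "g \<circ> l1 = (\<lambda>x. F x 0)" "g \<circ> l2 = F 1" "g \<circ> l3 = reversepath (\<lambda>x. F x 1)"
    "g \<circ> l4 = reversepath (F 0)"
    by (auto simp: fun_eq_iff g_def l1_def l2_def l3_def l4_def linepath_def reversepath_def)
  note p0 = paths_of_square[OF cont, of 0] and p1 = paths_of_square[OF cont, of 1]
  have n: "0 \<notin> path_image (\<lambda>x. F x 0)" "0 \<notin> path_image (F 1)" "0 \<notin> path_image (\<lambda>x. F x 1)"
    "0 \<notin> path_image (F 0)"
    using nz by (force simp: path_image_def nonzero_on_boundary_def)+
  have "(\<lambda>u. let z = rectpath 0 (Complex 1 1) u in F (Re z) (Im z)) =
      g \<circ> (l1 +++ l2 +++ l3 +++ l4)"
    by (simp add: rp g_def o_def Let_def)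
  also have "\<dots> = (\<lambda>x. F x 0) +++ F 1 +++ reversepath (\<lambda>x. F x 1) +++ reversepath (F 0)"
    by (simp add: path_compose_join e)
  finally show ?thesis
    using p0 p1 n by (simp add: winding_number_join path_image_join winding_number_reversepath
        boundary_winding_def pathfinish_def[of "F _"] pathstart_def[of "F _"]
        pathfinish_def[of "\<lambda>x. F x _"] pathstart_def[of "\<lambda>x. F x _"])
qed

lemma boundary_winding_mult:
  assumes "continuous_on unit_square (\<lambda>(x, y). F x y)" "nonzero_on_boundary F"
    "continuous_on unit_square (\<lambda>(x, y). G x y)" "nonzero_on_boundary G"
  shows "boundary_winding (\<lambda>x y. F x y * G x y) = boundary_winding F + boundary_winding G"
proof -
  note F = paths_of_square[OF assms(1)] assms(2)[unfolded nonzero_on_boundary_def]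
    and G = paths_of_square[OF assms(3)] assms(4)[unfolded nonzero_on_boundary_def]
  have "winding_number (\<lambda>x. F x s * G x s) 0 =
      winding_number (\<lambda>x. F x s) 0 + winding_number (\<lambda>x. G x s) 0"
    "winding_number (\<lambda>y. F s y * G s y) 0 = winding_number (F s) 0 + winding_number (G s) 0"
    if "s \<in> {0, 1}" for s
    using that F G by (auto intro!: winding_number_mult)
  then show ?thesis
    by (simp add: boundary_winding_def)
qed

text \<open>The square is contractible, so \<open>F\<close> has a continuous logarithm on it, and
  its differences along the four sides cancel.\<close>

lemma boundary_winding_nonzero:
  assumes cont: "continuous_on unit_square (\<lambda>(x, y). F x y)"
    and nz: "\<And>x y. x \<in> {0..1} \<Longrightarrow> y \<in> {0..1} \<Longrightarrow> F x y \<noteq> 0"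
  shows "boundary_winding F = 0"
proof -
  have "contractible unit_square"
    by (intro convex_imp_contractible convex_Times) auto
  moreover have "(\<lambda>(x, y). F x y) z \<noteq> 0" if "z \<in> unit_square" for z
    using that nz by auto
  ultimately obtain g where g: "continuous_on unit_square g"
    "\<And>z. z \<in> unit_square \<Longrightarrow> (\<lambda>(x, y). F x y) z = exp (g z)"
    using continuous_logarithm_on_contractible[OF cont] by blast
  define q where "q x y = g (x, y)" for x y
  have q: "continuous_on unit_square (\<lambda>(x, y). q x y)"
    and qe: "\<And>x y. x \<in> {0..1} \<Longrightarrow> y \<in> {0..1} \<Longrightarrow> F x y = exp (q x y)"
    using g by (auto simp: q_def)
  note p = paths_of_square[OF q]
  have w1: "winding_number (\<lambda>x. F x s) 0 = (q 1 s - q 0 s) / (2 * of_real pi * \<i>)"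
    if "s \<in> {0..1}" for s
    using winding_number_exp_path[OF p(1), of s] qe that by (simp add: pathfinish_def pathstart_def)
  have w2: "winding_number (F s) 0 = (q s 1 - q s 0) / (2 * of_real pi * \<i>)"
    if "s \<in> {0..1}" for s
    using winding_number_exp_path[OF p(2), of s] qe that by (simp add: pathfinish_def pathstart_def)
  show ?thesis
    by (simp add: boundary_winding_def w1 w2 flip: add_divide_distrib diff_divide_distrib)
qed

section \<open>A quasi-periodic function vanishing on the Gaussian integers\<close>

text \<open>On the strip \<open>\<bar>Im w\<bar> \<le> 1/2\<close> the function is \<open>\<i> sin (\<pi> x) - sin (\<pi> y) cos (\<pi> x)\<close>, whose values on the
  two boundary lines are \<open>exp (\<i> \<pi> x)\<close> and \<open>- exp (- \<i> \<pi> x)\<close>; the factor \<open>cis\<close> glues the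
  translates of the strip. Like a theta function it has a complex derivative at its zeros, which is what
  makes the quotient by \<open>w\<close> continuous at \<open>0\<close>.\<close>

definition quasi_strip :: "int \<Rightarrow> complex \<Rightarrow> complex" where
  "quasi_strip n w = cis (- (2 * pi * n * Re w)) *
     (cos (pi * n) * \<i> * sin (pi * Re w) - sin (pi * Im w) * cos (pi * Re w))"

definition quasi_sine :: "complex \<Rightarrow> complex" where
  "quasi_sine w = quasi_strip \<lfloor>Im w + 1/2\<rfloor> w"

definition gaussian_ints :: "complex set" where
  "gaussian_ints = {z. Re z \<in> \<int> \<and> Im z \<in> \<int>}"

lemma sin_pi_eq_0_iff: "sin (pi * x) = 0 \<longleftrightarrow> x \<in> \<int>" for x :: real
  by (metis Ints_cases Ints_of_int mult.commute mult_cancel_right pi_neq_zero sin_zero_iff_int2)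

lemma cos_pi_int_sq: "cos (pi * of_int n) = 1 \<or> cos (pi * of_int n) = -1"
  using cos_npi_int[of n] by (auto simp: mult.commute)

lemma sin_pi_int: "sin (pi * of_int n) = 0"
  by (simp only: sin_pi_eq_0_iff Ints_of_int)

text \<open>On this line \<open>sin (pi * Im w)\<close> equals \<open>cos (pi * n)\<close>, so both
  formulas collapse to one exponential. The phases \<open>- 2 pi n x - pi x\<close> and
  \<open>- 2 pi (n + 1) x + pi x\<close> coincide, and so do the signs, since
  \<open>cos (pi * n)\<close> changes sign with \<open>n\<close>.\<close>

lemma quasi_strip_boundary:
  assumes "Im w = n + 1/2"
  shows "quasi_strip n w = quasi_strip (n + 1) w"
proof -
  define x where "x = Re w"
  define c where "c = cos (pi * n)"
  have s: "sin (pi * Im w) = c"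
    using sin_pi_int[of n] by (simp add: assms distrib_left sin_add c_def)
  have c': "cos (pi * (of_int n + 1)) = - c"
    by (simp add: distrib_left cos_add c_def)
  have e1: "\<i> * sin (pi * x) - cos (pi * x) = - cis (- (pi * x))"
    "\<i> * sin (pi * x) + cos (pi * x) = cis (pi * x)"
    by (simp_all add: complex_eq_iff)
  have "quasi_strip n w = c * (cis (- (2 * pi * n * x)) * (\<i> * sin (pi * x) - cos (pi * x)))"
    unfolding quasi_strip_def s c_def[symmetric] x_def[symmetric]
    by (simp add: algebra_simps)
  also have "\<dots> = - (c * (cis (- (2 * pi * n * x)) * cis (- (pi * x))))"
    unfolding e1 by simp
  also have "cis (- (2 * pi * n * x)) * cis (- (pi * x)) = cis (- (2 * pi * (n + 1) * x)) * cis (pi * x)"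
    by (simp add: cis_mult algebra_simps)
  also have "- (c * (cis (- (2 * pi * (n + 1) * x)) * cis (pi * x))) = quasi_strip (n + 1) w"
    unfolding quasi_strip_def s c_def[symmetric] x_def[symmetric] of_int_add of_int_1 c' e1(2)[symmetric]
    by (simp add: algebra_simps)
  finally show ?thesis .
qed

lemma continuous_on_quasi_strip: "continuous_on A (quasi_strip n)"
  unfolding quasi_strip_def by (intro continuous_intros)

lemma continuous_on_quasi_sine: "continuous_on A quasi_sine"
proof -
  have "isCont quasi_sine w" for w
  proof -
    define n where "n = \<lfloor>Im w\<rfloor>"
    \<comment> \<open>For \<open>n\<close> the floor of \<open>Im w\<close>, this neighbourhood of
      \<open>w\<close> contains a single seam, at height \<open>n + 1/2\<close>, so two of the strip
      formulas suffice.\<close>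
    define U where "U = {z. of_int n - 1/2 < Im z \<and> Im z < of_int n + 3/2}"
    have "open U"
      unfolding U_def by (intro open_Collect_conj open_Collect_less continuous_intros)
    moreover have "w \<in> U"
      unfolding U_def n_def by (simp; linarith)
    moreover have "continuous_on U (\<lambda>z. if Im z \<le> of_int n + 1/2 then quasi_strip n z
        else quasi_strip (n + 1) z)"
      by (intro continuous_on_cases_le continuous_on_quasi_strip continuous_intros
          quasi_strip_boundary) auto
    moreover have "quasi_sine z = (if Im z \<le> of_int n + 1/2 then quasi_strip n z
        else quasi_strip (n + 1) z)" if "z \<in> U" for z
    proof -
      consider "Im z < n + 1/2" | "Im z = n + 1/2" | "Im z > n + 1/2" by linarith
      then show ?thesis
      proof cases
        case 1
        with that have "\<lfloor>Im z + 1/2\<rfloor> = n"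
          by (simp add: floor_eq_iff U_def)
        with 1 show ?thesis by (simp add: quasi_sine_def)
      next
        case 2
        then have "\<lfloor>Im z + 1/2\<rfloor> = n + 1"
          by (simp add: floor_eq_iff)
        with 2 quasi_strip_boundary[OF 2] show ?thesis by (simp add: quasi_sine_def add.commute)
      next
        case 3
        with that have "\<lfloor>Im z + 1/2\<rfloor> = n + 1"
          by (simp add: floor_eq_iff U_def)
        with 3 show ?thesis by (simp add: quasi_sine_def)
      qed
    qed
    ultimately have "continuous_on U quasi_sine"
      by (simp cong: continuous_on_cong)
    with \<open>open U\<close> \<open>w \<in> U\<close> show ?thesis
      by (simp add: continuous_on_eq_continuous_at)
  qed
  then show ?thesis
    by (simp add: continuous_at_imp_continuous_on)
qed

text \<open>Once the factor of modulus one is removed, the imaginary part is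
  \<open>sin (pi * Re w)\<close> up to sign and the real part is
  \<open>- sin (pi * Im w) * cos (pi * Re w)\<close>; where the former vanishes, the cosine does
  not.\<close>

lemma quasi_sine_eq_0_iff: "quasi_sine w = 0 \<longleftrightarrow> w \<in> gaussian_ints"
proof -
  define n where "n = \<lfloor>Im w + 1/2\<rfloor>"
  have "quasi_sine w = 0 \<longleftrightarrow>
      sin (pi * Re w) = 0 \<and> sin (pi * Im w) * cos (pi * Re w) = 0"
  proof -
    define c where "c = cos (pi * n)"
    have "c \<noteq> 0"
      using cos_pi_int_sq[of n] by (auto simp: c_def)
    moreover have "quasi_sine w = 0 \<longleftrightarrow>
        c * \<i> * sin (pi * Re w) - sin (pi * Im w) * cos (pi * Re w) = 0"
      unfolding quasi_sine_def n_def[symmetric] quasi_strip_def c_def[symmetric] by simp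
    ultimately show ?thesis
      by (auto simp: complex_eq_iff)
  qed
  also have "\<dots> \<longleftrightarrow> sin (pi * Re w) = 0 \<and> sin (pi * Im w) = 0"
    using sin_cos_squared_add[of "pi * Re w"] by (auto simp: power2_eq_square)
  finally show ?thesis
    by (simp add: gaussian_ints_def sin_pi_eq_0_iff)
qed

text \<open>The two cosines are the sign \<open>(-1)^(m + n)\<close>. A horizontal shift changes
  nothing else, while a vertical one moves the strip index by \<open>n\<close> and contributes a
  phase that turns with \<open>Re w\<close>. This turning is the source of the intersection
  form.\<close>

lemma quasi_sine_add_int:
  fixes m n :: int
  shows "quasi_sine (w + Complex m n) =
    of_real (cos (pi * m) * cos (pi * n)) * cis (- (2 * pi * n * Re w)) * quasi_sine w"
proof -
  define k where "k = \<lfloor>Im w + 1/2\<rfloor>"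
  have f: "\<lfloor>Im (w + Complex m n) + 1/2\<rfloor> = k + n"
  proof -
    have "Im (w + Complex m n) + 1/2 = (Im w + 1/2) + of_int n"
      by simp
    then show ?thesis
      by (simp only: k_def floor_add_int)
  qed
  have c: "cis (- (2 * pi * (of_int k + of_int n) * (Re w + m))) =
      cis (- (2 * pi * k * Re w)) * cis (- (2 * pi * n * Re w))"
  proof -
    have "cis (- (2 * pi * (of_int k + of_int n) * (Re w + m))) =
        cis (- (2 * pi * k * Re w)) * cis (- (2 * pi * n * Re w)) * cis (2 * pi * of_int (- ((k + n) * m)))"
      by (simp add: cis_mult algebra_simps)
    also have "cis (2 * pi * of_int (- ((k + n) * m))) = 1"
      by (rule cis_multiple_2pi) simp
    finally show ?thesis by simp
  qed
  have ck: "cos (pi * (of_int k + of_int n)) = cos (pi * k) * cos (pi * n)"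
    by (simp add: distrib_left cos_add sin_pi_int)
  have t: "sin (pi * (Re w + m)) = sin (pi * Re w) * cos (pi * m)"
    "cos (pi * (Re w + m)) = cos (pi * Re w) * cos (pi * m)"
    "sin (pi * (Im w + n)) = sin (pi * Im w) * cos (pi * n)"
    by (simp_all add: distrib_left cos_add sin_add sin_pi_int)
  define C where "C j = cos (pi * of_int j)" for j
  show ?thesis
    unfolding quasi_sine_def f k_def[symmetric]
    unfolding quasi_strip_def plus_complex.sel complex.sel of_int_add c ck t
    unfolding C_def[symmetric] by (simp add: algebra_simps)
qed

definition quasi_sine_unit :: "complex \<Rightarrow> complex" where
  "quasi_sine_unit w = (if w = 0 then \<i> * pi else quasi_sine w / w)"

lemma quasi_sine_factor: "quasi_sine w = w * quasi_sine_unit w"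
  using quasi_sine_eq_0_iff[of 0] by (simp add: quasi_sine_unit_def gaussian_ints_def)

lemma quasi_sine_unit_eq_0: "quasi_sine_unit w = 0 \<Longrightarrow> w \<in> gaussian_ints - {0}"
  using quasi_sine_eq_0_iff by (auto simp: quasi_sine_unit_def split: if_splits)

text \<open>The real differential sends \<open>h\<close> to
  \<open>\<i> * pi * Re h - pi * Im h\<close>, which happens to be multiplication by
  \<open>\<i> * pi\<close>. This explains the value of \<open>quasi_sine_unit\<close> at 0.\<close>

lemma has_field_derivative_quasi_sine_0: "(quasi_sine has_field_derivative \<i> * pi) (at 0)"
proof -
  have "((\<lambda>w. \<i> * of_real (sin (pi * Re w)) - of_real (sin (pi * Im w)) * of_real (cos (pi * Re w)))
      has_derivative (\<lambda>h. (\<i> * pi) * h)) (at 0)"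
  proof -
    have "((\<lambda>w. sin (pi * Re w)) has_derivative (\<lambda>h. pi * Re h)) (at 0)"
      "((\<lambda>w. sin (pi * Im w)) has_derivative (\<lambda>h. pi * Im h)) (at 0)"
      "((\<lambda>w. cos (pi * Re w)) has_derivative (\<lambda>h. 0)) (at 0)"
      by (auto intro!: derivative_eq_intros simp: fun_eq_iff)
    note this[THEN has_derivative_of_real[where ?'a = complex]]
    from has_derivative_diff[OF has_derivative_mult[OF has_derivative_const this(1)]
        has_derivative_mult[OF this(2,3)]]
    show ?thesis
      by (rule has_derivative_eq_rhs) (auto simp: fun_eq_iff complex_eq_iff)
  qed
  moreover have "open {z. \<bar>Im z\<bar> < 1/2}"
    by (intro open_Collect_less continuous_intros)
  moreover have "(0 :: complex) \<in> {z. \<bar>Im z\<bar> < 1/2}"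
    by simp
  moreover have "\<i> * of_real (sin (pi * Re w)) - of_real (sin (pi * Im w)) * of_real (cos (pi * Re w)) = quasi_sine w"
    if "w \<in> {z. \<bar>Im z\<bar> < 1/2}" for w
  proof -
    have "\<lfloor>Im w + 1/2\<rfloor> = 0"
      using that by (auto simp: floor_eq_iff)
    then show ?thesis
      by (simp add: quasi_sine_def quasi_strip_def)
  qed
  ultimately show ?thesis
    unfolding has_field_derivative_def
    by (rule has_derivative_transform_within_open) auto
qed

lemma continuous_on_quasi_sine_unit: "continuous_on A quasi_sine_unit"
proof -
  have "isCont quasi_sine_unit w" for w
  proof (cases "w = 0")
    case True
    have "((\<lambda>y. (quasi_sine y - quasi_sine 0) / (y - 0)) \<longlongrightarrow> \<i> * pi) (at 0)"
      using has_field_derivative_quasi_sine_0 by (simp only: has_field_derivative_iff)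
    moreover have "quasi_sine 0 = 0"
      by (simp add: quasi_sine_factor)
    ultimately have "((\<lambda>y. quasi_sine y / y) \<longlongrightarrow> \<i> * pi) (at 0)"
      by simp
    then have "(quasi_sine_unit \<longlongrightarrow> \<i> * pi) (at 0)"
      by (rule tendsto_cong[THEN iffD1, rotated])
        (simp add: eventually_at_filter quasi_sine_unit_def)
    then show ?thesis
      by (simp add: True isCont_def quasi_sine_unit_def)
  next
    case False
    have "continuous_on (- {0}) (\<lambda>w. quasi_sine w / w)"
      by (intro continuous_intros continuous_on_quasi_sine) auto
    then have "continuous_on (- {0}) quasi_sine_unit"
      by (rule continuous_on_eq) (simp add: quasi_sine_unit_def)
    then show ?thesis
      using False by (simp add: continuous_on_eq_continuous_at open_Compl)
  qed
  then show ?thesis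
    by (simp add: continuous_at_imp_continuous_on)
qed

text \<open>The multiplier is the exponential of an explicit path \<open>q\<close>, whose end point
  difference is the correction term; the constant sign enters only through \<open>Ln c\<close> and
  cancels.\<close>

lemma winding_number_quasi_sine_shift:
  fixes m n :: int
  assumes "path p" "\<And>t. t \<in> {0..1} \<Longrightarrow> quasi_sine (p t) \<noteq> 0"
  shows "winding_number (\<lambda>t. quasi_sine (p t + Complex m n)) 0 =
    winding_number (\<lambda>t. quasi_sine (p t)) 0 - of_real (n * (Re (p 1) - Re (p 0)))"
proof -
  define c where "c = complex_of_real (cos (pi * m) * cos (pi * n))"
  define q where "q t = Ln c - \<i> * of_real (2 * pi * n * Re (p t))" for t
  have "c \<noteq> 0"
    using cos_pi_int_sq[of m] cos_pi_int_sq[of n] by (auto simp: c_def)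
  then have e: "c * cis (- (2 * pi * n * Re (p t))) = exp (q t)" for t
    by (simp add: q_def exp_diff cis_conv_exp exp_minus field_simps)
  have q: "path q"
    using assms(1) unfolding q_def path_def by (intro continuous_intros)
  have qs: "path (\<lambda>t. quasi_sine (p t))"
    using assms(1) continuous_on_compose[OF _ continuous_on_quasi_sine, of "{0..1}" p]
    by (simp add: path_def o_def)
  have "(\<lambda>t. quasi_sine (p t + Complex m n)) = (\<lambda>t. exp (q t) * quasi_sine (p t))"
    unfolding quasi_sine_add_int c_def[symmetric] e ..
  then have "winding_number (\<lambda>t. quasi_sine (p t + Complex m n)) 0 =
      winding_number (\<lambda>t. exp (q t) * quasi_sine (p t)) 0"
    by simp
  also have "\<dots> = winding_number (\<lambda>t. exp (q t)) 0 + winding_number (\<lambda>t. quasi_sine (p t)) 0"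
    using q qs assms(2) by (intro winding_number_mult) (auto simp: path_def intro!: continuous_intros)
  also have "winding_number (\<lambda>t. exp (q t)) 0 = (pathfinish q - pathstart q) / (2 * of_real pi * \<i>)"
    using q by (intro winding_number_exp_path) auto
  also have "\<dots> = - of_real (n * (Re (p 1) - Re (p 0)))"
    by (simp add: pathfinish_def pathstart_def q_def field_simps)
  finally show ?thesis by simp
qed

lemma boundary_winding_quasi_sine_zero_free:
  assumes "continuous_on unit_square (\<lambda>(x, y). F x y)"
    and "\<And>x y. x \<in> {0..1} \<Longrightarrow> y \<in> {0..1} \<Longrightarrow> F x y \<notin> gaussian_ints"
  shows "boundary_winding (\<lambda>x y. quasi_sine (F x y)) = 0"
proof (rule boundary_winding_nonzero)
  have "continuous_on unit_square (quasi_sine \<circ> (\<lambda>(x, y). F x y))"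
    by (intro continuous_on_compose assms continuous_on_quasi_sine)
  then show "continuous_on unit_square (\<lambda>(x, y). quasi_sine (F x y))"
    by (simp add: o_def split_def)
qed (use assms quasi_sine_eq_0_iff in auto)

text \<open>Since \<open>F\<close> takes no lattice value except possibly 0,
  \<open>quasi_sine (F x y + Complex m n)\<close> is \<open>F x y\<close> times a continuous
  function without zeros on the square, and that factor has boundary winding 0. So the index of
  \<open>quasi_sine\<close> agrees with the local index of the crossing.\<close>

lemma boundary_winding_quasi_sine_local:
  fixes m n :: int
  assumes cont: "continuous_on unit_square (\<lambda>(x, y). F x y)"
    and lat: "\<And>x y. x \<in> {0..1} \<Longrightarrow> y \<in> {0..1} \<Longrightarrow> F x y \<in> gaussian_ints \<Longrightarrow> F x y = 0"
    and nz: "nonzero_on_boundary F"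
  shows "boundary_winding (\<lambda>x y. quasi_sine (F x y + Complex m n)) = boundary_winding F"
proof -
  define G where "G x y = complex_of_real (cos (pi * m) * cos (pi * n)) *
    cis (- (2 * pi * n * Re (F x y))) * quasi_sine_unit (F x y)" for x y
  have "continuous_on unit_square (quasi_sine_unit \<circ> (\<lambda>(x, y). F x y))"
    by (intro continuous_on_compose cont continuous_on_quasi_sine_unit)
  then have u: "continuous_on unit_square (\<lambda>z. quasi_sine_unit (F (fst z) (snd z)))"
    by (simp add: o_def split_def)
  have "continuous_on unit_square (\<lambda>z. F (fst z) (snd z))"
    using cont by (simp add: split_def)
  with u have G: "continuous_on unit_square (\<lambda>(x, y). G x y)"
    unfolding G_def split_def by (intro continuous_intros)
  have G0: "G x y \<noteq> 0" if "x \<in> {0..1}" "y \<in> {0..1}" for x y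
  proof -
    have "quasi_sine_unit (F x y) \<noteq> 0"
      using quasi_sine_unit_eq_0 lat[OF that] by blast
    then show ?thesis
      using cos_pi_int_sq[of m] cos_pi_int_sq[of n] by (auto simp: G_def)
  qed
  have "(\<lambda>x y. quasi_sine (F x y + Complex m n)) = (\<lambda>x y. F x y * G x y)"
    unfolding quasi_sine_add_int G_def quasi_sine_factor[of "F _ _"] by (simp add: mult_ac)
  then have "boundary_winding (\<lambda>x y. quasi_sine (F x y + Complex m n)) =
      boundary_winding (\<lambda>x y. F x y * G x y)"
    by simp
  also have "\<dots> = boundary_winding F + boundary_winding G"
    using G0 by (intro boundary_winding_mult cont nz G) (auto simp: nonzero_on_boundary_def)
  also have "boundary_winding G = 0"
    using G G0 by (intro boundary_winding_nonzero) auto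
  finally show ?thesis by simp
qed

section \<open>Circulations and potentials\<close>

definition circulation :: "('v, 'e) pre_digraph \<Rightarrow> ('e \<Rightarrow> real) \<Rightarrow> bool" where
  "circulation G \<phi> \<longleftrightarrow> (\<forall>v\<in>verts G.
     (\<Sum>e\<in>{e \<in> arcs G. tail G e = v}. \<phi> e) = (\<Sum>e\<in>{e \<in> arcs G. head G e = v}. \<phi> e))"

text \<open>Regrouping by vertices leaves inflow minus outflow as the coefficient of each
  \<open>b v\<close>. This is why moving vertices, or choosing other lifts of them, has no effect on
  the class of a circulation.\<close>

lemma circulation_coboundary:
  fixes b :: "'v \<Rightarrow> 'a::real_vector"
  assumes "fin_digraph G" "circulation G \<phi>"
  shows "(\<Sum>e\<in>arcs G. \<phi> e *\<^sub>R (b (head G e) - b (tail G e))) = 0"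
proof -
  interpret fin_digraph G by fact
  have group: "(\<Sum>e\<in>arcs G. \<phi> e *\<^sub>R b (p e)) = (\<Sum>v\<in>verts G. (\<Sum>e\<in>{e \<in> arcs G. p e = v}. \<phi> e) *\<^sub>R b v)"
    if "p ` arcs G \<subseteq> verts G" for p
  proof -
    have "(\<Sum>e\<in>arcs G. \<phi> e *\<^sub>R b (p e)) = (\<Sum>v\<in>verts G. \<Sum>e\<in>{e \<in> arcs G. p e = v}. \<phi> e *\<^sub>R b (p e))"
      using that by (intro sum.group[symmetric]) auto
    also have "\<dots> = (\<Sum>v\<in>verts G. \<Sum>e\<in>{e \<in> arcs G. p e = v}. \<phi> e *\<^sub>R b v)"
      by (intro sum.cong) auto
    finally show ?thesis by (simp add: scaleR_left.sum)
  qed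
  have "(\<Sum>e\<in>arcs G. \<phi> e *\<^sub>R b (head G e)) = (\<Sum>e\<in>arcs G. \<phi> e *\<^sub>R b (tail G e))"
    using assms(2) group[of "head G"] group[of "tail G"]
    by (simp add: circulation_def image_subset_iff)
  then show ?thesis
    by (simp add: scaleR_diff_right sum_subtractf)
qed

text \<open>\<open>c e\<close> counts the traversals of \<open>e\<close> by an undirected walk, with sign.\<close>

inductive walk_chain :: "('v, 'e) pre_digraph \<Rightarrow> 'v \<Rightarrow> 'v \<Rightarrow> ('e \<Rightarrow> int) \<Rightarrow> bool" for G where
  stay: "walk_chain G a a (\<lambda>_. 0)"
| forward: "walk_chain G a (tail G e) c \<Longrightarrow> e \<in> arcs G \<Longrightarrow> walk_chain G a (head G e) (c(e := c e + 1))"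
| backward: "walk_chain G a (head G e) c \<Longrightarrow> e \<in> arcs G \<Longrightarrow> walk_chain G a (tail G e) (c(e := c e - 1))"

lemma walk_chain_trans:
  assumes "walk_chain G b d c'" "walk_chain G a b c"
  shows "walk_chain G a d (\<lambda>e. c e + c' e)"
  using assms
proof (induction rule: walk_chain.induct)
  case (forward b e c')
  from walk_chain.forward[OF forward.IH[OF forward.prems] \<open>e \<in> arcs G\<close>]
  show ?case by (rule back_subst[of "walk_chain G a _"]) auto
next
  case (backward b e c')
  from walk_chain.backward[OF backward.IH[OF backward.prems] \<open>e \<in> arcs G\<close>]
  show ?case by (rule back_subst[of "walk_chain G a _"]) auto
qed auto

lemma walk_chain_reverse:
  assumes "walk_chain G a b c"
  shows "walk_chain G b a (\<lambda>e. - c e)"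
  using assms
proof (induction rule: walk_chain.induct)
  case (stay a)
  then show ?case using walk_chain.stay[of G a] by simp
next
  case (forward a e c)
  from walk_chain_trans[OF forward.IH walk_chain.backward[OF walk_chain.stay \<open>e \<in> arcs G\<close>]]
  show ?case by (rule back_subst[of "walk_chain G _ a"]) auto
next
  case (backward a e c)
  from walk_chain_trans[OF backward.IH walk_chain.forward[OF walk_chain.stay \<open>e \<in> arcs G\<close>]]
  show ?case by (rule back_subst[of "walk_chain G _ a"]) auto
qed

lemma sum_fun_upd_add:
  fixes x :: "'e \<Rightarrow> 'a::comm_ring_1"
  assumes "finite A" "e \<in> A"
  shows "(\<Sum>i\<in>A. of_int ((c(e := c e + k)) i) * x i) = (\<Sum>i\<in>A. of_int (c i) * x i) + of_int k * x e"
proof -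
  have "(\<Sum>i\<in>A. of_int ((c(e := c e + k)) i) * x i) =
      (\<Sum>i\<in>A. of_int (c i) * x i + (if i = e then of_int k * x e else 0))"
    by (intro sum.cong) (auto simp: algebra_simps)
  then show ?thesis
    using assms by (simp add: sum.distrib)
qed

lemma walk_chain_coboundary:
  fixes f :: "'v \<Rightarrow> 'a::comm_ring_1"
  assumes "walk_chain G a b c" "finite (arcs G)"
  shows "(\<Sum>e\<in>arcs G. of_int (c e) * (f (head G e) - f (tail G e))) = f b - f a"
  using assms
proof (induction rule: walk_chain.induct)
  case (forward a e c)
  then show ?case using sum_fun_upd_add[of "arcs G" e c 1 "\<lambda>e. f (head G e) - f (tail G e)"] by (simp del: fun_upd_apply)
next
  case (backward a e c)
  then show ?case using sum_fun_upd_add[of "arcs G" e c "-1" "\<lambda>e. f (head G e) - f (tail G e)"] by (simp del: fun_upd_apply)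
qed auto

text \<open>Conservation at \<open>v\<close> is the coboundary formula for the indicator function of
  \<open>v\<close>.\<close>

lemma circulation_closed_walk:
  assumes "walk_chain G a a c" "finite (arcs G)"
  shows "circulation G (\<lambda>e. of_int (c e))"
  unfolding circulation_def
proof
  fix v
  have "(\<Sum>e\<in>arcs G. real_of_int (c e) * ((if head G e = v then 1 else 0) - (if tail G e = v then 1 else 0))) = 0"
    using walk_chain_coboundary[OF assms, of "\<lambda>u. if u = v then 1 else 0"] by simp
  moreover have "real_of_int (c e) * ((if head G e = v then 1 else 0) - (if tail G e = v then 1 else 0)) =
      (if head G e = v then of_int (c e) else 0) - (if tail G e = v then of_int (c e) else 0)" for e
    by auto
  ultimately have "(\<Sum>e\<in>arcs G. (if tail G e = v then of_int (c e) else 0)) =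
      (\<Sum>e\<in>arcs G. (if head G e = v then real_of_int (c e) else 0))"
    by (simp add: sum_subtractf)
  then show "(\<Sum>e\<in>{e \<in> arcs G. tail G e = v}. real_of_int (c e)) = (\<Sum>e\<in>{e \<in> arcs G. head G e = v}. of_int (c e))"
    using assms(2) by (simp add: sum.inter_filter)
qed

text \<open>Summation of \<open>x\<close> along walks from a root of each component is independent
  of the walk. The ring is left open since integer potentials are needed for heights and real ones
  for displacements.\<close>

lemma potential_exists:
  fixes x :: "'e \<Rightarrow> 'a::comm_ring_1"
  assumes "finite (arcs G)"
    and closed: "\<And>a c. walk_chain G a a c \<Longrightarrow> (\<Sum>e\<in>arcs G. of_int (c e) * x e) = 0"
  obtains u where "\<And>e. e \<in> arcs G \<Longrightarrow> x e = u (head G e) - u (tail G e)"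
proof
  define r where "r v = (SOME a. \<exists>c. walk_chain G a v c)" for v
  define C where "C v = (SOME c. walk_chain G (r v) v c)" for v
  define u where "u v = (\<Sum>e\<in>arcs G. of_int (C v e) * x e)" for v
  have C: "walk_chain G (r v) v (C v)" for v
  proof -
    have "\<exists>a c. walk_chain G a v c"
      using walk_chain.stay[of G v] by blast
    then have "\<exists>c. walk_chain G (r v) v c"
      unfolding r_def by (rule someI_ex)
    then show ?thesis
      unfolding C_def by (rule someI_ex)
  qed
  fix e assume e: "e \<in> arcs G"
  \<comment> \<open>The ends of an edge are reachable from the same vertices, so the choice operator
    in \<open>r\<close> sees equal predicates and returns the same root.\<close>
  have "(\<exists>c. walk_chain G a (tail G e) c) \<longleftrightarrow> (\<exists>c. walk_chain G a (head G e) c)" for a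
    using e walk_chain.forward walk_chain.backward by metis
  then have r: "r (head G e) = r (tail G e)"
    by (simp add: r_def)
  define c where "c i = (if i = e then C (tail G e) e + 1 else C (tail G e) i) - C (head G e) i" for i
  have "walk_chain G (head G e) (r (tail G e)) (\<lambda>i. - C (head G e) i)"
    using walk_chain_reverse[OF C[of "head G e"]] r by simp
  from walk_chain_trans[OF this walk_chain.forward[OF C e]]
  have "walk_chain G (r (tail G e)) (r (tail G e)) c"
    by (rule back_subst[of "walk_chain G _ _"]) (auto simp: c_def)
  then have "(\<Sum>i\<in>arcs G. of_int (c i) * x i) = 0"
    by (rule closed)
  moreover have "of_int (c i) * x i = of_int (C (tail G e) i) * x i + (if i = e then x e else 0)
      - of_int (C (head G e) i) * x i" for i
    by (simp add: c_def algebra_simps)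
  ultimately have "u (tail G e) + x e - u (head G e) = 0"
    using e assms(1) by (simp add: u_def sum.distrib sum_subtractf)
  then show "x e = u (head G e) - u (tail G e)"
    by (simp add: algebra_simps)
qed

section \<open>Lifts and displacements\<close>

definition int_vectors :: "(real^2) set" where
  "int_vectors = {z. \<forall>i. z $ i \<in> \<int>}"

lemma int_vectors_arith:
  assumes "x \<in> int_vectors" "y \<in> int_vectors"
  shows "x + y \<in> int_vectors" "x - y \<in> int_vectors"
  using assms by (auto simp: int_vectors_def)

lemma uminus_int_vectors: "x \<in> int_vectors \<Longrightarrow> - x \<in> int_vectors"
  by (simp add: int_vectors_def)

lemma zero_int_vectors [simp]: "0 \<in> int_vectors"
  by (simp add: int_vectors_def)

lemma torus_lattice_eq: "torus_lattice M = (*v) M ` int_vectors"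
  by (simp add: torus_lattice_def int_vectors_def)

lemma torus_proj_eq_iff: "torus_proj M x = torus_proj M y \<longleftrightarrow> (\<exists>z\<in>int_vectors. y = x + M *v z)"
proof
  assume *: "torus_proj M x = torus_proj M y"
  have "y \<in> torus_proj M y"
    unfolding torus_proj_def torus_lattice_eq image_image
    by (rule image_eqI[of _ _ 0]) auto
  with * show "\<exists>z\<in>int_vectors. y = x + M *v z"
    by (auto simp: torus_proj_def torus_lattice_eq)
next
  assume "\<exists>z\<in>int_vectors. y = x + M *v z"
  then obtain z where z: "z \<in> int_vectors" "y = x + M *v z" by blast
  have "v \<in> torus_proj M x \<longleftrightarrow> v \<in> torus_proj M y" for v
  proof -
    have "v = x + M *v w \<longleftrightarrow> v = y + M *v (w - z)" for w
      by (simp add: z matrix_vector_mult_diff_distrib)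
    moreover have "v = y + M *v w \<longleftrightarrow> v = x + M *v (w + z)" for w
      by (simp add: z matrix_vector_right_distrib algebra_simps)
    ultimately have "(\<exists>w\<in>int_vectors. v = x + M *v w) \<longleftrightarrow> (\<exists>w\<in>int_vectors. v = y + M *v w)"
      using int_vectors_arith(1,2)[OF _ z(1)] by blast
    then show ?thesis
      by (simp add: torus_proj_def torus_lattice_eq image_iff)
  qed
  then show "torus_proj M x = torus_proj M y" by blast
qed

lemma torus_proj_square_eq_iff: "torus_proj square x = torus_proj square y \<longleftrightarrow> y - x \<in> int_vectors"
  by (auto simp: torus_proj_eq_iff matrix_vector_mul_lid) (metis add_diff_cancel_left' diff_add_cancel)

lemma quotient_map_torus_proj: "quotient_map euclidean (torus M) (torus_proj M)"
  unfolding quotient_map_def topspace_torus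
  by (auto simp: torus_def openin_quotient_topology)

lemma continuous_map_torus_proj: "continuous_map euclidean (torus M) (torus_proj M)"
  by (rule quotient_imp_continuous_map[OF quotient_map_torus_proj])

lemma continuous_map_torus_proj_compose:
  "continuous_map X euclidean q \<Longrightarrow> continuous_map X (torus M) (\<lambda>x. torus_proj M (q x))"
  using continuous_map_compose[OF _ continuous_map_torus_proj] by (simp add: o_def)

lemma continuous_map_torus_map: "continuous_map (torus square) (torus M) (torus_map M)"
proof (rule continuous_compose_quotient_map[OF quotient_map_torus_proj])
  have "continuous_map euclidean (torus M) (\<lambda>x. torus_proj M (M *v x))"
    by (rule continuous_map_torus_proj_compose)
      (simp add: linear_continuous_on matrix_vector_mul_bounded_linear)
  then show "continuous_map euclidean (torus M) (torus_map M \<circ> torus_proj square)"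
    by (simp add: o_def torus_map_proj)
qed

lemma matrix_inv_vector_mult:
  fixes M :: "real^'n^'n"
  assumes "invertible M"
  shows "matrix_inv M *v (M *v x) = x" "M *v (matrix_inv M *v x) = x"
  using someI_ex[OF assms[unfolded invertible_def]]
  by (simp_all add: matrix_vector_mul_assoc matrix_inv_def matrix_vector_mul_lid)

lemma torus_map_inv_proj:
  assumes "invertible M"
  shows "torus_map (matrix_inv M) (torus_proj M x) = torus_proj square (matrix_inv M *v x)"
proof -
  have "torus_map (matrix_inv M) (torus_map M (torus_proj square (matrix_inv M *v x))) =
      torus_proj square (matrix_inv M *v x)"
    by (simp only: torus_map_def image_image matrix_inv_vector_mult[OF assms] image_ident)
  then show ?thesis
    by (simp only: torus_map_proj matrix_inv_vector_mult[OF assms])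
qed

lemma continuous_map_torus_map_inv:
  assumes "invertible M"
  shows "continuous_map (torus M) (torus square) (torus_map (matrix_inv M))"
proof (rule continuous_compose_quotient_map[OF quotient_map_torus_proj])
  have "continuous_map euclidean (torus square) (\<lambda>x. torus_proj square (matrix_inv M *v x))"
    by (rule continuous_map_torus_proj_compose)
      (simp add: linear_continuous_on matrix_vector_mul_bounded_linear)
  then show "continuous_map euclidean (torus square) (torus_map (matrix_inv M) \<circ> torus_proj M)"
    by (simp add: o_def torus_map_inv_proj assms)
qed

text \<open>These two coordinates present the square torus as a product of circles, so that lifting
  becomes taking logarithms. The chosen representative does not matter, because \<open>cis\<close>
  is periodic.\<close>

definition circle_coord :: "2 \<Rightarrow> (real^2) set \<Rightarrow> complex" where
  "circle_coord i c = cis (2 * pi * (SOME x. torus_proj square x = c) $ i)"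

lemma circle_coord_proj: "circle_coord i (torus_proj square x) = cis (2 * pi * x $ i)"
proof -
  define y where "y = (SOME y. torus_proj square y = torus_proj square x)"
  have "torus_proj square y = torus_proj square x"
    unfolding y_def by (rule someI) simp
  then have "x - y \<in> int_vectors"
    by (simp add: torus_proj_square_eq_iff)
  then have "(x - y) $ i \<in> \<int>"
    unfolding int_vectors_def by blast
  then obtain k :: int where "(x - y) $ i = k"
    by (elim Ints_cases)
  then have "x $ i = y $ i + k"
    by simp
  then have "cis (2 * pi * x $ i) = cis (2 * pi * y $ i) * cis (2 * pi * k)"
    by (simp only: cis_mult distrib_left)
  also have "cis (2 * pi * k) = 1"
    by (rule cis_multiple_2pi) simp
  finally show ?thesis
    by (simp add: circle_coord_def y_def)
qed

lemma continuous_map_circle_coord: "continuous_map (torus square) euclidean (circle_coord i)"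
proof (rule continuous_compose_quotient_map[OF quotient_map_torus_proj])
  have "continuous_on UNIV (\<lambda>x :: real^2. cis (2 * pi * x $ i))"
    by (intro continuous_intros)
  then show "continuous_map euclidean euclidean (circle_coord i \<circ> torus_proj square)"
    by (simp add: o_def circle_coord_proj)
qed

text \<open>Each circle coordinate of \<open>f\<close> is nonzero and hence has a continuous
  logarithm on the contractible set \<open>S\<close>; the imaginary parts divided by
  \<open>2 * pi\<close> are the coordinates of the lift.\<close>

lemma torus_lift_exists:
  fixes S :: "'a::real_normed_vector set"
  assumes "contractible S" and f: "continuous_map (top_of_set S) (torus square) f"
  obtains q where "continuous_on S q" "\<And>s. s \<in> S \<Longrightarrow> torus_proj square (q s) = f s"
proof -
  have range: "\<exists>x. f s = torus_proj square x" if "s \<in> S" for s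
    using continuous_map_funspace[OF f] that by (auto simp: topspace_torus)
  have "\<exists>g. continuous_on S g \<and> (\<forall>s\<in>S. circle_coord i (f s) = exp (g s))" for i
  proof -
    have "continuous_on S (circle_coord i \<circ> f)"
      using continuous_map_compose[OF f continuous_map_circle_coord[of i]] by simp
    moreover have "(circle_coord i \<circ> f) s \<noteq> 0" if "s \<in> S" for s
      using range[OF that] by (auto simp: circle_coord_proj)
    ultimately obtain g where "continuous_on S g" "\<And>s. s \<in> S \<Longrightarrow> (circle_coord i \<circ> f) s = exp (g s)"
      using continuous_logarithm_on_contractible[OF _ assms(1)] by blast
    then show ?thesis
      by (intro exI[of _ g]) simp
  qed
  then obtain g where g: "\<And>i. continuous_on S (g i)"
    "\<And>i s. s \<in> S \<Longrightarrow> circle_coord i (f s) = exp (g i s)"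
    by metis
  define q :: "'a \<Rightarrow> real^2" where "q s = (\<chi> i. Im (g i s) / (2 * pi))" for s
  show ?thesis
  proof
    show "continuous_on S q"
      unfolding q_def by (intro continuous_on_vec_lambda continuous_intros g) auto
    fix s assume s: "s \<in> S"
    then obtain x where x: "f s = torus_proj square x"
      using range by blast
    have "(x - q s) $ i \<in> \<int>" for i
    proof -
      have e: "cis (2 * pi * x $ i) = exp (g i s)"
        using g(2)[OF s, of i] by (simp add: x circle_coord_proj)
      then have "exp (g i s) = exp (\<i> * (2 * pi * x $ i))"
        by (simp add: cis_conv_exp)
      then obtain n :: int where "g i s = \<i> * (2 * pi * x $ i) + of_int (2 * n) * pi * \<i>"
        by (auto simp: exp_eq)
      then have "Im (g i s) = 2 * pi * x $ i + 2 * n * pi"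
        by simp
      then have "(x - q s) $ i = - of_int n"
        by (simp add: q_def field_simps)
      then show ?thesis by simp
    qed
    then show "torus_proj square (q s) = f s"
      by (simp add: x torus_proj_square_eq_iff int_vectors_def)
  qed
qed

lemma continuous_int_valued_constant:
  fixes f :: "'a::topological_space \<Rightarrow> real"
  assumes "topological_space_class.connected S" "continuous_on S f" "\<And>s. s \<in> S \<Longrightarrow> f s \<in> \<int>"
  shows "f constant_on S"
proof (rule continuous_discrete_range_constant[OF assms(1,2)])
  fix x assume "x \<in> S"
  have "1 \<le> norm (f y - f x)" if "y \<in> S" "f y \<noteq> f x" for y
    using Ints_nonzero_abs_ge1[of "f y - f x"] that \<open>x \<in> S\<close> assms(3) by auto
  then show "\<exists>e>0. \<forall>y. y \<in> S \<and> f y \<noteq> f x \<longrightarrow> e \<le> norm (f y - f x)"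
    by (intro exI[of _ 1]) auto
qed

lemma continuous_on_matrix_vector:
  fixes M :: "real^'n^'m"
  shows "continuous_on S q \<Longrightarrow> continuous_on S (\<lambda>t. M *v q t)"
  using continuous_on_compose2[OF linear_continuous_on[OF matrix_vector_mul_bounded_linear], where f = q and s = S]
  by blast

text \<open>In lattice coordinates, the difference of two lifts is continuous and integer-valued,
  hence constant on a connected set.\<close>

lemma torus_lift_unique:
  assumes "topological_space_class.connected S" "continuous_on S q" "continuous_on S q'" "invertible M"
    and eq: "\<And>s. s \<in> S \<Longrightarrow> torus_proj M (q s) = torus_proj M (q' s)"
  obtains z where "z \<in> int_vectors" "\<And>s. s \<in> S \<Longrightarrow> q' s = q s + M *v z"
proof -
  define d where "d s = matrix_inv M *v (q' s - q s)" for s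
  have d: "continuous_on S d"
    unfolding d_def by (intro continuous_on_matrix_vector continuous_on_diff assms)
  have int: "d s \<in> int_vectors" if "s \<in> S" for s
    using eq[OF that] by (auto simp: torus_proj_eq_iff d_def matrix_inv_vector_mult assms(4))
  have "\<exists>k. \<forall>s\<in>S. d s $ i = k" for i
    using continuous_int_valued_constant[of S "\<lambda>s. d s $ i"] assms(1) d int
    by (auto simp: constant_on_def int_vectors_def intro: continuous_on_component)
  then obtain k where k: "\<And>i s. s \<in> S \<Longrightarrow> d s $ i = k i"
    by metis
  then have dk: "d s = (\<chi> i. k i)" if "s \<in> S" for s
    using that by (simp add: vec_eq_iff)
  have q': "q' s = q s + M *v d s" for s
    by (simp add: d_def matrix_inv_vector_mult assms(4))
  show ?thesis
  \<comment> \<open>On the empty set nothing forces the constants \<open>k\<close> to be integers,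
    so the translation 0 is supplied instead.\<close>
  proof (cases "S = {}")
    case True
    then show ?thesis using that[of 0] by simp
  next
    case False
    then have "(\<chi> i. k i) \<in> int_vectors"
      using int dk by fastforce
    moreover have "q' s = q s + M *v (\<chi> i. k i)" if "s \<in> S" for s
      using q'[of s] dk[OF that] by simp
    ultimately show ?thesis
      by (rule that)
  qed
qed

text \<open>All lifts of a path are translates of one another, so the definite description in
  \<open>displacement\<close> has a unique value, computable from any lift.\<close>

lemma displacement_eq:
  assumes M: "invertible M" and q: "is_lift M p q"
  shows "displacement M p = q 1 - q 0"
  unfolding displacement_def
proof (rule the_equality)
  show "\<exists>r. is_lift M p r \<and> q 1 - q 0 = pathfinish r - pathstart r"
    using q by (auto simp: pathfinish_def pathstart_def)
next
  fix v assume "\<exists>r. is_lift M p r \<and> v = pathfinish r - pathstart r"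
  then obtain r where r: "is_lift M p r" "v = r 1 - r 0"
    by (auto simp: pathfinish_def pathstart_def)
  obtain z where "\<And>s. s \<in> {0..1} \<Longrightarrow> r s = q s + M *v z"
    using q r M by (auto simp: is_lift_def path_def intro: torus_lift_unique[of "{0..1}" q r M])
  then show "v = q 1 - q 0"
    using r by simp
qed

lemma is_lift_translate:
  assumes "is_lift M p q" "z \<in> int_vectors"
  shows "is_lift M p (\<lambda>t. q t + M *v z)"
proof -
  have "torus_proj M (q t + M *v z) = torus_proj M (q t)" for t
    using assms(2) by (subst eq_commute) (auto simp: torus_proj_eq_iff)
  then show ?thesis
    using assms by (auto simp: is_lift_def path_def intro!: continuous_intros)
qed

lemma is_lift_reverse:
  assumes "is_lift M p q"
  shows "is_lift M (\<lambda>t. p (1 - t)) (\<lambda>t. q (1 - t))"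
  using assms path_reversepath[of q] by (auto simp: is_lift_def reversepath_def)

lemma is_lift_torus_map:
  assumes "is_lift square p q"
  shows "is_lift M (torus_map M \<circ> p) (\<lambda>t. M *v q t)"
  using assms continuous_on_matrix_vector[of "{0..1}" q M]
  by (auto simp: is_lift_def path_def torus_map_proj[symmetric])

section \<open>Lifts of edges, and displacements on different tori\<close>

lemma edge_param_graph_points:
  assumes "wf_digraph G" "e \<in> arcs G" "t \<in> {0..1}"
  shows "edge_param G e t \<in> graph_points G"
  using assms by (auto simp: edge_param_def graph_points_def wf_digraph_def)

lemma continuous_map_edge_param:
  assumes "wf_digraph G" "e \<in> arcs G"
  shows "continuous_map (top_of_set {0..1}) (graph_space G) (edge_param G e)"
  using assms edge_param_graph_points[OF assms]
  by (auto simp: continuous_map_def openin_graph_space topspace_graph_space)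

lemma drawing_wf: "drawing M G f \<Longrightarrow> wf_digraph G"
  by (simp add: drawing_def fin_digraph.axioms(1))

lemma continuous_map_edge_path:
  assumes "drawing M G f" "e \<in> arcs G"
  shows "continuous_map (top_of_set {0..1}) (torus M) (edge_path G f e)"
  using continuous_map_compose[OF continuous_map_edge_param[OF drawing_wf[OF assms(1)] assms(2)], of "torus M" f]
    assms(1)
  by (simp add: drawing_def edge_path_def[abs_def] o_def)

lemma edge_path_lift_square:
  assumes "drawing square G f" "e \<in> arcs G"
  obtains q where "is_lift square (edge_path G f e) q"
proof -
  have "contractible {0..1::real}"
    by (intro convex_imp_contractible) auto
  then obtain q where "continuous_on {0..1} q"
    "\<And>s. s \<in> {0..1} \<Longrightarrow> torus_proj square (q s) = edge_path G f e s"
    using torus_lift_exists[OF _ continuous_map_edge_path[OF assms]] by blast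
  then show ?thesis
    by (intro that[of q]) (simp add: is_lift_def path_def)
qed

lemma drawing_torus_map: "drawing square G f \<Longrightarrow> drawing M G (torus_map M \<circ> f)"
  using continuous_map_compose[OF _ continuous_map_torus_map] by (auto simp: drawing_def)

lemma drawing_torus_map_inv:
  "invertible M \<Longrightarrow> drawing M G f \<Longrightarrow> drawing square G (torus_map (matrix_inv M) \<circ> f)"
  using continuous_map_compose[OF _ continuous_map_torus_map_inv] by (auto simp: drawing_def)

lemma torus_map_inverse:
  assumes "invertible M"
  shows "torus_map M (torus_map (matrix_inv M) c) = c" "torus_map (matrix_inv M) (torus_map M c) = c"
  by (simp_all add: torus_map_def image_image matrix_inv_vector_mult[OF assms])

lemma edge_path_lift:
  assumes "invertible M" "drawing M G f" "e \<in> arcs G"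
  obtains q where "is_lift M (edge_path G f e) q"
proof -
  obtain q where q: "is_lift square (edge_path G (torus_map (matrix_inv M) \<circ> f) e) q"
    using edge_path_lift_square[OF drawing_torus_map_inv[OF assms(1,2)] assms(3)] .
  have "torus_map M \<circ> edge_path G (torus_map (matrix_inv M) \<circ> f) e = edge_path G f e"
    by (simp add: fun_eq_iff edge_path_def torus_map_inverse assms(1))
  with is_lift_torus_map[OF q, of M] show ?thesis
    by (intro that[of "\<lambda>t. M *v q t"]) simp
qed

lemma dart_displacement_lift:
  assumes "invertible M" "is_lift M (edge_path G f e) q"
  shows "dart_displacement M G f (e, True) = q 1 - q 0"
    "dart_displacement M G f (e, False) = q 0 - q 1"
  using displacement_eq[OF assms] displacement_eq[OF assms(1) is_lift_reverse[OF assms(2)]]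
  by (simp_all add: dart_displacement_def dart_path_def)

lemma dart_displacement_reverse:
  assumes "invertible M" "drawing M G f" "e \<in> arcs G"
  shows "dart_displacement M G f (e, False) = - dart_displacement M G f (e, True)"
proof -
  obtain q where "is_lift M (edge_path G f e) q"
    using edge_path_lift[OF assms] .
  then show ?thesis
    by (simp add: dart_displacement_lift[OF assms(1)])
qed

lemma invertible_square: "invertible square"
  by (auto simp: invertible_def intro: exI[of _ square])

lemma dart_displacement_torus_map:
  assumes "invertible M" "drawing square G f" "d \<in> darts G"
  shows "dart_displacement M G (torus_map M \<circ> f) d = M *v dart_displacement square G f d"
proof -
  obtain e b where d: "d = (e, b)" "e \<in> arcs G"
    using assms(3) by (auto simp: darts_def)
  obtain q where q: "is_lift square (edge_path G f e) q"
    using edge_path_lift_square[OF assms(2) d(2)] .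
  have "is_lift M (edge_path G (torus_map M \<circ> f) e) (\<lambda>t. M *v q t)"
    using is_lift_torus_map[OF q] by (simp add: edge_path_def[abs_def] o_def)
  from dart_displacement_lift[OF assms(1) this] dart_displacement_lift[OF invertible_square q]
  show ?thesis
    by (cases b) (simp_all add: d matrix_vector_mult_diff_distrib)
qed

lemma dart_displacement_torus_map_inv:
  assumes "invertible M" "drawing M G f" "d \<in> darts G"
  shows "dart_displacement square G (torus_map (matrix_inv M) \<circ> f) d =
    matrix_inv M *v dart_displacement M G f d"
proof -
  have "torus_map M \<circ> (torus_map (matrix_inv M) \<circ> f) = f"
    by (simp add: fun_eq_iff torus_map_inverse assms(1))
  then show ?thesis
    using dart_displacement_torus_map[OF assms(1) drawing_torus_map_inv[OF assms(1,2)] assms(3)]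
    by (simp add: matrix_inv_vector_mult assms(1))
qed

text \<open>The homotopy restricted to one edge lifts to the parameter square. Two opposite sides
  lift the edge in both drawings, the other two lift the tracks of its end vertices, and the side
  differences add up to zero around the square.\<close>

lemma homotopic_drawings_displacement:
  assumes "fin_digraph G" "homotopic_drawings square G f g"
  obtains u where "\<And>e. e \<in> arcs G \<Longrightarrow> dart_displacement square G g (e, True) =
    dart_displacement square G f (e, True) + u (head G e) - u (tail G e)"
proof -
  interpret fin_digraph G by fact
  obtain h where h: "continuous_map (prod_topology (top_of_set {0..1::real}) (graph_space G)) (torus square) h"
    and h01: "\<And>x. h (0, x) = f x" "\<And>x. h (1, x) = g x"
    using assms(2) by (auto simp: homotopic_drawings_def homotopic_with_def)
  \<comment> \<open>The displacement of the track of \<open>v\<close> does not depend on the lift,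
    so it is the same for all edges at \<open>v\<close>.\<close>
  define u where "u v = displacement square (\<lambda>s. h (s, Vertex v))" for v
  show ?thesis
  proof (rule that)
    fix e assume e: "e \<in> arcs G"
    have "continuous_map (prod_topology (top_of_set {0..1::real}) (top_of_set {0..1}))
        (prod_topology (top_of_set {0..1}) (graph_space G)) (\<lambda>(s, t). (s, edge_param G e t))"
      using continuous_map_prod_top[of "top_of_set {0..1::real}" "top_of_set {0..1::real}" "top_of_set {0..1::real}" "graph_space G" id "edge_param G e"]
        continuous_map_edge_param[OF wf_digraph_axioms e] by simp
    from continuous_map_compose[OF this h]
    have "continuous_map (top_of_set unit_square) (torus square) (h \<circ> (\<lambda>(s, t). (s, edge_param G e t)))"
      by simp
    moreover have "contractible unit_square"
      by (intro convex_imp_contractible convex_Times) auto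
    ultimately obtain Q where Q: "continuous_on unit_square Q"
      and Qh: "\<And>z. z \<in> unit_square \<Longrightarrow> torus_proj square (Q z) = (h \<circ> (\<lambda>(s, t). (s, edge_param G e t))) z"
      using torus_lift_exists by blast
    define F where "F s t = Q (s, t)" for s t
    have FQ: "torus_proj square (F s t) = h (s, edge_param G e t)" if "s \<in> {0..1}" "t \<in> {0..1}" for s t
      using Qh[of "(s, t)"] that by (simp add: F_def)
    have c1: "continuous_on {0..1} (\<lambda>s. F s t)" if "t \<in> {0..1}" for t
      unfolding F_def by (rule continuous_on_compose2[OF Q]) (use that in \<open>auto intro!: continuous_intros\<close>)
    have c2: "continuous_on {0..1} (F s)" if "s \<in> {0..1}" for s
      unfolding F_def by (rule continuous_on_compose2[OF Q]) (use that in \<open>auto intro!: continuous_intros\<close>)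
    have "is_lift square (edge_path G f e) (F 0)" "is_lift square (edge_path G g e) (F 1)"
      using c2 FQ by (auto simp: is_lift_def path_def edge_path_def h01)
    moreover have "is_lift square (\<lambda>s. h (s, Vertex (tail G e))) (\<lambda>s. F s 0)"
      "is_lift square (\<lambda>s. h (s, Vertex (head G e))) (\<lambda>s. F s 1)"
      using c1 FQ by (auto simp: is_lift_def path_def edge_param_def)
    ultimately show "dart_displacement square G g (e, True) =
        dart_displacement square G f (e, True) + u (head G e) - u (tail G e)"
      by (simp add: dart_displacement_lift[OF invertible_square] u_def displacement_eq[OF invertible_square])
  qed
qed

lemma sum_darts_at:
  assumes "fin_digraph G"
  shows "(\<Sum>d\<in>{d \<in> darts G. dart_tail G d = p}. F d) =
    (\<Sum>e\<in>{e \<in> arcs G. tail G e = p}. F (e, True)) + (\<Sum>e\<in>{e \<in> arcs G. head G e = p}. F (e, False))"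
proof -
  interpret fin_digraph G by fact
  have "{d \<in> darts G. dart_tail G d = p} =
      (\<lambda>e. (e, True)) ` {e \<in> arcs G. tail G e = p} \<union> (\<lambda>e. (e, False)) ` {e \<in> arcs G. head G e = p}"
    by (auto simp: darts_def dart_tail_def split: if_splits)
  moreover have "sum F ((\<lambda>e. (e, True)) ` {e \<in> arcs G. tail G e = p} \<union> (\<lambda>e. (e, False)) ` {e \<in> arcs G. head G e = p}) =
      sum F ((\<lambda>e. (e, True)) ` {e \<in> arcs G. tail G e = p}) + sum F ((\<lambda>e. (e, False)) ` {e \<in> arcs G. head G e = p})"
    by (intro sum.union_disjoint) auto
  ultimately show ?thesis
    by (simp add: sum.reindex inj_on_def)
qed

text \<open>The dart leaving the head of an edge has the opposite displacement, so the equilibrium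
  sum at a vertex is outflow minus inflow, coordinate by coordinate.\<close>

lemma equilibrium_stress_circulation:
  assumes "drawing square G f" "equilibrium_stress square G f \<omega>"
  shows "circulation G (\<lambda>e. \<omega> e * dart_displacement square G f (e, True) $ i)"
  unfolding circulation_def
proof
  fix p assume "p \<in> verts G"
  let ?D = "dart_displacement square G f"
  have fin: "fin_digraph G"
    using assms(1) by (simp add: drawing_def)
  have "(\<Sum>e\<in>{e \<in> arcs G. tail G e = p}. \<omega> e *\<^sub>R ?D (e, True)) +
      (\<Sum>e\<in>{e \<in> arcs G. head G e = p}. \<omega> e *\<^sub>R ?D (e, False)) = 0"
    using assms(2) \<open>p \<in> verts G\<close> sum_darts_at[OF fin, of "\<lambda>d. \<omega> (fst d) *\<^sub>R ?D d" p]
    by (simp add: equilibrium_stress_def)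
  moreover have "(\<Sum>e\<in>{e \<in> arcs G. head G e = p}. \<omega> e *\<^sub>R ?D (e, False)) =
      - (\<Sum>e\<in>{e \<in> arcs G. head G e = p}. \<omega> e *\<^sub>R ?D (e, True))"
    using dart_displacement_reverse[OF invertible_square assms(1)]
    by (simp add: sum_negf[symmetric])
  ultimately have "(\<Sum>e\<in>{e \<in> arcs G. tail G e = p}. \<omega> e *\<^sub>R ?D (e, True)) =
      (\<Sum>e\<in>{e \<in> arcs G. head G e = p}. \<omega> e *\<^sub>R ?D (e, True))"
    by simp
  then have "(\<Sum>e\<in>{e \<in> arcs G. tail G e = p}. \<omega> e *\<^sub>R ?D (e, True)) $ i =
      (\<Sum>e\<in>{e \<in> arcs G. head G e = p}. \<omega> e *\<^sub>R ?D (e, True)) $ i"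
    by simp
  then show "(\<Sum>e\<in>{e \<in> arcs G. tail G e = p}. \<omega> e * ?D (e, True) $ i) =
      (\<Sum>e\<in>{e \<in> arcs G. head G e = p}. \<omega> e * ?D (e, True) $ i)"
    by simp
qed

section \<open>Intersection numbers\<close>

text \<open>All edges are lifted from one fixed lift \<open>P\<close> of the vertices.
  \<open>Q e\<close> records how far the lifted edge misses the chosen lift of its head; it is an
  integer version of the displacement, differing from it by the coboundary of
  \<open>P\<close>.\<close>

lemma drawing_lifts:
  assumes "drawing square G f"
  obtains P q Q where
    "\<And>v. v \<in> verts G \<Longrightarrow> torus_proj square (P v) = f (Vertex v)"
    "\<And>e. e \<in> arcs G \<Longrightarrow> is_lift square (edge_path G f e) (q e)"
    "\<And>e. e \<in> arcs G \<Longrightarrow> q e 0 = P (tail G e)"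
    "\<And>e. e \<in> arcs G \<Longrightarrow> q e 1 = P (head G e) + Q e"
    "\<And>e. e \<in> arcs G \<Longrightarrow> Q e \<in> int_vectors"
proof -
  have wf: "wf_digraph G"
    by (rule drawing_wf[OF assms])
  interpret wf_digraph G by fact
  define P where "P v = (SOME x. torus_proj square x = f (Vertex v))" for v
  have P: "torus_proj square (P v) = f (Vertex v)" if "v \<in> verts G" for v
  proof -
    have "Vertex v \<in> topspace (graph_space G)"
      using that by (simp add: topspace_graph_space wf graph_points_def)
    moreover have "continuous_map (graph_space G) (torus square) f"
      using assms by (simp add: drawing_def)
    ultimately have "f (Vertex v) \<in> range (torus_proj square)"
      using continuous_map_funspace by (fastforce simp: topspace_torus)
    then obtain x where "torus_proj square x = f (Vertex v)"
      by (metis imageE)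
    then show ?thesis
      unfolding P_def by (rule someI)
  qed
  have "\<exists>q. is_lift square (edge_path G f e) q \<and> q 0 = P (tail G e)" if e: "e \<in> arcs G" for e
  proof -
    obtain q where q: "is_lift square (edge_path G f e) q"
      using edge_path_lift_square[OF assms e] .
    have "torus_proj square (q 0) = torus_proj square (P (tail G e))"
      using q P[of "tail G e"] e by (simp add: is_lift_def edge_path_def edge_param_def)
    then have "P (tail G e) - q 0 \<in> int_vectors"
      by (simp add: torus_proj_square_eq_iff)
    from is_lift_translate[OF q this] show ?thesis
      by (intro exI[of _ "\<lambda>t. q t + (P (tail G e) - q 0)"]) (simp add: matrix_vector_mul_lid)
  qed
  then obtain q where q: "\<And>e. e \<in> arcs G \<Longrightarrow> is_lift square (edge_path G f e) (q e)"
    "\<And>e. e \<in> arcs G \<Longrightarrow> q e 0 = P (tail G e)"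
    by metis
  have "q e 1 - P (head G e) \<in> int_vectors" if e: "e \<in> arcs G" for e
  proof -
    have "torus_proj square (P (head G e)) = torus_proj square (q e 1)"
      using q(1)[OF e] P[of "head G e"] e by (simp add: is_lift_def edge_path_def edge_param_def)
    then show ?thesis
      by (simp add: torus_proj_square_eq_iff)
  qed
  then show ?thesis
    by (intro that[of P q "\<lambda>e. q e 1 - P (head G e)"] P q) auto
qed

section \<open>The index of one edge against one dual edge\<close>

definition plane_to_complex :: "real^2 \<Rightarrow> complex" where
  "plane_to_complex v = Complex (v $ 1) (v $ 2)"

lemma plane_to_complex_add: "plane_to_complex (v + w) = plane_to_complex v + plane_to_complex w"
  by (simp add: plane_to_complex_def complex_eq_iff)

lemma plane_to_complex_0: "plane_to_complex 0 = 0"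
  by (simp add: plane_to_complex_def complex_eq_iff)

lemma continuous_on_plane_to_complex:
  "continuous_on S f \<Longrightarrow> continuous_on S (\<lambda>x. plane_to_complex (f x))"
  unfolding plane_to_complex_def by (intro continuous_intros)

lemma plane_to_complex_gaussian: "plane_to_complex v \<in> gaussian_ints \<longleftrightarrow> v \<in> int_vectors"
  by (auto simp: plane_to_complex_def gaussian_ints_def int_vectors_def forall_2)

lemma plane_to_complex_int:
  assumes "z \<in> int_vectors"
  obtains m n :: int where "plane_to_complex z = Complex m n" "z $ 1 = m" "z $ 2 = n"
proof -
  have "z $ 1 \<in> \<int>" "z $ 2 \<in> \<int>"
    using assms by (auto simp: int_vectors_def)
  then obtain m n where "z $ 1 = of_int m" "z $ 2 = of_int n"
    by (metis Ints_cases)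
  then show ?thesis
    by (intro that[of m n]) (auto simp: plane_to_complex_def)
qed

lemma winding_number_quasi_sine_plane_shift:
  assumes p: "continuous_on {0..1} p" and z: "z \<in> int_vectors"
    and nz: "\<And>t. t \<in> {0..1} \<Longrightarrow> p t + z \<notin> int_vectors"
  shows "winding_number (\<lambda>t. quasi_sine (plane_to_complex (p t + z))) 0 =
    winding_number (\<lambda>t. quasi_sine (plane_to_complex (p t))) 0 - of_real (z $ 2 * (p 1 $ 1 - p 0 $ 1))"
proof -
  obtain m n :: int where mn: "plane_to_complex z = Complex m n" "z $ 2 = n"
    using plane_to_complex_int[OF z] by blast
  have "p t \<notin> int_vectors" if "t \<in> {0..1}" for t
    using nz[OF that] int_vectors_arith(1)[OF _ z] by blast
  then have "quasi_sine (plane_to_complex (p t)) \<noteq> 0" if "t \<in> {0..1}" for t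
    using that by (simp add: quasi_sine_eq_0_iff plane_to_complex_gaussian)
  moreover have "path (\<lambda>t. plane_to_complex (p t))"
    unfolding path_def by (intro continuous_on_plane_to_complex p)
  ultimately have "winding_number (\<lambda>t. quasi_sine (plane_to_complex (p t) + Complex m n)) 0 =
      winding_number (\<lambda>t. quasi_sine (plane_to_complex (p t))) 0 -
      of_real (n * (Re (plane_to_complex (p 1)) - Re (plane_to_complex (p 0))))"
    by (intro winding_number_quasi_sine_shift)
  then show ?thesis
    by (simp add: plane_to_complex_add mn) (simp add: plane_to_complex_def)
qed

lemma edge_param_eq_Interior: "edge_param G e t = Interior e' s \<longleftrightarrow> e = e' \<and> t = s \<and> t \<noteq> 0 \<and> t \<noteq> 1"
  by (auto simp: edge_param_def)

lemma embedding_edge_path_eq: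
  assumes "embedding M G f" "e \<in> arcs G" "e' \<in> arcs G" "t \<in> {0..1}" "s \<in> {0<..<1}"
    and "edge_path G f e t = edge_path G f e' s"
  shows "e = e' \<and> t = s"
proof -
  have wf: "wf_digraph G"
    using assms(1) drawing_wf by (auto simp: embedding_def)
  have "edge_param G e t = edge_param G e' s"
    using assms edge_param_graph_points[OF wf] by (auto simp: embedding_def edge_path_def inj_on_def topspace_graph_space wf)
  moreover have "edge_param G e' s = Interior e' s"
    using assms(5) by (auto simp: edge_param_def)
  ultimately show ?thesis
    by (simp add: edge_param_eq_Interior)
qed

lemma natural_dual_edge:
  assumes "natural_dual_embedding G h H k" "e \<in> arcs G"
  obtains s t where "s \<in> {0<..<1}" "t \<in> {0<..<1}" "edge_path G h e s = edge_path H k e t"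
    "edge_path H k e ` {0..1} \<inter> h ` topspace (graph_space G) = {edge_path G h e s}"
    "crosses_right_to_left square (edge_path G h e) (edge_path H k e)"
proof -
  have "\<forall>e\<in>arcs G. \<exists>s\<in>{0<..<1}. \<exists>t\<in>{0<..<1}.
        edge_path G h e s = edge_path H k e t \<and>
        edge_path H k e ` {0..1} \<inter> h ` topspace (graph_space G) = {edge_path G h e s} \<and>
        crosses_right_to_left square (edge_path G h e) (edge_path H k e)"
    using assms(1) unfolding natural_dual_embedding_def by (elim conjE) assumption
  from bspec[OF this assms(2)] show ?thesis
    by (elim bexE conjE) (rule that)
qed

text \<open>The dual edge has just one point in common with the drawing of \<open>G\<close>.
  Injectivity of both embeddings recovers the edge and both parameters from it; the interior
  position of the point excludes vertices.\<close>

lemma dual_edge_crossing: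
  assumes G: "embedding square G h" and dual: "natural_dual_embedding G h H k" and e': "e' \<in> arcs G"
  obtains s t where "s \<in> {0<..<1}" "t \<in> {0<..<1}"
    "\<And>e x y. e \<in> arcs G \<Longrightarrow> x \<in> {0..1} \<Longrightarrow> y \<in> {0..1} \<Longrightarrow> edge_path H k e' x = edge_path G h e y \<Longrightarrow>
       e = e' \<and> x = t \<and> y = s"
proof -
  have H: "embedding square H k" "arcs H = arcs G"
    using dual by (auto simp: natural_dual_embedding_def)
  obtain s t where st: "s \<in> {0<..<1}" "t \<in> {0<..<1}" "edge_path G h e' s = edge_path H k e' t"
    and meet: "edge_path H k e' ` {0..1} \<inter> h ` topspace (graph_space G) = {edge_path G h e' s}"
    using natural_dual_edge[OF dual e'] .
  show ?thesis
  proof (rule that[OF st(1,2)])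
    fix e x y
    assume e: "e \<in> arcs G" and x: "x \<in> {0..1}" and y: "y \<in> {0..1}"
      and eq: "edge_path H k e' x = edge_path G h e y"
    have wf: "wf_digraph G"
      using G drawing_wf by (auto simp: embedding_def)
    have "edge_path G h e y \<in> h ` topspace (graph_space G)"
      using edge_param_graph_points[OF wf e y] by (simp add: edge_path_def topspace_graph_space wf)
    moreover have "edge_path G h e y \<in> edge_path H k e' ` {0..1}"
      using x by (intro image_eqI[of _ _ x] eq[symmetric])
    ultimately have *: "edge_path G h e y = edge_path G h e' s"
      using meet by blast
    then have "e = e' \<and> y = s"
      using embedding_edge_path_eq[OF G e e' y st(1)] by simp
    moreover have "x = t"
      using embedding_edge_path_eq[OF H(1) _ _ x st(2), of e' e'] e' H(2) * eq st(3) by simp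
    ultimately show "e = e' \<and> x = t \<and> y = s" by simp
  qed
qed

text \<open>If the edges differ, no lifts meet modulo the lattice and the index is 0. If they agree,
  the lifts provided by \<open>crosses_right_to_left\<close> have index 1, and arbitrary lifts
  differ from those by lattice vectors, which \<open>boundary_winding_quasi_sine_local\<close>
  absorbs.\<close>

lemma dual_edge_winding:
  assumes G: "embedding square G h" and dual: "natural_dual_embedding G h H k"
    and e: "e \<in> arcs G" and e': "e' \<in> arcs G"
    and q: "is_lift square (edge_path G h e) q" and r: "is_lift square (edge_path H k e') r"
  shows "boundary_winding (\<lambda>x y. quasi_sine (plane_to_complex (r x - q y))) = of_bool (e = e')"
    and "nonzero_on_boundary (\<lambda>x y. quasi_sine (plane_to_complex (r x - q y)))"
proof -
  obtain s t where st: "s \<in> {0<..<1}" "t \<in> {0<..<1}"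
    and cross: "\<And>e x y. e \<in> arcs G \<Longrightarrow> x \<in> {0..1} \<Longrightarrow> y \<in> {0..1} \<Longrightarrow>
      edge_path H k e' x = edge_path G h e y \<Longrightarrow> e = e' \<and> x = t \<and> y = s"
    by (rule dual_edge_crossing[OF G dual e']) blast
  have hit: "e = e' \<and> x = t \<and> y = s"
    if "is_lift square (edge_path G h e) q" "is_lift square (edge_path H k e') r"
      "x \<in> {0..1}" "y \<in> {0..1}" "r x - q y \<in> int_vectors" for q r x y
  proof (rule cross[OF e that(3,4)])
    have "torus_proj square (q y) = torus_proj square (r x)"
      using that(5) by (simp add: torus_proj_square_eq_iff)
    with that show "edge_path H k e' x = edge_path G h e y"
      by (simp add: is_lift_def)
  qed
  have off: "r x - q y \<notin> int_vectors"
    if "is_lift square (edge_path G h e) q" "is_lift square (edge_path H k e') r"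
      "x \<in> {0..1}" "y \<in> {0..1}" "x \<in> {0, 1} \<or> y \<in> {0, 1}" for q r x y
    using hit[OF that(1-4)] st that(5) by auto
  have cont: "continuous_on unit_square (\<lambda>(x, y). plane_to_complex (r x - q y))"
    if "is_lift square (edge_path G h e) q" "is_lift square (edge_path H k e') r" for q r
  proof -
    have "continuous_on unit_square (\<lambda>z. r (fst z))" "continuous_on unit_square (\<lambda>z. q (snd z))"
      using that by (auto simp: is_lift_def path_def intro!: continuous_intros elim!: continuous_on_compose2)
    then show ?thesis
      unfolding split_def by (intro continuous_on_plane_to_complex continuous_intros)
  qed
  show "nonzero_on_boundary (\<lambda>x y. quasi_sine (plane_to_complex (r x - q y)))"
    using off[OF q r] by (simp add: nonzero_on_boundary_def quasi_sine_eq_0_iff plane_to_complex_gaussian)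
  show "boundary_winding (\<lambda>x y. quasi_sine (plane_to_complex (r x - q y))) = of_bool (e = e')"
  proof (cases "e = e'")
    case False
    then have "plane_to_complex (r x - q y) \<notin> gaussian_ints" if "x \<in> {0..1}" "y \<in> {0..1}" for x y
      using hit[OF q r that] by (auto simp: plane_to_complex_gaussian)
    from boundary_winding_quasi_sine_zero_free[OF cont[OF q r] this] False show ?thesis
      by simp
  next
    case True
    have "crosses_right_to_left square (edge_path G h e) (edge_path H k e')"
      using natural_dual_edge[OF dual e'] True by blast
    then obtain q' r' where q': "is_lift square (edge_path G h e) q'" and r': "is_lift square (edge_path H k e') r'"
      and ne: "path_image q' \<inter> path_image r' \<noteq> {}" and ci: "crossing_index q' r' = 1"
      unfolding crosses_right_to_left_def by blast
    obtain x0 y0 where "x0 \<in> {0..1}" "y0 \<in> {0..1}" "r' x0 = q' y0"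
      using ne unfolding path_image_def by force
    \<comment> \<open>The only parameters whose difference is a lattice vector are
      \<open>(t, s)\<close>. As these two lifts do meet somewhere, that vector is 0, so
      \<open>F\<close> below attains no other lattice value.\<close>
    then have zero: "r' t - q' s = 0"
      using hit[OF q' r', of x0 y0] by auto
    have conn: "topological_space_class.connected {0..1::real}"
      by simp
    obtain z1 where z1: "z1 \<in> int_vectors" "\<And>y. y \<in> {0..1} \<Longrightarrow> q y = q' y + z1"
      using torus_lift_unique[OF conn _ _ invertible_square, of q' q] q q'
      by (auto simp: is_lift_def path_def matrix_vector_mul_lid)
    obtain z2 where z2: "z2 \<in> int_vectors" "\<And>x. x \<in> {0..1} \<Longrightarrow> r x = r' x + z2"
      using torus_lift_unique[OF conn _ _ invertible_square, of r' r] r r'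
      by (auto simp: is_lift_def path_def matrix_vector_mul_lid)
    obtain m n :: int where mn: "plane_to_complex (z2 - z1) = Complex m n"
      using plane_to_complex_int[OF int_vectors_arith(2)[OF z2(1) z1(1)]] by blast
    define F where "F x y = plane_to_complex (r' x - q' y)" for x y
    have F: "plane_to_complex (r x - q y) = F x y + Complex m n" if "x \<in> {0..1}" "y \<in> {0..1}" for x y
      unfolding F_def mn[symmetric] plane_to_complex_add[symmetric] z1(2)[OF that(2)] z2(2)[OF that(1)]
      by (simp add: algebra_simps)
    have lat: "F x y = 0" if "x \<in> {0..1}" "y \<in> {0..1}" "F x y \<in> gaussian_ints" for x y
    proof -
      have "r' x - q' y \<in> int_vectors"
        using that(3) by (simp only: F_def plane_to_complex_gaussian)
      then have "r' x - q' y = 0"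
        using hit[OF q' r' that(1,2)] zero by blast
      then show ?thesis
        by (simp only: F_def plane_to_complex_0)
    qed
    have contF: "continuous_on unit_square (\<lambda>(x, y). F x y)"
      unfolding F_def by (rule cont[OF q' r'])
    have nzF: "nonzero_on_boundary F"
    proof -
      have "F x y \<noteq> 0" if "x \<in> {0..1}" "y \<in> {0..1}" "x \<in> {0, 1} \<or> y \<in> {0, 1}" for x y
      proof
        assume "F x y = 0"
        then have "F x y \<in> gaussian_ints"
          by (simp add: gaussian_ints_def)
        then show False
          using off[OF q' r' that] by (simp only: F_def plane_to_complex_gaussian)
      qed
      then show ?thesis by (simp add: nonzero_on_boundary_def)
    qed
    have "boundary_winding (\<lambda>x y. quasi_sine (plane_to_complex (r x - q y))) =
        boundary_winding (\<lambda>x y. quasi_sine (F x y + Complex m n))"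
      unfolding boundary_winding_def
      by (intro arg_cong2[of _ _ _ _ "(+)"] arg_cong2[of _ _ _ _ "(-)"] winding_number_cong) (simp_all add: F)
    also have "\<dots> = boundary_winding F"
      by (rule boundary_winding_quasi_sine_local[OF contF lat nzF])
    also have "\<dots> = crossing_index q' r'"
      unfolding boundary_winding_eq_winding_number[OF contF nzF, symmetric] crossing_index_def
      by (simp add: F_def plane_to_complex_def Let_def)
    finally show ?thesis
      by (simp add: ci True)
  qed
qed

theorem intersection_pairing:
  assumes G: "embedding square G h" and dual: "natural_dual_embedding G h H k"
    and \<phi>: "circulation G \<phi>" and c: "circulation H c"
  defines "\<Phi> \<equiv> \<Sum>e\<in>arcs G. \<phi> e *\<^sub>R dart_displacement square G h (e, True)"
    and "C \<equiv> \<Sum>e\<in>arcs G. c e *\<^sub>R dart_displacement square H k (e, True)"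
  shows "(\<Sum>e\<in>arcs G. \<phi> e * c e) = C $ 2 * \<Phi> $ 1 - C $ 1 * \<Phi> $ 2"
proof -
  have H: "embedding square H k" and arcs: "arcs H = arcs G"
    using dual by (auto simp: natural_dual_embedding_def)
  have dG: "drawing square G h" and dH: "drawing square H k"
    using G H by (auto simp: embedding_def)
  then have fG: "fin_digraph G" and fH: "fin_digraph H"
    by (auto simp: drawing_def)
  obtain P q Q where
    q: "\<And>e. e \<in> arcs G \<Longrightarrow> is_lift square (edge_path G h e) (q e)"
    and q0: "\<And>e. e \<in> arcs G \<Longrightarrow> q e 0 = P (tail G e)"
    and q1: "\<And>e. e \<in> arcs G \<Longrightarrow> q e 1 = P (head G e) + Q e"
    and Q: "\<And>e. e \<in> arcs G \<Longrightarrow> Q e \<in> int_vectors"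
    by (rule drawing_lifts[OF dG]) (rule that; assumption)
  obtain P' r R where
    r: "\<And>e. e \<in> arcs G \<Longrightarrow> is_lift square (edge_path H k e) (r e)"
    and r0: "\<And>e. e \<in> arcs G \<Longrightarrow> r e 0 = P' (tail H e)"
    and r1: "\<And>e. e \<in> arcs G \<Longrightarrow> r e 1 = P' (head H e) + R e"
    and R: "\<And>e. e \<in> arcs G \<Longrightarrow> R e \<in> int_vectors"
    by (rule drawing_lifts[OF dH, unfolded arcs]) (rule that; assumption)
  define D where "D e = dart_displacement square G h (e, True)" for e
  define D' where "D' e = dart_displacement square H k (e, True)" for e
  have D: "D e = q e 1 - q e 0" "D' e = r e 1 - r e 0" if "e \<in> arcs G" for e
    using dart_displacement_lift(1)[OF invertible_square] q[OF that] r[OF that] by (auto simp: D_def D'_def)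
  \<comment> \<open>\<open>b\<close> belongs to a dual edge and a vertex of \<open>G\<close>,
    \<open>t\<close> to a vertex of \<open>H\<close> and an edge of \<open>G\<close>. In the vertex
    argument each acts as a potential, so its differences vanish against a circulation. The real
    part keeps just the change of argument.\<close>
  define b where "b e v = Re (winding_number (\<lambda>x. quasi_sine (plane_to_complex (r e x - P v))) 0)" for e v
  define t where "t u e = Re (winding_number (\<lambda>y. quasi_sine (plane_to_complex (P' u - q e y))) 0)" for u e
  \<comment> \<open>Opposite sides of the parameter square differ by a vertex difference together
    with the shift \<open>R e'\<close> or \<open>Q e\<close>. The multiplier of
    \<open>quasi_sine\<close> turns the vertical part of the shift, times the horizontal extent of
    the other edge, into the two products.\<close>
  have key: "of_bool (e = e') = (b e' (tail G e) - b e' (head G e)) + (t (head H e') e - t (tail H e') e)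
      + R e' $ 2 * D e $ 1 - Q e $ 2 * D' e' $ 1"
    if e: "e \<in> arcs G" and e': "e' \<in> arcs G" for e e'
  proof -
    let ?F = "\<lambda>x y. quasi_sine (plane_to_complex (r e' x - q e y))"
    have nz: "r e' x - q e y \<notin> int_vectors"
      if "x \<in> {0..1}" "y \<in> {0..1}" "x \<in> {0, 1} \<or> y \<in> {0, 1}" for x y
      using dual_edge_winding(2)[OF G dual e e' q[OF e] r[OF e']] that
      by (auto simp: nonzero_on_boundary_def quasi_sine_eq_0_iff plane_to_complex_gaussian)
    have cr: "continuous_on {0..1} (r e')" and cq: "continuous_on {0..1} (q e)"
      using q[OF e] r[OF e'] by (auto simp: is_lift_def path_def)
    have bottom: "Re (winding_number (\<lambda>x. ?F x 0) 0) = b e' (tail G e)"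
      by (simp add: b_def q0[OF e])
    have left: "Re (winding_number (?F 0) 0) = t (tail H e') e"
      by (simp add: t_def r0[OF e'])
    have top: "Re (winding_number (\<lambda>x. ?F x 1) 0) = b e' (head G e) + Q e $ 2 * D' e' $ 1"
    proof -
      have eq: "r e' x - q e 1 = (r e' x - P (head G e)) + - Q e" for x
        by (simp add: q1[OF e])
      have "continuous_on {0..1} (\<lambda>x. r e' x - P (head G e))"
        by (intro continuous_intros cr)
      from winding_number_quasi_sine_plane_shift[OF this uminus_int_vectors[OF Q[OF e]]]
      show ?thesis
        using nz[of _ 1] D(2)[OF e'] unfolding eq by (simp add: b_def)
    qed
    have right: "Re (winding_number (?F 1) 0) = t (head H e') e + R e' $ 2 * D e $ 1"
    proof -
      have eq: "r e' 1 - q e y = (P' (head H e') - q e y) + R e'" for y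
        by (simp add: r1[OF e'])
      have "continuous_on {0..1} (\<lambda>y. P' (head H e') - q e y)"
        by (intro continuous_intros cq)
      moreover have "P' (head H e') - q e y + R e' \<notin> int_vectors" if "y \<in> {0..1}" for y
        using nz[of 1 y] that unfolding eq by simp
      ultimately have w: "winding_number (?F 1) 0 =
          winding_number (\<lambda>y. quasi_sine (plane_to_complex (P' (head H e') - q e y))) 0 -
          of_real (R e' $ 2 * ((P' (head H e') - q e 1) $ 1 - (P' (head H e') - q e 0) $ 1))"
        unfolding eq by (intro winding_number_quasi_sine_plane_shift R e')
      show ?thesis
        unfolding w t_def D(1)[OF e] by (simp add: algebra_simps)
    qed
    have "Re (boundary_winding ?F) = of_bool (e = e')"
      using dual_edge_winding(1)[OF G dual e e' q[OF e] r[OF e']] by simp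
    then show ?thesis
      by (simp add: boundary_winding_def bottom left top right)
  qed
  have finG: "finite (arcs G)"
    using fG by (simp add: fin_digraph.finite_arcs)
  have b0: "(\<Sum>e\<in>arcs G. \<phi> e * (b e' (tail G e) - b e' (head G e))) = 0" for e'
    using circulation_coboundary[OF fG \<phi>, of "b e'"]
    by (simp add: right_diff_distrib sum_subtractf)
  have t0: "(\<Sum>e'\<in>arcs G. c e' * (t (head H e') e - t (tail H e') e)) = 0" for e
    using circulation_coboundary[OF fH c, of "\<lambda>u. t u e"] by (simp add: arcs)
  \<comment> \<open>Integer translations and displacements have the same total against a
    circulation. This is needed since \<open>key\<close> mixes them: horizontal displacements stand
    next to vertical translations.\<close>
  have Phi: "\<Phi> = (\<Sum>e\<in>arcs G. \<phi> e *\<^sub>R Q e)"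
  proof -
    have "\<Phi> = (\<Sum>e\<in>arcs G. \<phi> e *\<^sub>R Q e + \<phi> e *\<^sub>R (P (head G e) - P (tail G e)))"
      unfolding \<Phi>_def by (intro sum.cong) (auto simp flip: D_def simp: D q0 q1 algebra_simps)
    then show ?thesis
      using circulation_coboundary[OF fG \<phi>, of P] by (simp add: sum.distrib)
  qed
  have C: "C = (\<Sum>e\<in>arcs G. c e *\<^sub>R R e)"
  proof -
    have "C = (\<Sum>e\<in>arcs G. c e *\<^sub>R R e + c e *\<^sub>R (P' (head H e) - P' (tail H e)))"
      unfolding C_def by (intro sum.cong) (auto simp flip: D'_def simp: D r0 r1 algebra_simps)
    then show ?thesis
      using circulation_coboundary[OF fH c, of P'] by (simp add: sum.distrib arcs)
  qed
  have expand: "\<phi> e * c e' * of_bool (e = e') =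
      c e' * (\<phi> e * (b e' (tail G e) - b e' (head G e))) +
      \<phi> e * (c e' * (t (head H e') e - t (tail H e') e)) +
      (c e' * R e' $ 2) * (\<phi> e * D e $ 1) - (c e' * D' e' $ 1) * (\<phi> e * Q e $ 2)"
    if "e' \<in> arcs G" "e \<in> arcs G" for e e'
    unfolding key[OF that(2,1)] by (simp add: algebra_simps)
  have "(\<Sum>e\<in>arcs G. \<phi> e * c e) = (\<Sum>e'\<in>arcs G. \<Sum>e\<in>arcs G. \<phi> e * c e' * of_bool (e = e'))"
    by (simp add: finG of_bool_def if_distrib[of "\<lambda>x. _ * x"] sum.delta cong: if_cong)
  also have "\<dots> = (\<Sum>e'\<in>arcs G. \<Sum>e\<in>arcs G.
      c e' * (\<phi> e * (b e' (tail G e) - b e' (head G e))) +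
      \<phi> e * (c e' * (t (head H e') e - t (tail H e') e)) +
      (c e' * R e' $ 2) * (\<phi> e * D e $ 1) - (c e' * D' e' $ 1) * (\<phi> e * Q e $ 2))"
    by (intro sum.cong expand refl)
  also have "\<dots> = (\<Sum>e'\<in>arcs G. \<Sum>e\<in>arcs G. c e' * (\<phi> e * (b e' (tail G e) - b e' (head G e)))) +
      (\<Sum>e'\<in>arcs G. \<Sum>e\<in>arcs G. \<phi> e * (c e' * (t (head H e') e - t (tail H e') e))) +
      (\<Sum>e'\<in>arcs G. c e' * R e' $ 2) * (\<Sum>e\<in>arcs G. \<phi> e * D e $ 1) -
      (\<Sum>e'\<in>arcs G. c e' * D' e' $ 1) * (\<Sum>e\<in>arcs G. \<phi> e * Q e $ 2)"
    by (simp only: sum.distrib sum_subtractf sum_product)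
  also have "(\<Sum>e'\<in>arcs G. \<Sum>e\<in>arcs G. c e' * (\<phi> e * (b e' (tail G e) - b e' (head G e)))) = 0"
    by (simp only: sum_distrib_left[symmetric] b0 mult_zero_right sum.neutral_const)
  also have "(\<Sum>e'\<in>arcs G. \<Sum>e\<in>arcs G. \<phi> e * (c e' * (t (head H e') e - t (tail H e') e))) = 0"
    by (subst sum.swap) (simp only: sum_distrib_left[symmetric] t0 mult_zero_right sum.neutral_const)
  also have "0 + 0 + (\<Sum>e'\<in>arcs G. c e' * R e' $ 2) * (\<Sum>e\<in>arcs G. \<phi> e * D e $ 1) -
      (\<Sum>e'\<in>arcs G. c e' * D' e' $ 1) * (\<Sum>e\<in>arcs G. \<phi> e * Q e $ 2) = C $ 2 * \<Phi> $ 1 - C $ 1 * \<Phi> $ 2"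
  proof -
    have "C $ 2 = (\<Sum>e'\<in>arcs G. c e' * R e' $ 2)" "\<Phi> $ 2 = (\<Sum>e\<in>arcs G. \<phi> e * Q e $ 2)"
      unfolding C Phi by simp_all
    moreover have "C $ 1 = (\<Sum>e'\<in>arcs G. c e' * D' e' $ 1)" "\<Phi> $ 1 = (\<Sum>e\<in>arcs G. \<phi> e * D e $ 1)"
      unfolding C_def \<Phi>_def D_def D'_def by simp_all
    ultimately show ?thesis
      by simp
  qed
  finally show ?thesis .
qed

section \<open>Homology classes of closed walks\<close>

lemma infdist_translation_invariant:
  fixes A :: "'a::euclidean_space set"
  assumes "closed A" "A \<noteq> {}" "\<And>x. x \<in> A \<Longrightarrow> x + v \<in> A" "\<And>x. x \<in> A \<Longrightarrow> x - v \<in> A"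
  shows "infdist (x + v) A = infdist x A"
proof -
  have le: "infdist (x + v) A \<le> infdist x A" if "\<And>x. x \<in> A \<Longrightarrow> x + v \<in> A" for x v
  proof -
    obtain y where y: "y \<in> A" "infdist x A = dist x y"
      using infdist_attains_inf[OF assms(1,2)] .
    have "infdist (x + v) A \<le> dist (x + v) (y + v)"
      by (intro infdist_le that y)
    then show ?thesis
      using y by simp
  qed
  show ?thesis
    using le[of v x] le[of "- v" "x + v"] assms(3,4) by simp
qed

text \<open>Rotation by a right angle keeps integer entries. For an integer vector \<open>a\<close>
  it thus gives a lattice translation along the level lines of the form
  \<open>a \<bullet> x\<close>.\<close>

definition quarter_turn :: "real^2 \<Rightarrow> real^2" where
  "quarter_turn a = vector [- a $ 2, a $ 1]"

lemma inner_plane: "x \<bullet> y = x $ 1 * y $ 1 + x $ 2 * y $ 2" for x y :: "real^2"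
  by (simp add: inner_vec_def sum_2)

lemma inner_quarter_turn: "a \<bullet> quarter_turn a = 0" "quarter_turn a \<bullet> quarter_turn a = a \<bullet> a"
  by (simp_all add: inner_plane quarter_turn_def)

lemma inner_quarter_turn_decomp:
  "(a \<bullet> a) * (x \<bullet> x) = (a \<bullet> x)\<^sup>2 + (quarter_turn a \<bullet> x)\<^sup>2"
  by (simp add: inner_plane quarter_turn_def power2_eq_square algebra_simps)

lemma bounded_rectangle:
  fixes a :: "real^2"
  assumes "a \<noteq> 0"
  shows "bounded {x. \<bar>a \<bullet> x\<bar> \<le> \<beta> \<and> \<bar>quarter_turn a \<bullet> x\<bar> \<le> \<delta>}"
  unfolding bounded_iff
proof (intro exI ballI)
  fix x assume x: "x \<in> {x. \<bar>a \<bullet> x\<bar> \<le> \<beta> \<and> \<bar>quarter_turn a \<bullet> x\<bar> \<le> \<delta>}"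
  have "(a \<bullet> x)\<^sup>2 \<le> \<beta>\<^sup>2" "(quarter_turn a \<bullet> x)\<^sup>2 \<le> \<delta>\<^sup>2"
    using x by (auto intro!: abs_le_square_iff[THEN iffD1])
  then have "(a \<bullet> a) * (x \<bullet> x) \<le> \<beta>\<^sup>2 + \<delta>\<^sup>2"
    by (simp add: inner_quarter_turn_decomp)
  then have "x \<bullet> x \<le> (\<beta>\<^sup>2 + \<delta>\<^sup>2) / (a \<bullet> a)"
    using assms by (simp add: pos_le_divide_eq mult.commute)
  then show "norm x \<le> sqrt ((\<beta>\<^sup>2 + \<delta>\<^sup>2) / (a \<bullet> a))"
    by (simp add: norm_eq_sqrt_inner)
qed

text \<open>Points of \<open>C\<close> tending to infinity are moved by multiples of the period into
  a compact piece of \<open>L\<close>, where they accumulate. Two of them then lie in one ball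
  inside \<open>U\<close> although they were moved by different multiples, and the ball joins
  \<open>C\<close> to a translate of one of its points.\<close>

lemma periodic_unbounded_connected_returns:
  fixes U :: "(real^2) set"
  assumes U: "open U" and period: "\<And>x m. x \<in> U \<Longrightarrow> x + real_of_int m *\<^sub>R quarter_turn a \<in> U"
    and a: "a \<noteq> 0" and C: "topological_space_class.connected C" "C \<subseteq> L" "\<not> bounded C"
    and L: "closed L" "L \<subseteq> U" "\<And>x m. x \<in> L \<Longrightarrow> x + real_of_int m *\<^sub>R quarter_turn a \<in> L"
    and strip: "\<And>x. x \<in> L \<Longrightarrow> \<bar>a \<bullet> x\<bar> \<le> \<beta>"
  obtains x m where "m \<noteq> 0" "connected_component U x (x + real_of_int m *\<^sub>R quarter_turn a)"
proof -
  define b where "b = quarter_turn a"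
  have bb: "b \<bullet> b > 0" and ab: "a \<bullet> b = 0"
    using a by (simp_all add: b_def inner_quarter_turn)
  have "\<forall>n::nat. \<exists>x\<in>C. norm x > n"
    using C(3) unfolding bounded_iff by (meson not_le)
  then obtain x where x: "\<And>n. x n \<in> C" "\<And>n. norm (x n) > real n"
    by metis
  define m where "m n = \<lfloor>(b \<bullet> x n) / (b \<bullet> b)\<rfloor>" for n
  define y where "y n = x n - of_int (m n) *\<^sub>R b" for n
  define Y where "Y = L \<inter> {x. \<bar>a \<bullet> x\<bar> \<le> \<beta> \<and> \<bar>b \<bullet> x\<bar> \<le> b \<bullet> b}"
  have yL: "y n \<in> L" for n
    using L(3)[of "x n" "- m n"] x(1)[of n] C(2) by (auto simp: y_def b_def)
  have "\<bar>b \<bullet> y n\<bar> \<le> b \<bullet> b" for n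
  proof -
    have "b \<bullet> y n = (b \<bullet> b) * ((b \<bullet> x n) / (b \<bullet> b) - of_int (m n))"
      using bb by (simp add: y_def inner_diff_right right_diff_distrib)
    also have "(b \<bullet> x n) / (b \<bullet> b) - of_int (m n) = frac ((b \<bullet> x n) / (b \<bullet> b))"
      by (simp add: m_def frac_def)
    finally show ?thesis
      using bb frac_lt_1[of "(b \<bullet> x n) / (b \<bullet> b)"] frac_ge_0[of "(b \<bullet> x n) / (b \<bullet> b)"]
      by (simp add: abs_mult)
  qed
  then have yY: "y n \<in> Y" for n
    using yL strip by (auto simp: Y_def)
  have "bounded {x. \<bar>a \<bullet> x\<bar> \<le> \<beta> \<and> \<bar>b \<bullet> x\<bar> \<le> b \<bullet> b}"
    unfolding b_def by (rule bounded_rectangle[OF a])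
  then have bY: "bounded Y"
    unfolding Y_def by (rule bounded_subset) auto
  moreover have "closed Y"
    unfolding Y_def
    by (intro closed_Int L closed_Collect_conj closed_Collect_le continuous_intros)
  ultimately have "compact Y"
    by (simp add: compact_eq_bounded_closed)
  then obtain l r where l: "l \<in> Y" and r: "strict_mono r" and lim: "(y \<circ> r) \<longlonglongrightarrow> l"
    using yY unfolding compact_def by blast
  have "l \<in> U"
    using l L(2) by (auto simp: Y_def)
  then obtain \<epsilon> where \<epsilon>: "\<epsilon> > 0" "ball l \<epsilon> \<subseteq> U"
    using U open_contains_ball by blast
  have "eventually (\<lambda>n. (y \<circ> r) n \<in> ball l \<epsilon>) sequentially"
    using topological_tendstoD[OF lim, of "ball l \<epsilon>"] \<epsilon>(1) by auto
  then obtain N where N: "\<And>n. n \<ge> N \<Longrightarrow> y (r n) \<in> ball l \<epsilon>"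
    unfolding eventually_sequentially by auto
  obtain K where "\<forall>x\<in>Y. norm x \<le> K"
    using bY unfolding bounded_iff ..
  then have K: "norm x \<le> K" if "x \<in> Y" for x
    using that by simp
  have "\<exists>n\<ge>N. m (r n) \<noteq> m (r N)"
  \<comment> \<open>A constant multiple would keep \<open>x (r n)\<close> bounded, since
    \<open>y\<close> stays in the bounded set \<open>Y\<close>; \<open>n\<close> is taken large
    enough to exceed that bound.\<close>
  proof (rule ccontr)
    assume neg: "\<not> ?thesis"
    define n where "n = max N (nat \<lceil>K + norm (of_int (m (r N)) *\<^sub>R b)\<rceil>)"
    have "N \<le> n"
      by (simp add: n_def)
    with neg have "m (r n) = m (r N)"
      by blast
    then have "x (r n) = y (r n) + of_int (m (r N)) *\<^sub>R b"
      by (simp add: y_def)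
    then have "norm (x (r n)) \<le> K + norm (of_int (m (r N)) *\<^sub>R b)"
      using K[OF yY[of "r n"]] norm_triangle_ineq[of "y (r n)" "of_int (m (r N)) *\<^sub>R b"] by simp
    also have "\<dots> \<le> n"
      unfolding n_def by linarith
    also have "n \<le> r n"
      by (rule seq_suble[OF r])
    finally show False
      using x(2)[of "r n"] by simp
  qed
  then obtain n where n: "n \<ge> N" "m (r n) \<noteq> m (r N)" by blast
  define i j where "i = r N" and "j = r n"
  \<comment> \<open>The ball is moved back by the multiple of \<open>x i\<close>. It then contains
    \<open>x i\<close> itself, but \<open>x j\<close> only after translation by
    \<open>m i - m j\<close> periods.\<close>
  define B where "B = (\<lambda>x. x + of_int (m i) *\<^sub>R b) ` ball l \<epsilon>"
  have yi: "y i \<in> ball l \<epsilon>" and yj: "y j \<in> ball l \<epsilon>"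
    using N[of N] N[OF n(1)] by (simp_all add: i_def j_def)
  have xi: "x i \<in> B"
    unfolding B_def by (rule image_eqI[OF _ yi]) (simp add: y_def)
  have xj: "x j + of_int (m i - m j) *\<^sub>R b \<in> B"
    unfolding B_def by (rule image_eqI[OF _ yj]) (simp add: y_def algebra_simps)
  have "topological_space_class.connected B"
    unfolding B_def by (intro connected_continuous_image continuous_intros) simp
  then have "topological_space_class.connected (C \<union> B)"
    using C(1) x(1)[of i] xi by (intro connected_Un) auto
  moreover have "C \<union> B \<subseteq> U"
    using C(2) L(2) \<epsilon>(2) period by (auto simp: B_def b_def)
  ultimately have "connected_component U (x j) (x j + of_int (m i - m j) *\<^sub>R b)"
    using x(1)[of j] xj by (intro connected_componentI[of "C \<union> B"]) auto
  then show ?thesis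
    using n(2) by (intro that[of "m i - m j" "x j"]) (auto simp: i_def j_def b_def)
qed

text \<open>The points equidistant from \<open>A\<close> and \<open>B\<close> separate left from right, hence so does one of their
  components. It is unbounded but lies in a strip, so it comes close to a translate of itself.\<close>

lemma separating_strip_returns:
  fixes A B :: "(real^2) set"
  assumes A: "closed A" "A \<noteq> {}" and B: "closed B" "B \<noteq> {}" and AB: "A \<inter> B = {}" and a: "a \<noteq> 0"
    and period: "\<And>x m. x \<in> A \<Longrightarrow> x + real_of_int m *\<^sub>R quarter_turn a \<in> A"
      "\<And>x m. x \<in> B \<Longrightarrow> x + real_of_int m *\<^sub>R quarter_turn a \<in> B"
    and left: "\<And>x. a \<bullet> x < - \<beta> \<Longrightarrow> infdist x A < infdist x B"
    and right: "\<And>x. a \<bullet> x > \<beta> \<Longrightarrow> infdist x B < infdist x A"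
    and \<beta>: "\<beta> \<ge> 0"
  obtains x m where "m \<noteq> 0" "connected_component (- (A \<union> B)) x (x + real_of_int m *\<^sub>R quarter_turn a)"
proof -
  define L where "L = {x. infdist x A = infdist x B}"
  have inv: "infdist (x + real_of_int m *\<^sub>R quarter_turn a) A = infdist x A"
    "infdist (x + real_of_int m *\<^sub>R quarter_turn a) B = infdist x B" for x m
    using period(1)[of _ "- m"] period(2)[of _ "- m"]
    by (auto intro!: infdist_translation_invariant A B period)
  have closedL: "closed L"
    unfolding L_def by (intro closed_Collect_eq continuous_intros)
  have LAB: "L \<subseteq> - (A \<union> B)"
    using AB A B in_closed_iff_infdist_zero[of A] in_closed_iff_infdist_zero[of B]
    by (auto simp: L_def)
  have perL: "x + real_of_int m *\<^sub>R quarter_turn a \<in> L" if "x \<in> L" for x m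
    using that by (simp add: L_def inv)
  have strip: "\<bar>a \<bullet> x\<bar> \<le> \<beta>" if "x \<in> L" for x
  proof -
    have "\<not> a \<bullet> x < - \<beta>" "\<not> a \<bullet> x > \<beta>"
      using that left[of x] right[of x] by (auto simp: L_def)
    then show ?thesis by linarith
  qed
  \<comment> \<open>One point on either side of the strip, with \<open>a \<bullet> x\<close> equal
    to \<open>- (\<beta> + 1)\<close> and \<open>\<beta> + 1\<close>.\<close>
  define xl xr where "xl = (- (\<beta> + 1) / (a \<bullet> a)) *\<^sub>R a" and "xr = ((\<beta> + 1) / (a \<bullet> a)) *\<^sub>R a"
  have axl: "a \<bullet> xl < - \<beta>" and axr: "a \<bullet> xr > \<beta>"
    using a by (simp_all add: xl_def xr_def)
  have "\<not> connected_component (- L) xl xr"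
  proof
    assume "connected_component (- L) xl xr"
    then obtain T where T: "topological_space_class.connected T" "T \<subseteq> - L" "xl \<in> T" "xr \<in> T"
      by (auto simp: connected_component_def)
    have "open {x. infdist x A < infdist x B}" "open {x. infdist x B < infdist x A}"
      by (intro open_Collect_less continuous_intros)+
    moreover have "T \<subseteq> {x. infdist x A < infdist x B} \<union> {x. infdist x B < infdist x A}"
      using T(2) by (auto simp: L_def)
    ultimately have "{x. infdist x A < infdist x B} \<inter> T = {} \<or> {x. infdist x B < infdist x A} \<inter> T = {}"
      using connectedD[OF T(1), of "{x. infdist x A < infdist x B}" "{x. infdist x B < infdist x A}"]
      by fastforce
    then show False
      using T(3,4) left[OF axl] right[OF axr] by blast
  qed
  then obtain C where C: "C \<in> components L" "\<not> connected_component (- C) xl xr"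
    using separation_by_component_closed_pointwise[OF closedL] by blast
  have CL: "C \<subseteq> L"
    by (rule in_components_subset[OF C(1)])
  \<comment> \<open>The half planes beyond the strip are connected, unbounded and disjoint from
    \<open>C\<close>.\<close>
  have half: "\<not> bounded (connected_component_set (- C) x)"
    if S: "S = {x. a \<bullet> x < - \<beta>} \<or> S = {x. a \<bullet> x > \<beta>}" and "x \<in> S" for x S
  proof -
    have "convex S"
      using S convex_halfspace_lt convex_halfspace_gt by metis
    then have "S \<subseteq> connected_component_set (- C) x"
      using S \<open>x \<in> S\<close> CL strip by (intro connected_component_maximal convex_connected) fastforce+
    moreover have "\<not> bounded S"
    proof
      assume "bounded S"
      then obtain K where K: "\<forall>y\<in>S. norm y \<le> K"
        unfolding bounded_iff ..
      \<comment> \<open>Chosen to exceed both \<open>\<beta>\<close>, which puts \<open>y\<close>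
        into \<open>S\<close>, and the Cauchy-Schwarz bound for \<open>a \<bullet> y\<close> that
        follows from \<open>norm y \<le> K\<close>.\<close>
      define s where "s = \<bar>K\<bar> * norm a + \<beta> + 1"
      define y where "y = (if S = {x. a \<bullet> x > \<beta>} then s / (a \<bullet> a) else - s / (a \<bullet> a)) *\<^sub>R a"
      have s: "s > \<beta>"
        unfolding s_def by (simp add: add_nonneg_pos)
      have ay: "a \<bullet> y = s \<and> S = {x. a \<bullet> x > \<beta>} \<or> a \<bullet> y = - s \<and> S = {x. a \<bullet> x < - \<beta>}"
        using a S by (auto simp: y_def)
      then have "y \<in> S"
        using s by auto
      then have "norm y \<le> \<bar>K\<bar>"
        using K by force
      moreover have "s \<le> norm a * norm y"
        using Cauchy_Schwarz_ineq2[of a y] ay by auto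
      ultimately have "s \<le> norm a * \<bar>K\<bar>"
        by (meson mult_left_mono norm_ge_zero order_trans)
      then show False
        using \<beta> by (simp add: s_def mult.commute)
    qed
    ultimately show ?thesis
      using bounded_subset by blast
  qed
  \<comment> \<open>The complement of a bounded plane set has only one unbounded component, and it
    would contain both \<open>xl\<close> and \<open>xr\<close>, which \<open>C\<close>
    separates.\<close>
  have "\<not> bounded C"
  proof
    assume "bounded C"
    then have "connected_component_set (- C) xl = connected_component_set (- C) xr"
      using half[OF disjI1[OF HOL.refl], of xl] half[OF disjI2[OF HOL.refl], of xr] axl axr
      by (intro cobounded_unique_unbounded_component) auto
    moreover have "xr \<in> - C"
      using CL strip axr by fastforce
    ultimately show False
      using C(2) connected_component_refl[of xr "- C"] by auto
  qed
  moreover have "open (- (A \<union> B))"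
    using A B by (intro open_Compl closed_Un)
  moreover have "x + real_of_int m *\<^sub>R quarter_turn a \<in> - (A \<union> B)" if "x \<in> - (A \<union> B)" for x m
  proof -
    have "x = (x + real_of_int m *\<^sub>R quarter_turn a) + real_of_int (- m) *\<^sub>R quarter_turn a"
      by simp
    then show ?thesis
      using that period(1)[of "x + real_of_int m *\<^sub>R quarter_turn a" "- m"]
        period(2)[of "x + real_of_int m *\<^sub>R quarter_turn a" "- m"] by auto
  qed
  ultimately show ?thesis
    using periodic_unbounded_connected_returns[OF _ _ a in_components_connected[OF C(1)] CL _ closedL LAB perL strip]
      that by blast
qed

section \<open>Loops in the faces of a cellular embedding\<close>

text \<open>The projected loop stays within one face, and a face is an open disk, whose inclusion
  into the torus lifts to the plane. The loop therefore has a closed lift, and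
  \<open>\<gamma>\<close> is a translate of it.\<close>

lemma cellular_complement_loop:
  assumes emb: "embedding square H k" and \<gamma>: "path \<gamma>"
    and avoid: "\<And>t. t \<in> {0..1} \<Longrightarrow> torus_proj square (\<gamma> t) \<notin> k ` topspace (graph_space H)"
    and z: "\<gamma> 1 = \<gamma> 0 + z" "z \<in> int_vectors"
  shows "z = 0"
proof -
  define c where "c t = torus_proj square (\<gamma> t)" for t
  define X where "X = subtopology (torus square) (topspace (torus square) - k ` topspace (graph_space H))"
  define F where "F = connected_component_of_set X (c 0)"
  have "continuous_map (top_of_set {0..1}) (torus square) c"
    unfolding c_def by (rule continuous_map_torus_proj_compose) (use \<gamma> in \<open>simp add: path_def\<close>)
  then have cX: "continuous_map (top_of_set {0..1}) X c"
    unfolding X_def using avoid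
    by (intro continuous_map_into_subtopology) (auto simp: c_def topspace_torus)
  have "connectedin (top_of_set {0..1::real}) {0..1}"
    by (simp add: connectedin_subtopology)
  then have "connectedin X (c ` {0..1})"
    by (rule connectedin_continuous_map_image[OF cX])
  then have cF: "c ` {0..1} \<subseteq> F"
    unfolding F_def by (rule connected_component_of_maximal) simp
  have c0: "c 0 \<in> topspace X"
    using continuous_map_funspace[OF cX] by auto
  have "F \<in> faces square H k"
    using c0 by (simp add: faces_def X_def[symmetric] connected_components_of_def F_def)
  then have "subtopology (torus square) F homeomorphic_space top_of_set (ball (0 :: real^2) 1)"
    using emb by (simp add: embedding_def)
  then obtain \<phi> \<psi> where h: "homeomorphic_maps (subtopology (torus square) F) (top_of_set (ball (0 :: real^2) 1)) \<phi> \<psi>"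
    unfolding homeomorphic_space_def by blast
  then have \<phi>: "continuous_map (subtopology (torus square) F) (top_of_set (ball (0 :: real^2) 1)) \<phi>"
    and \<psi>: "continuous_map (top_of_set (ball (0 :: real^2) 1)) (subtopology (torus square) F) \<psi>"
    and inv: "\<And>x. x \<in> topspace (subtopology (torus square) F) \<Longrightarrow> \<psi> (\<phi> x) = x"
    by (simp_all add: homeomorphic_maps_def)
  have "continuous_map (top_of_set (ball (0 :: real^2) 1)) (torus square) \<psi>"
    using \<psi> by (simp add: continuous_map_in_subtopology)
  moreover have "contractible (ball (0 :: real^2) 1)"
    by (intro convex_imp_contractible) simp
  ultimately obtain \<psi>' where \<psi>': "continuous_on (ball (0 :: real^2) 1) \<psi>'"
    "\<And>s. s \<in> ball 0 1 \<Longrightarrow> torus_proj square (\<psi>' s) = \<psi> s"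
    using torus_lift_exists by blast
  have cF': "continuous_map (top_of_set {0..1}) (subtopology (torus square) F) c"
    using \<open>continuous_map (top_of_set {0..1}) (torus square) c\<close> cF
    by (intro continuous_map_into_subtopology) auto
  have \<phi>c: "continuous_map (top_of_set {0..1}) (top_of_set (ball (0 :: real^2) 1)) (\<phi> \<circ> c)"
    by (rule continuous_map_compose[OF cF' \<phi>])
  then have cont: "continuous_on {0..1} (\<phi> \<circ> c)" and into: "\<And>t. t \<in> {0..1} \<Longrightarrow> \<phi> (c t) \<in> ball 0 1"
    by (auto simp: continuous_map_in_subtopology image_subset_iff Pi_iff)
  have lift': "torus_proj square (\<psi>' (\<phi> (c t))) = torus_proj square (\<gamma> t)" if "t \<in> {0..1}" for t
  proof -
    have "c t \<in> topspace (subtopology (torus square) F)"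
      using continuous_map_funspace[OF cF'] that by auto
    then show ?thesis
      using \<psi>'(2)[OF into[OF that]] inv by (simp add: c_def)
  qed
  \<comment> \<open>This lift depends on \<open>t\<close> only through \<open>c t\<close>, so it
    takes equal values at 0 and 1 once \<open>c 1 = c 0\<close>.\<close>
  have cont': "continuous_on {0..1} (\<lambda>t. \<psi>' (\<phi> (c t)))"
    using continuous_on_compose2[OF \<psi>'(1) cont] into by (simp add: image_subset_iff)
  have "topological_space_class.connected {0..1::real}"
    by simp
  then obtain z' where z': "\<And>t. t \<in> {0..1} \<Longrightarrow> \<gamma> t = \<psi>' (\<phi> (c t)) + square *v z'"
    using torus_lift_unique[OF _ cont' _ invertible_square lift'] \<gamma> unfolding path_def by blast
  have "torus_proj square (\<gamma> 0) = torus_proj square (\<gamma> 1)"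
    using z by (simp add: torus_proj_square_eq_iff)
  then have "c 1 = c 0"
    by (simp add: c_def)
  then show "z = 0"
    using z'[of 0] z'[of 1] z(1) by simp
qed

lemma closed_int_vectors_level:
  assumes "closed T"
  shows "closed {z \<in> int_vectors. a \<bullet> z - c \<in> T}"
proof -
  have "closed {z :: real^2. \<forall>i. z $ i \<in> \<int>}"
    by (intro closed_Collect_all closed_Collect_neg closed_vimage_Int
        closed_vimage[OF closed_Ints, unfolded vimage_def] continuous_intros)
  moreover have "closed ((\<lambda>z. a \<bullet> z - c) -` T)"
    by (intro closed_vimage assms continuous_intros)
  moreover have "{z \<in> int_vectors. a \<bullet> z - c \<in> T} = {z :: real^2. \<forall>i. z $ i \<in> \<int>} \<inter> (\<lambda>z. a \<bullet> z - c) -` T"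
    by (auto simp: int_vectors_def)
  ultimately show ?thesis
    by (simp add: closed_Int)
qed

text \<open>Rounding down leaves an error of at most 1 in each of the two coordinates, and the norm
  is at most the sum of the errors.\<close>

lemma nearby_int_vector:
  fixes x p :: "real^2"
  obtains z where "z \<in> int_vectors" "norm (x - (p + z)) \<le> 2"
proof
  define z :: "real^2" where "z = (\<chi> i. of_int \<lfloor>x $ i - p $ i\<rfloor>)"
  show "z \<in> int_vectors"
    by (simp add: z_def int_vectors_def)
  have "\<bar>(x - (p + z)) $ i\<bar> \<le> 1" for i
    by (simp add: z_def) linarith
  then have "(\<Sum>i\<in>UNIV. \<bar>(x - (p + z)) $ i\<bar>) \<le> 2"
    using sum_bounded_above[of "UNIV :: 2 set" "\<lambda>i. \<bar>(x - (p + z)) $ i\<bar>" 1] by simp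
  then show "norm (x - (p + z)) \<le> 2"
    using norm_le_l1_cart[of "x - (p + z)"] by linarith
qed

lemma inner_int_vectors: "a \<in> int_vectors \<Longrightarrow> z \<in> int_vectors \<Longrightarrow> a \<bullet> z \<in> \<int>"
  by (simp add: int_vectors_def inner_plane)

lemma quarter_turn_int_vectors: "a \<in> int_vectors \<Longrightarrow> quarter_turn a \<in> int_vectors"
  by (simp add: int_vectors_def quarter_turn_def forall_2)

lemma of_int_scale_int_vectors: "z \<in> int_vectors \<Longrightarrow> of_int m *\<^sub>R z \<in> int_vectors"
  by (simp add: int_vectors_def)

text \<open>The integer \<open>a \<bullet> z - lev p\<close> attached to the lift \<open>\<kappa> p + z\<close> of a point \<open>p\<close> is locally constant on the
  lifted drawing, so its sign splits the lift into two disjoint closed sets \<open>A\<close> and \<open>B\<close>.\<close>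

lemma cellular_no_height_function:
  assumes emb: "embedding square H k"
    and P: "\<And>v. v \<in> verts H \<Longrightarrow> torus_proj square (P v) = k (Vertex v)"
    and q: "\<And>e. e \<in> arcs H \<Longrightarrow> is_lift square (edge_path H k e) (q e)"
    and q0: "\<And>e. e \<in> arcs H \<Longrightarrow> q e 0 = P (tail H e)"
    and q1: "\<And>e. e \<in> arcs H \<Longrightarrow> q e 1 = P (head H e) + Q e"
    and Q: "\<And>e. e \<in> arcs H \<Longrightarrow> Q e \<in> int_vectors"
    and a: "a \<in> int_vectors"
    and w: "\<And>v. w v \<in> \<int>" "\<And>e. e \<in> arcs H \<Longrightarrow> a \<bullet> Q e = w (head H e) - w (tail H e)"
  shows "a = 0"
proof (rule ccontr)
  assume a0: "a \<noteq> 0"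
  have dH: "drawing square H k"
    using emb by (simp add: embedding_def)
  then have "fin_digraph H"
    by (simp add: drawing_def)
  interpret fin_digraph H by fact
  let ?gp = "graph_points H"
  have top: "topspace (graph_space H) = ?gp"
    by (rule topspace_graph_space[OF wf_digraph_axioms])
  \<comment> \<open>A choice of one lift for each point of the graph, in general discontinuous at
    the heads of edges. The level of an edge is that of its tail; the jump at the head is
    compensated by the equation for \<open>w\<close>.\<close>
  define \<kappa> where "\<kappa> p = (case p of Vertex v \<Rightarrow> P v | Interior e t \<Rightarrow> q e t)" for p
  define lev where "lev p = (case p of Vertex v \<Rightarrow> w v | Interior e t \<Rightarrow> w (tail H e))" for p
  have \<kappa>: "torus_proj square (\<kappa> p) = k p" if "p \<in> ?gp" for p
  proof (cases p)
    case (Vertex v)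
    then show ?thesis
      using that P by (auto simp: \<kappa>_def graph_points_def)
  next
    case (Interior e t)
    then have "e \<in> arcs H" "0 < t" "t < 1"
      using that by (auto simp: graph_points_def)
    then show ?thesis
      using q[of e] Interior by (auto simp: \<kappa>_def is_lift_def edge_path_def edge_param_def)
  qed
  have lev_int: "lev p \<in> \<int>" for p
    using w(1) by (simp add: lev_def split: graph_point.split)
  define S where "S T = {\<kappa> p + z | p z. p \<in> ?gp \<and> z \<in> int_vectors \<and> a \<bullet> z - lev p \<in> T}" for T
  have closedS: "closed (S T)" if T: "closed T" for T
  proof -
    \<comment> \<open>Closedness is obtained from a finite union of sums of a compact and a closed
      set. Edges are taken with both ends here, although \<open>graph_points\<close> has only their
      interiors.\<close>
    define Z where "Z c = {z \<in> int_vectors. a \<bullet> z - c \<in> T}" for c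
    define V where "V v = (\<Union>x\<in>{P v}. \<Union>y\<in>Z (w v). {x + y})" for v
    define E where "E e = (\<Union>x\<in>q e ` {0..1}. \<Union>y\<in>Z (w (tail H e)). {x + y})" for e
    have Z: "closed (Z c)" for c
      unfolding Z_def by (rule closed_int_vectors_level[OF T])
    have "closed (V v)" for v
      unfolding V_def by (intro compact_closed_sums Z) simp
    moreover have "closed (E e)" if "e \<in> arcs H" for e
      unfolding E_def using q[OF that]
      by (intro compact_closed_sums Z compact_continuous_image) (auto simp: is_lift_def path_def)
    ultimately have "closed ((\<Union>v\<in>verts H. V v) \<union> (\<Union>e\<in>arcs H. E e))"
      by (intro closed_Un closed_UN) auto
    moreover have "S T = (\<Union>v\<in>verts H. V v) \<union> (\<Union>e\<in>arcs H. E e)"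
    proof (intro equalityI subsetI)
      fix x assume "x \<in> S T"
      then obtain p z where p: "p \<in> ?gp" "z \<in> Z (lev p)" "x = \<kappa> p + z"
        by (auto simp: S_def Z_def)
      show "x \<in> (\<Union>v\<in>verts H. V v) \<union> (\<Union>e\<in>arcs H. E e)"
      proof (cases p)
        case (Vertex v)
        then show ?thesis
          using p by (auto simp: V_def \<kappa>_def lev_def graph_points_def)
      next
        case (Interior e t)
        then have "e \<in> arcs H" "t \<in> {0..1}"
          using p(1) by (auto simp: graph_points_def)
        moreover have "x \<in> E e"
          unfolding E_def using Interior p \<open>t \<in> {0..1}\<close>
          by (auto simp: \<kappa>_def lev_def intro!: exI[of _ t] bexI[of _ t] bexI[of _ z])
        ultimately show ?thesis by blast
      qed
    next
      have memS: "\<kappa> p + z \<in> S T" if "p \<in> ?gp" "z \<in> Z (lev p)" for p z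
        using that by (auto simp: S_def Z_def)
      fix x assume "x \<in> (\<Union>v\<in>verts H. V v) \<union> (\<Union>e\<in>arcs H. E e)"
      then consider (V) v where "v \<in> verts H" "x \<in> V v" | (E) e where "e \<in> arcs H" "x \<in> E e"
        by blast
      then show "x \<in> S T"
      proof cases
        case V
        then show ?thesis
          using memS[of "Vertex v"] by (auto simp: V_def \<kappa>_def lev_def graph_points_def)
      next
        case E
        then obtain t z where t: "t \<in> {0..1}" "z \<in> Z (w (tail H e))" "x = q e t + z"
          by (auto simp: E_def)
        consider "t = 0" | "t = 1" | "0 < t" "t < 1"
          using t(1) by fastforce
        then show ?thesis
        proof cases
          case 1
          then show ?thesis
            using memS[of "Vertex (tail H e)" z] E(1) t q0[of e] by (simp add: \<kappa>_def lev_def graph_points_def)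
        next
          case 2
          \<comment> \<open>The head end of a lifted edge is also a lifted vertex, with translation
            \<open>Q e + z\<close>; both descriptions give the same level.\<close>
          have "a \<bullet> (Q e + z) - w (head H e) = a \<bullet> z - w (tail H e)"
            using w(2)[OF E(1)] by (simp add: inner_add_right)
          then have "Q e + z \<in> Z (w (head H e))"
            using t(2) int_vectors_arith(1)[OF Q[OF E(1)]] by (simp add: Z_def)
          then show ?thesis
            using memS[of "Vertex (head H e)" "Q e + z"] E(1) t 2 q1[of e]
            by (simp add: \<kappa>_def lev_def graph_points_def add.assoc)
        next
          case 3
          then show ?thesis
            using memS[of "Interior e t" z] E(1) t by (simp add: \<kappa>_def lev_def graph_points_def)
        qed
      qed
    qed
    ultimately show ?thesis by simp
  qed
  \<comment> \<open>Levels are integers, so at most 0 and at least 1 exhaust all cases while both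
    conditions remain closed.\<close>
  define A where "A = S {..0}"
  define B where "B = S {1..}"
  have covers: "x \<in> A \<union> B" if over: "torus_proj square x \<in> k ` topspace (graph_space H)" for x
  proof -
    obtain p where "p \<in> ?gp" "torus_proj square x = k p"
      using over unfolding top by blast
    then have p: "p \<in> ?gp" "torus_proj square x = torus_proj square (\<kappa> p)"
      using \<kappa> by simp_all
    define z where "z = x - \<kappa> p"
    have z: "z \<in> int_vectors"
      using p(2) unfolding z_def by (metis torus_proj_square_eq_iff)
    have "a \<bullet> z - lev p \<in> \<int>"
      using inner_int_vectors[OF a z] lev_int by simp
    then have "a \<bullet> z - lev p \<in> {..0} \<or> a \<bullet> z - lev p \<in> {1..}"
      by (elim Ints_cases) auto
    moreover have "x = \<kappa> p + z"
      by (simp add: z_def)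
    ultimately show ?thesis
      using p(1) z unfolding A_def B_def S_def by blast
  qed
  have disjoint: "A \<inter> B = {}"
  proof -
    have False if "x \<in> A" "x \<in> B" for x
    proof -
      obtain p z where p: "p \<in> ?gp" "z \<in> int_vectors" "a \<bullet> z - lev p \<le> 0" "x = \<kappa> p + z"
        using \<open>x \<in> A\<close> by (auto simp: A_def S_def)
      obtain p' z' where p': "p' \<in> ?gp" "z' \<in> int_vectors" "a \<bullet> z' - lev p' \<ge> 1" "x = \<kappa> p' + z'"
        using \<open>x \<in> B\<close> by (auto simp: B_def S_def)
      have "torus_proj square (\<kappa> p) = torus_proj square x" "torus_proj square (\<kappa> p') = torus_proj square x"
      proof -
        have "x - \<kappa> p = z" "x - \<kappa> p' = z'"
          using p(4) p'(4) by (metis add_diff_cancel_left')+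
        then show "torus_proj square (\<kappa> p) = torus_proj square x" "torus_proj square (\<kappa> p') = torus_proj square x"
          unfolding torus_proj_square_eq_iff using p(2) p'(2) by simp_all
      qed
      then have "k p = k p'"
        using \<kappa> p(1) p'(1) by simp
      then have "p = p'"
        using emb p(1) p'(1) by (auto simp: embedding_def top inj_on_def)
      then show False
        using p p' by auto
    qed
    then show ?thesis by blast
  qed
  have period: "x + real_of_int m *\<^sub>R quarter_turn a \<in> S T" if xS: "x \<in> S T" for x m T
  proof -
    obtain p z where p: "p \<in> ?gp" "z \<in> int_vectors" "a \<bullet> z - lev p \<in> T" "x = \<kappa> p + z"
      using xS by (auto simp: S_def)
    define z' where "z' = z + real_of_int m *\<^sub>R quarter_turn a"
    have "z' \<in> int_vectors"
      unfolding z'_def by (intro int_vectors_arith p of_int_scale_int_vectors quarter_turn_int_vectors a)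
    moreover have "a \<bullet> z' - lev p \<in> T"
      using p(3) by (simp add: z'_def inner_add_right inner_quarter_turn)
    moreover have "x + real_of_int m *\<^sub>R quarter_turn a = \<kappa> p + z'"
      by (simp add: p z'_def)
    ultimately show ?thesis
      using p(1) unfolding S_def by blast
  qed
  \<comment> \<open>A path from \<open>x\<close> to its translate outside \<open>A\<close> and
    \<open>B\<close> projects to a loop off the drawing, and in a cellular embedding such a loop
    lifts to a closed path.\<close>
  have loop_absurd: False
    if "m \<noteq> 0" "connected_component (- (A \<union> B)) x (x + real_of_int m *\<^sub>R quarter_turn a)" for x m
  proof -
    have "open (- (A \<union> B))"
      unfolding A_def B_def by (intro open_Compl closed_Un closedS) auto
    then have "path_component (- (A \<union> B)) x (x + real_of_int m *\<^sub>R quarter_turn a)"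
      using that(2) open_path_connected_component by metis
    then obtain \<gamma> where \<gamma>: "path \<gamma>" "path_image \<gamma> \<subseteq> - (A \<union> B)" "\<gamma> 0 = x" "\<gamma> 1 = x + real_of_int m *\<^sub>R quarter_turn a"
      unfolding path_component_def pathstart_def pathfinish_def by blast
    have "real_of_int m *\<^sub>R quarter_turn a = 0"
    proof (rule cellular_complement_loop[OF emb \<gamma>(1)])
      show "torus_proj square (\<gamma> t) \<notin> k ` topspace (graph_space H)" if "t \<in> {0..1}" for t
        using covers[of "\<gamma> t"] \<gamma>(2) that unfolding path_image_def by blast
      show "\<gamma> 1 = \<gamma> 0 + real_of_int m *\<^sub>R quarter_turn a"
        by (simp add: \<gamma>)
      show "real_of_int m *\<^sub>R quarter_turn a \<in> int_vectors"
        by (intro of_int_scale_int_vectors quarter_turn_int_vectors a)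
    qed
    then have "quarter_turn a \<bullet> quarter_turn a = 0"
      using that(1) by simp
    then show False
      using a0 by (simp only: inner_quarter_turn inner_eq_zero_iff)
  qed
  show False
  \<comment> \<open>Without vertices both sets are empty and any straight segment gives the
    forbidden loop.\<close>
  proof (cases "verts H = {}")
    case True
    then have "arcs H = {}"
      using wellformed by auto
    then have "- (A \<union> B) = UNIV"
      using True by (auto simp: A_def B_def S_def graph_points_def)
    moreover have "connected_component UNIV 0 (0 + real_of_int 1 *\<^sub>R quarter_turn a)"
      by (rule connected_componentI[of UNIV]) auto
    ultimately show False
      using loop_absurd[of 1 0] by simp
  next
    case False
    then obtain v0 where v0: "v0 \<in> verts H" by blast
    have "compact (P ` verts H)"
      by (intro finite_imp_compact) simp
    moreover have "compact (q e ` {0..1})" if "e \<in> arcs H" for e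
      using q[OF that] by (intro compact_continuous_image) (auto simp: is_lift_def path_def)
    ultimately have "compact (P ` verts H \<union> (\<Union>e\<in>arcs H. q e ` {0..1}))"
      by (intro compact_Un compact_UN) auto
    then have "bounded (P ` verts H \<union> (\<Union>e\<in>arcs H. q e ` {0..1}))"
      by (rule compact_imp_bounded)
    then obtain b1 where b1: "\<forall>x\<in>P ` verts H \<union> (\<Union>e\<in>arcs H. q e ` {0..1}). norm x \<le> b1"
      unfolding bounded_iff ..
    have "bounded (w ` verts H)"
      by (intro finite_imp_bounded) simp
    then obtain b2 where b2: "\<forall>x\<in>w ` verts H. norm x \<le> b2"
      unfolding bounded_iff ..
    have kb: "norm (\<kappa> p) \<le> b1" "\<bar>lev p\<bar> \<le> b2" if "p \<in> ?gp" for p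
      using that b1 b2 by (force simp: graph_points_def \<kappa>_def lev_def)+
    have b10: "b1 \<ge> 0" and b20: "b2 \<ge> 0"
      using kb[of "Vertex v0"] v0 by (auto simp: graph_points_def intro: order_trans[OF norm_ge_zero] order_trans[OF abs_ge_zero])
    \<comment> \<open>Up to \<open>norm a * b1 + b2\<close>, the level of a lifted point agrees with
      the form \<open>a \<bullet> x\<close>. Beyond \<open>\<beta>\<close>, a lift of
      \<open>v0\<close> at distance at most 2 lies in the expected set, where the final 1 secures
      level 1 for \<open>B\<close>; the other set has distance at least 3. The factor 5 leaves room
      for both.\<close>
    define \<beta> where "\<beta> = norm a * (b1 + 5) + b2 + 1"
    have \<beta>: "\<beta> \<ge> 0"
      using b10 b20 by (simp add: \<beta>_def)
    have near: "\<exists>z\<in>int_vectors. norm (x - (P v0 + z)) \<le> 2 \<and> \<bar>a \<bullet> z - a \<bullet> x\<bar> \<le> norm a * (b1 + 2)" for x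
    proof -
      obtain z where z: "z \<in> int_vectors" "norm (x - (P v0 + z)) \<le> 2"
        using nearby_int_vector[of x "P v0"] .
      have "norm (P v0) \<le> b1"
        using kb(1)[of "Vertex v0"] v0 by (simp add: graph_points_def \<kappa>_def)
      then have "norm (z - x) \<le> b1 + 2"
        using z(2) norm_triangle_ineq[of "P v0 + z - x" "- P v0"] by (simp add: norm_minus_commute)
      then have "norm a * norm (z - x) \<le> norm a * (b1 + 2)"
        by (intro mult_left_mono) auto
      moreover have "\<bar>a \<bullet> z - a \<bullet> x\<bar> \<le> norm a * norm (z - x)"
        using Cauchy_Schwarz_ineq2[of a "z - x"] by (simp add: inner_diff_right)
      ultimately show ?thesis
        using z by force
    qed
    have P0: "\<kappa> (Vertex v0) = P v0" "lev (Vertex v0) = w v0" "Vertex v0 \<in> ?gp" "\<bar>w v0\<bar> \<le> b2"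
      using kb(2)[of "Vertex v0"] v0 by (simp_all add: \<kappa>_def lev_def graph_points_def)
    have close: "infdist x (S T) \<le> 2" "S T \<noteq> {}"
      if "\<And>z. z \<in> int_vectors \<Longrightarrow> \<bar>a \<bullet> z - a \<bullet> x\<bar> \<le> norm a * (b1 + 2) \<Longrightarrow> a \<bullet> z - w v0 \<in> T" for x T
    proof -
      obtain z where z: "z \<in> int_vectors" "norm (x - (P v0 + z)) \<le> 2" "\<bar>a \<bullet> z - a \<bullet> x\<bar> \<le> norm a * (b1 + 2)"
        using near[of x] by blast
      have "P v0 + z \<in> S T"
        using that[OF z(1,3)] z(1) P0 unfolding S_def by force
      then show "infdist x (S T) \<le> 2" "S T \<noteq> {}"
        using z(2) by (auto intro: infdist_le2 simp: dist_norm)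
    qed
    have far: "infdist x (S T) > 2"
      if T: "closed T" "S T \<noteq> {}" and ge: "\<And>y. y \<in> S T \<Longrightarrow> norm a * 3 \<le> \<bar>a \<bullet> y - a \<bullet> x\<bar>" for x T
    proof -
      obtain y where y: "y \<in> S T" "infdist x (S T) = dist x y"
        using infdist_attains_inf[OF closedS[OF T(1)] T(2)] .
      have "norm a * 3 \<le> norm a * norm (y - x)"
        using ge[OF y(1)] Cauchy_Schwarz_ineq2[of a "y - x"] by (simp add: inner_diff_right)
      then have "3 \<le> norm (y - x)"
        using a0 by simp
      then show ?thesis
        using y(2) by (simp add: dist_norm norm_minus_commute)
    qed
    have ak: "\<bar>a \<bullet> \<kappa> p\<bar> \<le> norm a * b1" if "p \<in> ?gp" for p
    proof -
      have "norm a * norm (\<kappa> p) \<le> norm a * b1"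
        using kb(1)[OF that] by (intro mult_left_mono) auto
      then show ?thesis
        using Cauchy_Schwarz_ineq2[of a "\<kappa> p"] by linarith
    qed
    have upA: "a \<bullet> y \<le> norm a * b1 + b2" if yA: "y \<in> A" for y
    proof -
      obtain p z where p: "p \<in> ?gp" "a \<bullet> z - lev p \<le> 0" "y = \<kappa> p + z"
        using yA by (auto simp: A_def S_def)
      then show ?thesis
        using ak[OF p(1)] kb(2)[OF p(1)] by (simp add: inner_add_right)
    qed
    have lowB: "a \<bullet> y \<ge> - (norm a * b1 + b2)" if yB: "y \<in> B" for y
    proof -
      obtain p z where p: "p \<in> ?gp" "a \<bullet> z - lev p \<ge> 1" "y = \<kappa> p + z"
        using yB by (auto simp: B_def S_def)
      then show ?thesis
        using ak[OF p(1)] kb(2)[OF p(1)] by (simp add: inner_add_right)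
    qed
    have \<beta>': "\<beta> = norm a * b1 + norm a * 5 + b2 + 1"
      by (simp add: \<beta>_def algebra_simps)
    have na: "norm a \<ge> 0"
      by simp
    have nearA: "infdist x A \<le> 2" "A \<noteq> {}" if x: "a \<bullet> x < - \<beta>" for x
    proof -
      have "a \<bullet> z - w v0 \<in> {..0}" if "\<bar>a \<bullet> z - a \<bullet> x\<bar> \<le> norm a * (b1 + 2)" for z
        using that x P0(4) na unfolding \<beta>' distrib_left atMost_iff by linarith
      then show "infdist x A \<le> 2" "A \<noteq> {}"
        unfolding A_def by (intro close[of x]; blast)+
    qed
    have nearB: "infdist x B \<le> 2" "B \<noteq> {}" if x: "a \<bullet> x > \<beta>" for x
    proof -
      have "a \<bullet> z - w v0 \<in> {1..}" if "\<bar>a \<bullet> z - a \<bullet> x\<bar> \<le> norm a * (b1 + 2)" for z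
        using that x P0(4) na unfolding \<beta>' distrib_left atLeast_iff by linarith
      then show "infdist x B \<le> 2" "B \<noteq> {}"
        unfolding B_def by (intro close[of x]; blast)+
    qed
    have "a \<bullet> ((- (\<beta> + 1) / (a \<bullet> a)) *\<^sub>R a) < - \<beta>" "a \<bullet> (((\<beta> + 1) / (a \<bullet> a)) *\<^sub>R a) > \<beta>"
      using a0 by simp_all
    then have neA: "A \<noteq> {}" and neB: "B \<noteq> {}"
      using nearA(2) nearB(2) by blast+
    have left: "infdist x A < infdist x B" if x: "a \<bullet> x < - \<beta>" for x
    proof -
      have "norm a * 3 \<le> \<bar>a \<bullet> y - a \<bullet> x\<bar>" if "y \<in> B" for y
        using lowB[OF that] x na unfolding \<beta>' by linarith
      then have "infdist x B > 2"
        using neB unfolding B_def by (intro far) auto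
      then show ?thesis
        using nearA(1)[OF x] by linarith
    qed
    have right: "infdist x B < infdist x A" if x: "a \<bullet> x > \<beta>" for x
    proof -
      have "norm a * 3 \<le> \<bar>a \<bullet> y - a \<bullet> x\<bar>" if "y \<in> A" for y
        using upA[OF that] x na unfolding \<beta>' by linarith
      then have "infdist x A > 2"
        using neA unfolding A_def by (intro far) auto
      then show ?thesis
        using nearB(1)[OF x] by linarith
    qed
    have "closed A" "closed B"
      unfolding A_def B_def by (intro closedS; simp)+
    moreover have "\<And>x m. x \<in> A \<Longrightarrow> x + real_of_int m *\<^sub>R quarter_turn a \<in> A"
      "\<And>x m. x \<in> B \<Longrightarrow> x + real_of_int m *\<^sub>R quarter_turn a \<in> B"
      unfolding A_def B_def by (intro period; assumption)+
    ultimately show False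
      using separating_strip_returns[OF _ neA _ neB disjoint a0 _ _ left right \<beta>] loop_absurd by blast
  qed
qed

section \<open>Classes of closed walks and their span\<close>

text \<open>Against a closed walk the displacements may be replaced by the integer translations
  \<open>Q\<close>, because the coboundary of \<open>P\<close> cancels.\<close>

lemma closed_walk_class_int_vectors:
  assumes "drawing square H k" "walk_chain H b b c"
  shows "(\<Sum>e\<in>arcs H. real_of_int (c e) *\<^sub>R dart_displacement square H k (e, True)) \<in> int_vectors"
proof -
  have fin: "fin_digraph H"
    using assms(1) by (simp add: drawing_def)
  then have finarcs: "finite (arcs H)"
    by (rule fin_digraph.finite_arcs)
  obtain P q Q where
    q: "\<And>e. e \<in> arcs H \<Longrightarrow> is_lift square (edge_path H k e) (q e)"
    and q0: "\<And>e. e \<in> arcs H \<Longrightarrow> q e 0 = P (tail H e)"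
    and q1: "\<And>e. e \<in> arcs H \<Longrightarrow> q e 1 = P (head H e) + Q e"
    and Q: "\<And>e. e \<in> arcs H \<Longrightarrow> Q e \<in> int_vectors"
    by (rule drawing_lifts[OF assms(1)]) (rule that; assumption)
  have "(\<Sum>e\<in>arcs H. real_of_int (c e) *\<^sub>R dart_displacement square H k (e, True)) =
      (\<Sum>e\<in>arcs H. real_of_int (c e) *\<^sub>R Q e + real_of_int (c e) *\<^sub>R (P (head H e) - P (tail H e)))"
    by (intro sum.cong HOL.refl)
      (simp add: dart_displacement_lift(1)[OF invertible_square q] q0 q1 algebra_simps)
  also have "\<dots> = (\<Sum>e\<in>arcs H. real_of_int (c e) *\<^sub>R Q e)"
    using circulation_coboundary[OF fin circulation_closed_walk[OF assms(2) finarcs], of P]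
    by (simp add: sum.distrib)
  finally show ?thesis
    using Q by (simp add: int_vectors_def) (metis (mono_tags, lifting) Ints_mult Ints_of_int Ints_sum)
qed

text \<open>If the form \<open>a\<close> vanished on the classes of all closed walks, the integers
  \<open>a \<bullet> Q e\<close> would have an integer potential, which is the height function that
  cellularity excludes.\<close>

lemma cellular_closed_walk_exists:
  assumes emb: "embedding square H k" and a: "a \<in> int_vectors" "a \<noteq> 0"
  obtains b c where "walk_chain H b b c"
    "a \<bullet> (\<Sum>e\<in>arcs H. real_of_int (c e) *\<^sub>R dart_displacement square H k (e, True)) \<noteq> 0"
proof -
  have dH: "drawing square H k"
    using emb by (simp add: embedding_def)
  then have fin: "fin_digraph H"
    by (simp add: drawing_def)
  then have finarcs: "finite (arcs H)"
    by (rule fin_digraph.finite_arcs)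
  obtain P q Q where
    P: "\<And>v. v \<in> verts H \<Longrightarrow> torus_proj square (P v) = k (Vertex v)"
    and q: "\<And>e. e \<in> arcs H \<Longrightarrow> is_lift square (edge_path H k e) (q e)"
    and q0: "\<And>e. e \<in> arcs H \<Longrightarrow> q e 0 = P (tail H e)"
    and q1: "\<And>e. e \<in> arcs H \<Longrightarrow> q e 1 = P (head H e) + Q e"
    and Q: "\<And>e. e \<in> arcs H \<Longrightarrow> Q e \<in> int_vectors"
    by (rule drawing_lifts[OF dH]) (rule that; assumption)
  define D where "D e = dart_displacement square H k (e, True)" for e
  \<comment> \<open>The floor changes no value on edges of \<open>H\<close>; it only moves to type
    \<open>int\<close>, so that the potential obtained is integer-valued too.\<close>
  define x where "x e = \<lfloor>a \<bullet> Q e\<rfloor>" for e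
  have x: "of_int (x e) = a \<bullet> Q e" if "e \<in> arcs H" for e
    using inner_int_vectors[OF a(1) Q[OF that]] by (auto simp: x_def elim: Ints_cases)
  note found = that
  show ?thesis
  proof (rule ccontr)
    assume "\<not> thesis"
    then have zero: "a \<bullet> (\<Sum>e\<in>arcs H. real_of_int (c e) *\<^sub>R D e) = 0" if "walk_chain H b b c" for b c
      using found[OF that] unfolding D_def by blast
    have "(\<Sum>e\<in>arcs H. of_int (c e) * x e) = 0" if walk: "walk_chain H b b c" for b c
    proof -
      have "(\<Sum>e\<in>arcs H. real_of_int (c e) *\<^sub>R D e) =
          (\<Sum>e\<in>arcs H. real_of_int (c e) *\<^sub>R Q e + real_of_int (c e) *\<^sub>R (P (head H e) - P (tail H e)))"
        by (intro sum.cong HOL.refl)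
          (simp add: D_def dart_displacement_lift(1)[OF invertible_square q] q0 q1 algebra_simps)
      also have "\<dots> = (\<Sum>e\<in>arcs H. real_of_int (c e) *\<^sub>R Q e)"
        using circulation_coboundary[OF fin circulation_closed_walk[OF walk finarcs], of P]
        by (simp add: sum.distrib)
      finally have "(\<Sum>e\<in>arcs H. real_of_int (c e) * (a \<bullet> Q e)) = 0"
        using zero[OF walk] by (simp add: inner_sum_right)
      then have "real_of_int (\<Sum>e\<in>arcs H. of_int (c e) * x e) = 0"
        by (simp add: x)
      then show ?thesis
        by (simp only: of_int_eq_0_iff)
    qed
    then obtain u where u: "\<And>e. e \<in> arcs H \<Longrightarrow> x e = u (head H e) - u (tail H e)"
      using potential_exists[OF finarcs, of x] by blast
    have "a = 0"
      by (rule cellular_no_height_function[OF emb P q q0 q1 Q a(1), where w = "\<lambda>v. of_int (u v)"])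
        (simp_all add: x[symmetric] u)
    with a(2) show False ..
  qed
qed

text \<open>A first closed walk of nonzero class comes from a coordinate form. As this class is
  integral, its quarter turn is again an admissible form and yields a second, linearly independent
  class. The vector \<open>d\<close> itself may be real.\<close>

lemma cellular_closed_walks_span:
  assumes emb: "embedding square H k"
    and zero: "\<And>b c. walk_chain H b b c \<Longrightarrow>
      d \<bullet> (\<Sum>e\<in>arcs H. real_of_int (c e) *\<^sub>R dart_displacement square H k (e, True)) = 0"
  shows "d = 0"
proof -
  have dH: "drawing square H k"
    using emb by (simp add: embedding_def)
  define C where "C c = (\<Sum>e\<in>arcs H. real_of_int (c e) *\<^sub>R dart_displacement square H k (e, True))" for c
  have "axis 1 1 \<in> int_vectors" "axis 1 1 \<noteq> (0 :: real^2)"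
    by (simp_all add: axis_eq_0_iff) (simp add: int_vectors_def axis_def)
  then obtain b c where c: "walk_chain H b b c" "axis 1 1 \<bullet> C c \<noteq> 0"
    using cellular_closed_walk_exists[OF emb] unfolding C_def by blast
  have "quarter_turn (C c) \<in> int_vectors"
    unfolding C_def by (intro quarter_turn_int_vectors closed_walk_class_int_vectors[OF dH c(1)])
  moreover have "quarter_turn (C c) \<noteq> 0"
    using c(2) inner_quarter_turn(2)[of "C c"] by (metis inner_eq_zero_iff inner_zero_right)
  ultimately obtain b' c' where c': "walk_chain H b' b' c'" "quarter_turn (C c) \<bullet> C c' \<noteq> 0"
    using cellular_closed_walk_exists[OF emb] unfolding C_def by blast
  have "d $ 1 * C c $ 1 + d $ 2 * C c $ 2 = 0" "d $ 1 * C c' $ 1 + d $ 2 * C c' $ 2 = 0"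
    using zero[OF c(1)] zero[OF c'(1)] unfolding C_def[symmetric] by (simp_all add: inner_plane)
  \<comment> \<open>Cramer's rule: the second factor is the determinant of the two classes.\<close>
  then have "d $ 1 * (quarter_turn (C c) \<bullet> C c') = 0" "d $ 2 * (quarter_turn (C c) \<bullet> C c') = 0"
    unfolding inner_plane quarter_turn_def vector_2 by algebra+
  then show ?thesis
    using c'(2) by (simp add: vec_eq_iff forall_2)
qed

section \<open>Geodesic drawings with prescribed displacements\<close>

lemma continuous_map_discrete_prod:
  assumes "\<And>d. d \<in> S \<Longrightarrow> continuous_map Z Y (\<lambda>z. f (d, z))"
  shows "continuous_map (prod_topology (discrete_topology S) Z) Y f"
  unfolding continuous_map_def
proof (intro conjI allI impI)
  show "f \<in> topspace (prod_topology (discrete_topology S) Z) \<rightarrow> topspace Y"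
    using continuous_map_funspace[OF assms] by fastforce
  fix U assume U: "openin Y U"
  have "\<exists>A B. openin (discrete_topology S) A \<and> openin Z B \<and> d \<in> A \<and> z \<in> B \<and>
      A \<times> B \<subseteq> {x \<in> topspace (prod_topology (discrete_topology S) Z). f x \<in> U}"
    if "(d, z) \<in> {x \<in> topspace (prod_topology (discrete_topology S) Z). f x \<in> U}" for d z
  proof (intro exI conjI)
    have "d \<in> S"
      using that by simp
    then show "openin (discrete_topology S) {d}" "openin Z {z \<in> topspace Z. f (d, z) \<in> U}"
      using openin_continuous_map_preimage[OF assms U] by simp_all
  qed (use that in auto)
  then show "openin (prod_topology (discrete_topology S) Z)
      {x \<in> topspace (prod_topology (discrete_topology S) Z). f x \<in> U}"
    unfolding openin_prod_topology_alt by blast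
qed

definition graph_cells :: "('v, 'e) pre_digraph \<Rightarrow> ('v + 'e) set" where
  "graph_cells G = Inl ` verts G \<union> Inr ` arcs G"

text \<open>A parametrization of the graph by a discrete set times \<open>[0,1]\<close>. Vertices
  get an interval too, collapsed to a point, which keeps the domain a product and covers isolated
  vertices.\<close>

definition cell_param :: "('v, 'e) pre_digraph \<Rightarrow> ('v + 'e) \<times> real \<Rightarrow> ('v, 'e) graph_point" where
  "cell_param G = (\<lambda>(d, t). case d of Inl v \<Rightarrow> Vertex v | Inr e \<Rightarrow> edge_param G e t)"

lemma quotient_map_cell_param:
  assumes "wf_digraph G"
  shows "quotient_map (prod_topology (discrete_topology (graph_cells G)) (top_of_set {0..1})) (graph_space G) (cell_param G)"
    (is "quotient_map ?X _ _")
proof -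
  have cont: "continuous_map ?X (graph_space G) (cell_param G)"
  proof (rule continuous_map_discrete_prod)
    fix d assume "d \<in> graph_cells G"
    then consider v where "v \<in> verts G" "d = Inl v" | e where "e \<in> arcs G" "d = Inr e"
      by (auto simp: graph_cells_def)
    then show "continuous_map (top_of_set {0..1}) (graph_space G) (\<lambda>t. cell_param G (d, t))"
    proof cases
      case 1
      then show ?thesis
        by (simp add: cell_param_def topspace_graph_space[OF assms] graph_points_def)
    next
      case 2
      then show ?thesis
        using continuous_map_edge_param[OF assms, of e] by (simp add: cell_param_def)
    qed
  qed
  have "graph_points G \<subseteq> cell_param G ` topspace ?X"
  proof
    fix p assume p: "p \<in> graph_points G"
    show "p \<in> cell_param G ` topspace ?X"
    proof (cases p)
      case (Vertex v)
      then show ?thesis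
        using p by (intro image_eqI[of _ _ "(Inl v, 0)"]) (auto simp: graph_points_def graph_cells_def cell_param_def)
    next
      case (Interior e t)
      then show ?thesis
        using p by (intro image_eqI[of _ _ "(Inr e, t)"])
          (auto simp: graph_points_def graph_cells_def cell_param_def edge_param_def)
    qed
  qed
  then have surj: "cell_param G ` topspace ?X = topspace (graph_space G)"
    using continuous_map_image_subset_topspace[OF cont] by (simp add: topspace_graph_space[OF assms])
  have "openin (graph_space G) U"
    if U: "U \<subseteq> topspace (graph_space G)" and pre: "openin ?X {x \<in> topspace ?X. cell_param G x \<in> U}" for U
    unfolding openin_graph_space
  proof (intro conjI ballI)
    show "U \<subseteq> graph_points G"
      using U by (simp add: topspace_graph_space[OF assms])
    fix e assume e: "e \<in> arcs G"
    have "continuous_map (top_of_set {0..1}) ?X (\<lambda>t. (Inr e, t))"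
      using e by (intro continuous_map_pairedI) (auto simp: graph_cells_def)
    from openin_continuous_map_preimage[OF this pre]
    show "openin (top_of_set {0..1}) {t \<in> {0..1}. edge_param G e t \<in> U}"
      by (rule back_subst[of "openin _"]) (use e in \<open>auto simp: cell_param_def graph_cells_def\<close>)
  qed
  then show ?thesis
    using surj openin_continuous_map_preimage[OF cont] unfolding quotient_map_def by blast
qed

text \<open>The product of a quotient map with the locally compact Hausdorff interval is again a
  quotient map, so continuity can be checked on each cell.\<close>

lemma continuous_map_graph_homotopy:
  assumes wf: "wf_digraph G"
    and v: "\<And>v. v \<in> verts G \<Longrightarrow> continuous_map (top_of_set {0..1}) Y (\<lambda>s. h (s, Vertex v))"
    and e: "\<And>e. e \<in> arcs G \<Longrightarrow> continuous_map (top_of_set unit_square) Y (\<lambda>(s, t). h (s, edge_param G e t))"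
  shows "continuous_map (prod_topology (top_of_set {0..1}) (graph_space G)) Y h"
proof -
  let ?I = "top_of_set {0..1::real}" and ?D = "discrete_topology (graph_cells G)"
  have "quotient_map (prod_topology ?I (prod_topology ?D ?I)) (prod_topology ?I (graph_space G))
      (\<lambda>(s, x). (s, cell_param G x))"
    by (intro quotient_map_prod_right quotient_map_cell_param wf)
      (auto simp: Hausdorff_space_subtopology compact_space_subtopology
        intro!: compact_imp_locally_compact_space)
  moreover have "continuous_map (prod_topology ?I (prod_topology ?D ?I)) Y (h \<circ> (\<lambda>(s, x). (s, cell_param G x)))"
  proof -
    \<comment> \<open>The discrete factor is moved to the front, where
      \<open>continuous_map_discrete_prod\<close> applies.\<close>
    define h' where "h' = (\<lambda>(d, s, t). h (s, cell_param G (d, t)))"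
    have "continuous_map (prod_topology ?D (prod_topology ?I ?I)) Y h'"
    proof (rule continuous_map_discrete_prod)
      fix d assume "d \<in> graph_cells G"
      then consider w where "w \<in> verts G" "d = Inl w" | a where "a \<in> arcs G" "d = Inr a"
        by (auto simp: graph_cells_def)
      then show "continuous_map (prod_topology ?I ?I) Y (\<lambda>z. h' (d, z))"
      proof cases
        case 1
        have "continuous_map (prod_topology ?I ?I) Y ((\<lambda>s. h (s, Vertex w)) \<circ> fst)"
          by (rule continuous_map_compose[OF continuous_map_fst v[OF 1(1)]])
        then show ?thesis
          by (simp add: h'_def 1 cell_param_def o_def split_def del: prod_topology_subtopology_eu)
      next
        case 2
        then show ?thesis
          using e[OF 2(1)] by (simp add: h'_def cell_param_def split_def)
      qed
    qed
    moreover have "continuous_map (prod_topology ?I (prod_topology ?D ?I)) (prod_topology ?D (prod_topology ?I ?I))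
        (\<lambda>p. (fst (snd p), (fst p, snd (snd p))))"
      by (intro continuous_map_pairedI continuous_map_fst continuous_map_snd
          continuous_map_compose[OF continuous_map_snd continuous_map_fst, unfolded o_def]
          continuous_map_compose[OF continuous_map_snd continuous_map_snd, unfolded o_def])
    ultimately have "continuous_map (prod_topology ?I (prod_topology ?D ?I)) Y
        (h' \<circ> (\<lambda>p. (fst (snd p), (fst p, snd (snd p)))))"
      using continuous_map_compose by blast
    then show ?thesis
      by (simp add: h'_def o_def split_def)
  qed
  ultimately show ?thesis
    by (rule continuous_compose_quotient_map)
qed

text \<open>Changing the displacements by a coboundary means moving each vertex \<open>v\<close> by
  \<open>u v\<close>. The lifted edges are deformed linearly to the straight segments between the
  moved ends, which is a homotopy of the whole drawing.\<close>

lemma geodesic_drawing_exists: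
  assumes d: "drawing square H k"
    and \<delta>: "\<And>e. e \<in> arcs H \<Longrightarrow> \<delta> e = dart_displacement square H k (e, True) + (u (head H e) - u (tail H e))"
  obtains k' where "geodesic_drawing square H k'" "homotopic_drawings square H k' k"
    "\<And>e. e \<in> arcs H \<Longrightarrow> dart_displacement square H k' (e, True) = \<delta> e"
proof -
  have wf: "wf_digraph H"
    by (rule drawing_wf[OF d])
  obtain P q Q where
    P: "\<And>v. v \<in> verts H \<Longrightarrow> torus_proj square (P v) = k (Vertex v)"
    and q: "\<And>e. e \<in> arcs H \<Longrightarrow> is_lift square (edge_path H k e) (q e)"
    and q0: "\<And>e. e \<in> arcs H \<Longrightarrow> q e 0 = P (tail H e)"
    and q1: "\<And>e. e \<in> arcs H \<Longrightarrow> q e 1 = P (head H e) + Q e"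
    and Q: "\<And>e. e \<in> arcs H \<Longrightarrow> Q e \<in> int_vectors"
    by (rule drawing_lifts[OF d]) (rule that; assumption)
  have \<delta>': "\<delta> e = P (head H e) + Q e - P (tail H e) + (u (head H e) - u (tail H e))" if "e \<in> arcs H" for e
    using \<delta>[OF that] by (simp add: dart_displacement_lift(1)[OF invertible_square q[OF that]] q0 q1 that)
  define l where "l e s t = (1 - s) *\<^sub>R q e t + s *\<^sub>R (P (tail H e) + u (tail H e) + t *\<^sub>R \<delta> e)" for e and s t :: real
  define h where "h = (\<lambda>(s, p). case p of Vertex v \<Rightarrow> torus_proj square (P v + s *\<^sub>R u v)
      | Interior e t \<Rightarrow> torus_proj square (l e s t))"
  have h_edge: "h (s, edge_param H e t) = torus_proj square (l e s t)" if e: "e \<in> arcs H" for e s t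
  proof -
    consider "t = 0" | "t = 1" | "t \<noteq> 0" "t \<noteq> 1" by blast
    then show ?thesis
    proof cases
      case 1
      then show ?thesis
        by (simp add: h_def edge_param_def l_def q0[OF e] algebra_simps)
    next
      case 2
      \<comment> \<open>At every time \<open>s\<close>, the deformed edge ends at the moved head up
        to the fixed lattice vector \<open>Q e\<close>, so edges stay attached on the torus.\<close>
      have "l e s 1 = P (head H e) + s *\<^sub>R u (head H e) + Q e"
        by (simp add: l_def q1[OF e] \<delta>'[OF e] algebra_simps)
      then show ?thesis
        using 2 Q[OF e] by (simp add: h_def edge_param_def torus_proj_square_eq_iff)
    qed (simp add: h_def edge_param_def)
  qed
  have cont: "continuous_map (prod_topology (top_of_set {0..1}) (graph_space H)) (torus square) h"
  proof (rule continuous_map_graph_homotopy[OF wf])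
    fix v assume "v \<in> verts H"
    have "continuous_map (top_of_set {0..1}) (torus square) (\<lambda>s. torus_proj square (P v + s *\<^sub>R u v))"
      by (rule continuous_map_torus_proj_compose) (simp add: continuous_intros)
    then show "continuous_map (top_of_set {0..1}) (torus square) (\<lambda>s. h (s, Vertex v))"
      by (simp add: h_def)
  next
    fix e assume e: "e \<in> arcs H"
    have "continuous_on unit_square (\<lambda>z. q e (snd z))"
      using q[OF e] by (auto simp: is_lift_def path_def intro!: continuous_intros elim!: continuous_on_compose2)
    then have "continuous_on unit_square (\<lambda>z. l e (fst z) (snd z))"
      unfolding l_def by (intro continuous_intros)
    then have "continuous_map (top_of_set unit_square) (torus square) (\<lambda>z. torus_proj square (l e (fst z) (snd z)))"
      by (intro continuous_map_torus_proj_compose) simp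
    then show "continuous_map (top_of_set unit_square) (torus square) (\<lambda>(s, t). h (s, edge_param H e t))"
      by (simp add: h_edge[OF e] split_def)
  qed
  define k' where "k' p = h (1, p)" for p
  have "homotopic_with (\<lambda>_. True) (graph_space H) (torus square) (\<lambda>p. h (0, p)) k'"
    unfolding homotopic_with_def using cont by (intro exI[of _ h]) (simp add: k'_def)
  moreover have "k p = h (0, p)" if "p \<in> topspace (graph_space H)" for p
  proof (cases p)
    case (Vertex v)
    then show ?thesis
      using that P by (auto simp: h_def topspace_graph_space[OF wf] graph_points_def)
  next
    case (Interior e t)
    then have "e \<in> arcs H" "0 < t" "t < 1"
      using that by (auto simp: topspace_graph_space[OF wf] graph_points_def)
    then show ?thesis
      using q[of e] Interior by (auto simp: h_def l_def is_lift_def edge_path_def edge_param_def)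
  qed
  ultimately have "homotopic_with (\<lambda>_. True) (graph_space H) (torus square) k k'"
    by (rule homotopic_with_eq) auto
  then have hom: "homotopic_with (\<lambda>_. True) (graph_space H) (torus square) k' k"
    by (simp only: homotopic_with_sym)
  then have dr: "drawing square H k'"
    using d homotopic_with_imp_continuous_maps[OF hom] by (simp add: drawing_def)
  have edge: "edge_path H k' e t = torus_proj square (P (tail H e) + u (tail H e) + t *\<^sub>R \<delta> e)"
    if "e \<in> arcs H" for e t
    using h_edge[OF that, of 1 t] by (simp add: edge_path_def k'_def l_def)
  show ?thesis
  proof (rule that)
    show "geodesic_drawing square H k'"
      unfolding geodesic_drawing_def geodesic_path_def using dr edge by blast
    show "homotopic_drawings square H k' k"
      using hom by (simp add: homotopic_drawings_def)
    fix e assume e: "e \<in> arcs H"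
    have "is_lift square (edge_path H k' e) (\<lambda>t. P (tail H e) + u (tail H e) + t *\<^sub>R \<delta> e)"
      by (auto simp: is_lift_def path_def edge[OF e] intro!: continuous_intros)
    from dart_displacement_lift(1)[OF invertible_square this]
    show "dart_displacement square H k' (e, True) = \<delta> e"
      by simp
  qed
qed

section \<open>Orthogonal reciprocal stresses\<close>

lemma geodesic_drawing_torus_map:
  assumes "geodesic_drawing square G f"
  shows "geodesic_drawing M G (torus_map M \<circ> f)"
proof -
  have "geodesic_path M (edge_path G (torus_map M \<circ> f) e)" if "e \<in> arcs G" for e
  proof -
    obtain x v where "\<forall>t\<in>{0..1}. edge_path G f e t = torus_proj square (x + t *\<^sub>R v)"
      using assms \<open>e \<in> arcs G\<close> unfolding geodesic_drawing_def geodesic_path_def by blast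
    then have "edge_path G (torus_map M \<circ> f) e t = torus_proj M (M *v x + t *\<^sub>R (M *v v))" if "t \<in> {0..1}" for t
      using that by (simp add: edge_path_def torus_map_proj matrix_vector_right_distrib matrix_vector_mult_scaleR)
    then show ?thesis
      unfolding geodesic_path_def by blast
  qed
  then show ?thesis
    using assms drawing_torus_map by (auto simp: geodesic_drawing_def)
qed

lemma equilibrium_stress_torus_map:
  assumes "invertible M" "drawing square G f" "equilibrium_stress square G f \<omega>"
  shows "equilibrium_stress M G (torus_map M \<circ> f) \<omega>"
  unfolding equilibrium_stress_def
proof (intro conjI ballI)
  fix p assume p: "p \<in> verts G"
  let ?S = "{d \<in> darts G. dart_tail G d = p}"
  have "(\<Sum>d\<in>?S. \<omega> (fst d) *\<^sub>R dart_displacement M G (torus_map M \<circ> f) d) =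
      (\<Sum>d\<in>?S. M *v (\<omega> (fst d) *\<^sub>R dart_displacement square G f d))"
    by (intro sum.cong) (auto simp: dart_displacement_torus_map assms matrix_vector_mult_scaleR)
  also have "\<dots> = M *v (\<Sum>d\<in>?S. \<omega> (fst d) *\<^sub>R dart_displacement square G f d)"
    by (rule linear_sum[OF matrix_vector_mul_linear, symmetric])
  also have "\<dots> = 0"
    using assms(3) p by (simp add: equilibrium_stress_def)
  finally show "(\<Sum>d\<in>?S. \<omega> (fst d) *\<^sub>R dart_displacement M G (torus_map M \<circ> f) d) = 0" .
qed (use assms(3) in \<open>simp add: equilibrium_stress_def\<close>)

definition stress_matrix :: "real \<Rightarrow> real \<Rightarrow> real \<Rightarrow> real^2^2" where
  "stress_matrix \<alpha> \<beta> \<gamma> = vector [vector [- \<gamma>, \<alpha>], vector [- \<beta>, \<gamma>]]"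

lemma matrix_vector_mult_2: "M *v x = vector [M $ 1 $ 1 * x $ 1 + M $ 1 $ 2 * x $ 2, M $ 2 $ 1 * x $ 1 + M $ 2 $ 2 * x $ 2]"
  for M :: "real^2^2"
  by (simp add: vec_eq_iff matrix_vector_mult_def forall_2 sum_2)

text \<open>Each coordinate of \<open>\<omega> \<Delta>\<close> is a circulation, to be paired with
  \<open>c\<close>. Its class is taken with the displacements of \<open>h\<close>, but those of
  \<open>g\<close> differ by a coboundary, so the class has entries among \<open>\<alpha>\<close>,
  \<open>\<beta>\<close>, \<open>\<gamma>\<close>.\<close>

lemma dual_circulation_class:
  assumes g: "geodesic_drawing square G g" and h: "embedding square G h"
    and hom: "homotopic_drawings square G g h" and dual: "natural_dual_embedding G h H k"
    and stress: "equilibrium_stress square G g \<omega>"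
    and \<alpha>: "\<alpha> = (\<Sum>e\<in>arcs G. \<omega> e * (dart_displacement square G g (e, True) $ 1)\<^sup>2)"
    and \<beta>: "\<beta> = (\<Sum>e\<in>arcs G. \<omega> e * (dart_displacement square G g (e, True) $ 2)\<^sup>2)"
    and \<gamma>: "\<gamma> = (\<Sum>e\<in>arcs G. \<omega> e * dart_displacement square G g (e, True) $ 1
                               * dart_displacement square G g (e, True) $ 2)"
    and c: "circulation H c"
  shows "(\<Sum>e\<in>arcs G. c e *\<^sub>R \<omega> e *\<^sub>R dart_displacement square G g (e, True)) =
    stress_matrix \<alpha> \<beta> \<gamma> *v (\<Sum>e\<in>arcs G. c e *\<^sub>R dart_displacement square H k (e, True))"
proof -
  define D where "D e = dart_displacement square G g (e, True)" for e
  have dg: "drawing square G g"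
    using g by (simp add: geodesic_drawing_def)
  then have fin: "fin_digraph G"
    by (simp add: drawing_def)
  obtain u where u: "\<And>e. e \<in> arcs G \<Longrightarrow> dart_displacement square G h (e, True) = D e + u (head G e) - u (tail G e)"
    using homotopic_drawings_displacement[OF fin hom] unfolding D_def by blast
  have circ: "circulation G (\<lambda>e. \<omega> e * D e $ i)" for i
    unfolding D_def by (rule equilibrium_stress_circulation[OF dg stress])
  have cls: "(\<Sum>e\<in>arcs G. (\<omega> e * D e $ i) *\<^sub>R dart_displacement square G h (e, True)) =
      (\<Sum>e\<in>arcs G. (\<omega> e * D e $ i) *\<^sub>R D e)" for i
  proof -
    have "(\<Sum>e\<in>arcs G. (\<omega> e * D e $ i) *\<^sub>R dart_displacement square G h (e, True)) =
        (\<Sum>e\<in>arcs G. (\<omega> e * D e $ i) *\<^sub>R D e + (\<omega> e * D e $ i) *\<^sub>R (u (head G e) - u (tail G e)))"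
      by (intro sum.cong HOL.refl) (simp add: u algebra_simps)
    then show ?thesis
      using circulation_coboundary[OF fin circ[of i], of u] by (simp add: sum.distrib)
  qed
  define C where "C = (\<Sum>e\<in>arcs G. c e *\<^sub>R dart_displacement square H k (e, True))"
  have pair: "(\<Sum>e\<in>arcs G. (\<omega> e * D e $ i) * c e) =
      C $ 2 * (\<Sum>e\<in>arcs G. (\<omega> e * D e $ i) * D e $ 1) - C $ 1 * (\<Sum>e\<in>arcs G. (\<omega> e * D e $ i) * D e $ 2)" for i
    using intersection_pairing[OF h dual circ[of i] c] unfolding cls C_def[symmetric] by simp
  have ab: "\<alpha> = (\<Sum>e\<in>arcs G. (\<omega> e * D e $ 1) * D e $ 1)" "\<beta> = (\<Sum>e\<in>arcs G. (\<omega> e * D e $ 2) * D e $ 2)"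
    "\<gamma> = (\<Sum>e\<in>arcs G. (\<omega> e * D e $ 1) * D e $ 2)" "\<gamma> = (\<Sum>e\<in>arcs G. (\<omega> e * D e $ 2) * D e $ 1)"
    by (simp_all add: \<alpha> \<beta> \<gamma> D_def power2_eq_square mult_ac)
  have "(\<Sum>e\<in>arcs G. c e *\<^sub>R \<omega> e *\<^sub>R D e) $ i = (\<Sum>e\<in>arcs G. (\<omega> e * D e $ i) * c e)" for i
    by (simp add: mult_ac)
  then have "(\<Sum>e\<in>arcs G. c e *\<^sub>R \<omega> e *\<^sub>R D e) $ 1 = C $ 2 * \<alpha> - C $ 1 * \<gamma>"
    "(\<Sum>e\<in>arcs G. c e *\<^sub>R \<omega> e *\<^sub>R D e) $ 2 = C $ 2 * \<gamma> - C $ 1 * \<beta>"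
    using pair[of 1] pair[of 2] unfolding ab[symmetric] by simp_all
  then show ?thesis
    unfolding D_def[symmetric] C_def[symmetric]
    by (simp add: vec_eq_iff forall_2 matrix_vector_mult_2 stress_matrix_def algebra_simps del: sum_component)
qed

text \<open>Prescribed displacements belong to a drawing homotopic to \<open>k\<close> exactly if
  they differ from those of \<open>k\<close> by a coboundary, which can be tested on closed walks.
  By \<open>dual_circulation_class\<close> the test says that
  \<open>matrix_inv M ** J ** M ** T\<close> fixes every class \<open>C\<close>.\<close>

lemma orthogonal_reciprocal_stress_iff:
  assumes g: "geodesic_drawing square G g" and h: "embedding square G h"
    and hom: "homotopic_drawings square G g h" and dual: "natural_dual_embedding G h H k"
    and stress: "equilibrium_stress square G g \<omega>"
    and \<alpha>: "\<alpha> = (\<Sum>e\<in>arcs G. \<omega> e * (dart_displacement square G g (e, True) $ 1)\<^sup>2)"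
    and \<beta>: "\<beta> = (\<Sum>e\<in>arcs G. \<omega> e * (dart_displacement square G g (e, True) $ 2)\<^sup>2)"
    and \<gamma>: "\<gamma> = (\<Sum>e\<in>arcs G. \<omega> e * dart_displacement square G g (e, True) $ 1
                               * dart_displacement square G g (e, True) $ 2)"
    and M: "invertible M"
  shows "orthogonal_reciprocal_stress M G (torus_map M \<circ> g) H k \<omega> \<longleftrightarrow> J ** M ** stress_matrix \<alpha> \<beta> \<gamma> = M"
proof -
  define D where "D e = dart_displacement square G g (e, True)" for e
  define D' where "D' e = dart_displacement square H k (e, True)" for e
  define T where "T = stress_matrix \<alpha> \<beta> \<gamma>"
  \<comment> \<open>The dual displacements that the orthogonality condition prescribes on
    \<open>torus M\<close>, carried back to the square torus.\<close>
  define \<delta> where "\<delta> e = matrix_inv M *v (\<omega> e *\<^sub>R (J *v (M *v D e)))" for e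
  let ?g = "torus_map M \<circ> g"
  have dg: "drawing square G g"
    using g by (simp add: geodesic_drawing_def)
  have embH: "embedding square H k" and arcs: "arcs H = arcs G"
    using dual by (auto simp: natural_dual_embedding_def)
  then have dk: "drawing square H k"
    by (simp add: embedding_def)
  then have finH: "fin_digraph H"
    by (simp add: drawing_def)
  then have finarcs: "finite (arcs H)"
    by (rule fin_digraph.finite_arcs)
  have dartsH: "darts H = darts G"
    by (simp add: darts_def arcs)
  have disp_g: "dart_displacement M G ?g (e, True) = M *v D e" if "e \<in> arcs G" for e
    unfolding D_def by (rule dart_displacement_torus_map[OF M dg]) (use that in \<open>simp add: darts_def\<close>)
  have \<delta>_sum: "(\<Sum>e\<in>arcs H. real_of_int (c e) *\<^sub>R \<delta> e) =
      matrix_inv M *v (J *v (M *v (T *v (\<Sum>e\<in>arcs H. real_of_int (c e) *\<^sub>R D' e))))"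
    if walk: "walk_chain H b b c" for b c
  proof -
    have "(\<Sum>e\<in>arcs H. real_of_int (c e) *\<^sub>R \<delta> e) =
        (\<Sum>e\<in>arcs H. (matrix_inv M ** J ** M) *v (real_of_int (c e) *\<^sub>R \<omega> e *\<^sub>R D e))"
      by (simp add: \<delta>_def matrix_vector_mult_scaleR matrix_vector_mul_assoc matrix_mul_assoc)
    also have "\<dots> = (matrix_inv M ** J ** M) *v (\<Sum>e\<in>arcs G. real_of_int (c e) *\<^sub>R \<omega> e *\<^sub>R D e)"
      unfolding arcs by (rule linear_sum[OF matrix_vector_mul_linear, symmetric])
    also have "(\<Sum>e\<in>arcs G. real_of_int (c e) *\<^sub>R \<omega> e *\<^sub>R D e) = T *v (\<Sum>e\<in>arcs H. real_of_int (c e) *\<^sub>R D' e)"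
      unfolding D_def D'_def T_def arcs
      by (rule dual_circulation_class[OF g h hom dual stress \<alpha> \<beta> \<gamma> circulation_closed_walk[OF walk finarcs]])
    finally show ?thesis
      by (simp add: matrix_vector_mul_assoc matrix_mul_assoc)
  qed
  have inv: "matrix_inv M ** M = mat 1" "M ** matrix_inv M = mat 1"
    using someI_ex[OF M[unfolded invertible_def]] by (simp_all add: matrix_inv_def)
  show ?thesis
    unfolding T_def[symmetric]
  proof
    assume "orthogonal_reciprocal_stress M G ?g H k \<omega>"
    then obtain k' where geo: "geodesic_drawing M H k'" and dd: "dual_drawing M H k k'"
      and orth: "\<forall>d\<in>darts G. dart_displacement M H k' d = \<omega> (fst d) *\<^sub>R (J *v dart_displacement M G ?g d)"
      unfolding orthogonal_reciprocal_stress_def by blast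
    let ?k = "torus_map (matrix_inv M) \<circ> k'"
    have dk': "drawing M H k'" and hom': "homotopic_drawings square H ?k k"
      using dd by (simp_all add: dual_drawing_def)
    have disp: "dart_displacement square H ?k (e, True) = \<delta> e" if "e \<in> arcs H" for e
    proof -
      have d: "(e, True) \<in> darts H" "(e, True) \<in> darts G"
        using that by (simp_all add: darts_def arcs)
      show ?thesis
        using dart_displacement_torus_map_inv[OF M dk' d(1)] bspec[OF orth d(2)] disp_g[of e] that
        by (simp add: \<delta>_def arcs)
    qed
    obtain u where u: "\<And>e. e \<in> arcs H \<Longrightarrow> D' e = dart_displacement square H ?k (e, True) + u (head H e) - u (tail H e)"
      using homotopic_drawings_displacement[OF finH hom'] unfolding D'_def by blast
    \<comment> \<open>\<open>W\<close> annihilates the class of every closed walk; these classes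
      span the plane, so each row of \<open>W\<close> is 0.\<close>
    define W where "W = matrix_inv M ** J ** M ** T - mat 1"
    have "W $ i = 0" for i
    proof (rule cellular_closed_walks_span[OF embH])
      fix b c assume walk: "walk_chain H b b c"
      define C where "C = (\<Sum>e\<in>arcs H. real_of_int (c e) *\<^sub>R D' e)"
      have "C = (\<Sum>e\<in>arcs H. real_of_int (c e) *\<^sub>R \<delta> e + real_of_int (c e) *\<^sub>R (u (head H e) - u (tail H e)))"
        unfolding C_def by (intro sum.cong HOL.refl) (simp add: u disp algebra_simps)
      also have "\<dots> = (\<Sum>e\<in>arcs H. real_of_int (c e) *\<^sub>R \<delta> e)"
        using circulation_coboundary[OF finH circulation_closed_walk[OF walk finarcs], of u]
        by (simp add: sum.distrib)
      finally have "W *v C = 0"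
        using \<delta>_sum[OF walk] unfolding C_def[symmetric]
        by (simp add: W_def matrix_vector_mult_diff_rdistrib matrix_vector_mul_assoc matrix_mul_assoc matrix_vector_mul_lid)
      then have "(W *v C) $ i = 0"
        by simp
      then show "W $ i \<bullet> (\<Sum>e\<in>arcs H. real_of_int (c e) *\<^sub>R dart_displacement square H k (e, True)) = 0"
        by (simp add: C_def D'_def matrix_vector_mul_component)
    qed
    then have "W = 0"
      by (simp add: vec_eq_iff)
    then have "matrix_inv M ** J ** M ** T = mat 1"
      by (simp add: W_def)
    then have "M ** (matrix_inv M ** J ** M ** T) = M"
      by (simp add: matrix_mul_rid)
    then show "J ** M ** T = M"
      by (simp add: matrix_mul_assoc inv matrix_mul_lid)
  next
    assume eq: "J ** M ** T = M"
    \<comment> \<open>The prescribed and the actual dual displacements have equal sums over every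
      closed walk, so their difference has a potential in each coordinate.\<close>
    have x0: "(\<Sum>e\<in>arcs H. of_int (c e) * (\<delta> e - D' e) $ i) = 0" if "walk_chain H b b c" for b c i
    proof -
      have "matrix_inv M *v (J *v (M *v (T *v C))) = C" for C
      proof -
        have "matrix_inv M *v (J *v (M *v (T *v C))) = (matrix_inv M ** (J ** M ** T)) *v C"
          by (simp add: matrix_vector_mul_assoc matrix_mul_assoc)
        then show ?thesis
          by (simp add: eq inv matrix_vector_mul_lid)
      qed
      then have "(\<Sum>e\<in>arcs H. real_of_int (c e) *\<^sub>R (\<delta> e - D' e)) = 0"
        using \<delta>_sum[OF that] by (simp add: scaleR_diff_right sum_subtractf)
      then have "(\<Sum>e\<in>arcs H. real_of_int (c e) *\<^sub>R (\<delta> e - D' e)) $ i = 0"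
        by simp
      then show ?thesis
        by simp
    qed
    have "\<exists>u. \<forall>e\<in>arcs H. (\<delta> e - D' e) $ i = u (head H e) - u (tail H e)" for i
    proof (rule potential_exists[OF finarcs, of "\<lambda>e. (\<delta> e - D' e) $ i"])
      show "(\<Sum>e\<in>arcs H. of_int (c e) * (\<delta> e - D' e) $ i) = 0" if "walk_chain H b b c" for b c
        by (rule x0[OF that])
    qed blast
    then obtain u where u: "\<And>i e. e \<in> arcs H \<Longrightarrow> (\<delta> e - D' e) $ i = u i (head H e) - u i (tail H e)"
      by metis
    define U where "U v = (\<chi> i. u i v)" for v
    have "\<delta> e = dart_displacement square H k (e, True) + (U (head H e) - U (tail H e))" if "e \<in> arcs H" for e
      using u[OF that] by (simp add: vec_eq_iff U_def D'_def algebra_simps)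
    then obtain k'' where geo: "geodesic_drawing square H k''" and hom'': "homotopic_drawings square H k'' k"
      and disp: "\<And>e. e \<in> arcs H \<Longrightarrow> dart_displacement square H k'' (e, True) = \<delta> e"
      using geodesic_drawing_exists[OF dk] by blast
    define k' where "k' = torus_map M \<circ> k''"
    have dk'': "drawing square H k''"
      using geo by (simp add: geodesic_drawing_def)
    have dk': "drawing M H k'"
      unfolding k'_def by (rule drawing_torus_map[OF dk''])
    have "torus_map (matrix_inv M) \<circ> k' = k''"
      by (simp add: k'_def fun_eq_iff torus_map_inverse[OF M])
    then have dd: "dual_drawing M H k k'"
      using dk' hom'' by (simp add: dual_drawing_def)
    have disp': "dart_displacement M H k' (e, True) = \<omega> e *\<^sub>R (J *v dart_displacement M G ?g (e, True))"
      if "e \<in> arcs G" for e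
      using dart_displacement_torus_map[OF M dk'', of "(e, True)"] disp[of e] disp_g[OF that] that
      by (simp add: k'_def darts_def arcs \<delta>_def matrix_inv_vector_mult[OF M])
    have dG: "drawing M G ?g"
      by (rule drawing_torus_map[OF dg])
    have "dart_displacement M H k' d = \<omega> (fst d) *\<^sub>R (J *v dart_displacement M G ?g d)" if dart: "d \<in> darts G" for d
    proof -
      obtain e b where d: "d = (e, b)" "e \<in> arcs G"
        using dart by (auto simp: darts_def)
      have "J *v (- x) = - (J *v x)" for x
        by (simp add: matrix_vector_mult_2 vec_eq_iff forall_2)
      then show ?thesis
        using disp'[OF d(2)] dart_displacement_reverse[OF M dk', of e] dart_displacement_reverse[OF M dG, of e] d
        by (cases b) (simp_all add: arcs)
    qed
    moreover have "geodesic_drawing M H k'"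
      unfolding k'_def by (rule geodesic_drawing_torus_map[OF geo])
    ultimately show "orthogonal_reciprocal_stress M G ?g H k \<omega>"
      unfolding orthogonal_reciprocal_stress_def
      using dd geodesic_drawing_torus_map[OF g] equilibrium_stress_torus_map[OF M dg stress] by blast
  qed
qed

section \<open>Solving the matrix equation\<close>

lemma matrix_mul_2: "(A ** B) $ i $ j = A $ i $ 1 * B $ 1 $ j + A $ i $ 2 * B $ 2 $ j" for A B :: "real^2^2"
  by (simp add: matrix_matrix_mult_def sum_2)

lemma matrix_eq_2: "A = B \<longleftrightarrow> A $ 1 $ 1 = B $ 1 $ 1 \<and> A $ 1 $ 2 = B $ 1 $ 2 \<and> A $ 2 $ 1 = B $ 2 $ 1 \<and> A $ 2 $ 2 = B $ 2 $ 2"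
  for A B :: "real^2^2"
  by (auto simp: vec_eq_iff forall_2)

lemma rotation_matrix_2_iff:
  "rotation_matrix R \<longleftrightarrow> R $ 1 $ 1 = R $ 2 $ 2 \<and> R $ 1 $ 2 = - R $ 2 $ 1 \<and> (R $ 1 $ 1)\<^sup>2 + (R $ 2 $ 1)\<^sup>2 = 1"
  for R :: "real^2^2"
proof -
  define a b c d where "a = R $ 1 $ 1" "b = R $ 1 $ 2" "c = R $ 2 $ 1" "d = R $ 2 $ 2"
  have "rotation_matrix R \<longleftrightarrow> a * a + c * c = 1 \<and> a * b + c * d = 0 \<and> b * b + d * d = 1 \<and> a * d - b * c = 1"
    by (auto simp: rotation_matrix_def orthogonal_matrix matrix_eq_2 matrix_mul_2 transpose_def mat_def det_2
        a_b_c_d_def mult.commute)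
  also have "\<dots> \<longleftrightarrow> a = d \<and> b = - c \<and> a\<^sup>2 + c\<^sup>2 = 1"
  proof
    assume *: "a * a + c * c = 1 \<and> a * b + c * d = 0 \<and> b * b + d * d = 1 \<and> a * d - b * c = 1"
    \<comment> \<open>The left side is the sum of the squared entries, which is 2, minus twice the
      determinant 1.\<close>
    then have "(a - d)\<^sup>2 + (b + c)\<^sup>2 = 0"
      by (simp add: power2_eq_square algebra_simps)
    then show "a = d \<and> b = - c \<and> a\<^sup>2 + c\<^sup>2 = 1"
      using * by (simp add: sum_power2_eq_zero_iff power2_eq_square)
  qed (auto simp: power2_eq_square)
  finally show ?thesis
    by (simp add: a_b_c_d_def)
qed

text \<open>Comparing determinants forces \<open>\<alpha> * \<beta> - \<gamma>\<^sup>2 = 1\<close>,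
  as \<open>det J = 1\<close> and \<open>det M\<close> is nonzero. Then \<open>\<beta>\<close> is
  nonzero and the equation determines the second column of \<open>M\<close> from the first, which
  stays free; a free nonzero vector in the plane is a scale factor and a rotation.\<close>

lemma J_stress_matrix_iff:
  assumes M: "invertible M"
  shows "J ** M ** stress_matrix \<alpha> \<beta> \<gamma> = M \<longleftrightarrow> \<alpha> * \<beta> - \<gamma>\<^sup>2 = 1 \<and>
    (\<exists>(R :: real^2^2) \<sigma>. rotation_matrix R \<and> \<sigma> > 0 \<and> M = \<sigma> *\<^sub>R (R ** vector [vector [\<beta>, - \<gamma>], vector [0, 1]]))"
    (is "?L \<longleftrightarrow> ?det \<and> ?R")
proof -
  define a b c d where "a = M $ 1 $ 1" "b = M $ 1 $ 2" "c = M $ 2 $ 1" "d = M $ 2 $ 2"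
  have L: "?L \<longleftrightarrow> c * \<gamma> + d * \<beta> = a \<and> - (c * \<alpha>) - d * \<gamma> = b \<and> - (a * \<gamma>) - b * \<beta> = c \<and> a * \<alpha> + b * \<gamma> = d"
    by (simp add: matrix_eq_2 matrix_mul_2 J_def stress_matrix_def a_b_c_d_def algebra_simps)
  have detM: "det M = a * d - b * c"
    by (simp add: det_2 a_b_c_d_def)
  then have det0: "a * d - b * c \<noteq> 0"
    using M by (simp add: invertible_det_nz)
  have det: ?det if ?L
  proof -
    have "det (J ** M ** stress_matrix \<alpha> \<beta> \<gamma>) = det M"
      using that by simp
    moreover have "det J = 1" "det (stress_matrix \<alpha> \<beta> \<gamma>) = \<alpha> * \<beta> - \<gamma>\<^sup>2"
      by (simp_all add: det_2 J_def stress_matrix_def power2_eq_square)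
    ultimately show ?thesis
      using det0 detM by (simp add: det_mul)
  qed
  have "?L \<longleftrightarrow> ?R" if ?det
  proof
    assume ?L
    with L have eqs: "c * \<gamma> + d * \<beta> = a" "- (c * \<alpha>) - d * \<gamma> = b" "- (a * \<gamma>) - b * \<beta> = c" "a * \<alpha> + b * \<gamma> = d"
      by blast+
    have "\<alpha> * \<beta> = 1 + \<gamma>\<^sup>2"
      using \<open>?det\<close> by simp
    then have "\<alpha> * \<beta> > 0"
      by (simp add: add_pos_nonneg)
    then have \<beta>: "\<beta> \<noteq> 0"
      by auto
    \<comment> \<open>The first column of \<open>M\<close> must be \<open>\<beta>\<close> times that
      of \<open>\<sigma>\<close> times the rotation. A negative \<open>\<beta>\<close> is absorbed
      in the signs of \<open>p\<close> and \<open>q\<close>, so \<open>\<sigma>\<close> can be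
      positive.\<close>
    define p q where "p = a / \<beta>" and "q = c / \<beta>"
    define \<sigma> where "\<sigma> = sqrt (p\<^sup>2 + q\<^sup>2)"
    have "a \<noteq> 0 \<or> c \<noteq> 0"
      using det0 by auto
    then have "p\<^sup>2 + q\<^sup>2 > 0"
      using \<beta> by (simp add: p_def q_def sum_power2_gt_zero_iff)
    then have \<sigma>: "\<sigma> > 0" "\<sigma>\<^sup>2 = p\<^sup>2 + q\<^sup>2"
      by (simp_all add: \<sigma>_def)
    define R :: "real^2^2" where "R = vector [vector [p / \<sigma>, - q / \<sigma>], vector [q / \<sigma>, p / \<sigma>]]"
    have "(p / \<sigma>)\<^sup>2 + (q / \<sigma>)\<^sup>2 = (p\<^sup>2 + q\<^sup>2) / \<sigma>\<^sup>2"
      by (simp only: power_divide add_divide_distrib)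
    then have "(p / \<sigma>)\<^sup>2 + (q / \<sigma>)\<^sup>2 = 1"
      using \<sigma>(1) unfolding \<sigma>(2)[symmetric] by simp
    then have "rotation_matrix R"
      by (simp add: rotation_matrix_2_iff R_def)
    moreover have "b = - p * \<gamma> - q" "d = - q * \<gamma> + p" "a = p * \<beta>" "c = q * \<beta>"
      using eqs(1,3) \<beta> by (auto simp: p_def q_def field_simps)
    then have "M = \<sigma> *\<^sub>R (R ** vector [vector [\<beta>, - \<gamma>], vector [0, 1]])"
      using \<sigma>(1) by (simp add: matrix_eq_2 matrix_mul_2 R_def flip: a_b_c_d_def) (simp add: field_simps)
    ultimately show ?R
      using \<sigma>(1) by blast
  next
    assume ?R
    then obtain R :: "real^2^2" and \<sigma> where R: "rotation_matrix R"
      and M: "M = \<sigma> *\<^sub>R (R ** vector [vector [\<beta>, - \<gamma>], vector [0, 1]])"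
      by blast
    define r s where "r = \<sigma> * R $ 1 $ 1" and "s = \<sigma> * R $ 2 $ 1"
    have "a = r * \<beta>" "c = s * \<beta>" "b = - r * \<gamma> - s" "d = - s * \<gamma> + r"
      using R by (simp_all add: a_b_c_d_def M matrix_mul_2 rotation_matrix_2_iff r_def s_def algebra_simps)
    moreover have "\<alpha> * \<beta> = 1 + \<gamma> * \<gamma>"
      using \<open>?det\<close> by (simp add: power2_eq_square)
    ultimately show ?L
      unfolding L by (auto simp: algebra_simps) algebra+
  qed
  with det show ?thesis by blast
qed

theorem theorem3p1:
  fixes G :: "('v, 'e) pre_digraph"
    and g h :: "('v, 'e) torus_drawing"
    and H :: "((real^2) set set, 'e) pre_digraph"
    and k :: "((real^2) set set, 'e) torus_drawing"
    and \<omega> :: "'e \<Rightarrow> real"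
    and \<alpha> \<beta> \<gamma> :: real
  assumes "geodesic_drawing square G g"
    and "embedding square G h"
    and "homotopic_drawings square G g h"
    and "essentially_simple square G h"
    and "essentially_three_connected square G h"
    and "natural_dual_embedding G h H k"
    and "equilibrium_stress square G g \<omega>"
    and "\<alpha> = (\<Sum>e\<in>arcs G. \<omega> e * (dart_displacement square G g (e, True) $ 1)\<^sup>2)"
    and "\<beta> = (\<Sum>e\<in>arcs G. \<omega> e * (dart_displacement square G g (e, True) $ 2)\<^sup>2)"
    and "\<gamma> = (\<Sum>e\<in>arcs G. \<omega> e * dart_displacement square G g (e, True) $ 1
                               * dart_displacement square G g (e, True) $ 2)"
  shows "(\<alpha> * \<beta> - \<gamma>\<^sup>2 = 1 \<longrightarrow>
           (\<forall>M :: real^2^2. invertible M \<longrightarrow>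
             (orthogonal_reciprocal_stress M G (torus_map M \<circ> g) H k \<omega> \<longleftrightarrow>
              (\<exists>(R :: real^2^2) \<sigma>. rotation_matrix R \<and> \<sigma> > 0 \<and>
                 M = \<sigma> *\<^sub>R (R ** vector [vector [\<beta>, - \<gamma>], vector [0, 1]]))))) \<and>
         (\<alpha> * \<beta> - \<gamma>\<^sup>2 \<noteq> 1 \<longrightarrow>
           (\<forall>M :: real^2^2. invertible M \<longrightarrow>
             \<not> orthogonal_reciprocal_stress M G (torus_map M \<circ> g) H k \<omega>))"
  using orthogonal_reciprocal_stress_iff[OF assms(1-3,6-10)]
    J_stress_matrix_iff[where \<alpha> = \<alpha> and \<beta> = \<beta> and \<gamma> = \<gamma>]
  by blast

end
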